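(* Let $\Omega\subset\mathbb{R}^n$ be a convex domain, let $(Q_i)_{i=1}^N,(m_i)_{i=1}^N\subset\mathbb{Z}_{\ge1}$ and let $u_i:\Omega\to\mathcal{A}_{Q_i}(\mathbb{R}^{m_i})$ for $i=1,\dots,N$. Let $\Omega'\subset\subset\Omega''\subset\subset\overline\Omega$, with $\Omega'$ a convex $A$-weighted domain. Suppose also that $\Gamma\subset\overline\Omega$ is a closed, non-empty subset, and that $\Gamma_1,\dots,\Gamma_N\subset\overline\Omega\setminus\Gamma$ satisfy $\overline{\Gamma_i}\subset\Gamma\cup\Gamma_i$. Suppose there are numbers $k\in\{0,1,2,\dots\}$, $q\in[1,\infty)$, $\beta,\beta_0\in(0,\infty)$, $\beta_1,\dots,\beta_N,\tilde\beta_1,\dots,\tilde\beta_N\in(0,\infty)$, $\mu\in(0,1)$, $\epsilon\in(0,1/4)$ and subsets $\mathfrak{P}_0,\mathfrak{P}_1,\dots,\mathfrak{P}_N,\mathfrak{P}\subset\mathcal{P}_k$ with $\sup_\Omega|P|\le\beta$ for all $P\in\mathfrak{P}_0$, such that: (I) for each $x_0\in\Gamma\cap\overline{\Omega''}$ there exist $P^1_{x_0},\dots,P^N_{x_0}\in\mathfrak{P}_0$ such that for all $0<\sigma\le\rho/2\le\epsilon/2$, $$\sigma^{-n-kq}\int_{B_\sigma(x_0)\cap\Omega}\sum_{i=1}^N\mathcal{G}(u_i,P^i_{x_0})^q\le\beta_0\Big(\frac\sigma\rho\Big)^{q\mu}\rho^{-n-kq}\int_{B_\rho(x_0)\cap\Omega}\sum_{i=1}^N\mathcal{G}(u_i,P^i_{x_0})^q;$$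 (II) for each $i\in\{1,\dots,N\}$ and each $x_1\in\overline{\Omega''}\cap\Gamma_i\setminus\Gamma$ there exists $P^i_{x_1}\in\mathfrak{P}_i$ such that for every $P\in\mathfrak{P}_0$ and every $0<\sigma\le\rho/2\le\frac12\min\{1/4,\mathrm{dist}(x_1,\Gamma)\}$, $$\sigma^{-n-kq}\int_{B_\sigma(x_1)\cap\Omega}\mathcal{G}(u_i,P^i_{x_1})^q\le\beta_i\Big(\frac\sigma\rho\Big)^{q\mu}\rho^{-n-kq}\int_{B_\rho(x_1)\cap\Omega}\mathcal{G}(u_i,P)^q;$$ (III) for each $i\in\{1,\dots,N\}$ and each $x_2\in\overline{\Omega''}\setminus(\Gamma\cup\Gamma_i)$ there exists $P^i_{x_2}\in\mathfrak{P}$ such that for every $P\in\mathfrak{P}_0\cup\mathfrak{P}_i$ and every $0<\sigma\le\rho/2\le\frac12\min\{1/4,\mathrm{dist}(x_2,\Gamma\cup\Gamma_i)\}$, $$\sigma^{-n-kq}\int_{B_\sigma(x_2)\cap\Omega}\mathcal{G}(u_i,P^i_{x_2})^q\le\tilde\beta_i\Big(\frac\sigma\rho\Big)^{q\mu}\rho^{-n-kq}\int_{B_\rho(x_2)\cap\Omega}\mathcal{G}(u_i,P)^q.$$ Then $u_i\in C^{k,\lambda}(\overline{\Omega'};\mathcal{A}_{Q_i}(\mathbb{R}^{m_i}))$ for each $i$, with the estimate $$\|u_i\|_{k,\lambda;\overline{\Omega'}}\le C\Big(\beta^q+\int_{\Omega''}\sum_{i=1}^N|u_i|^q\Big)^{1/q},$$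 where $\lambda,C$ both depend on $n,(m_i)_i,k,q,(Q_i)_i,N,A,\beta_0,(\beta_i)_i,(\tilde\beta_i)_i,\epsilon,\mathrm{dist}(\Omega',\Omega'')$, and $\lambda$ can also depend on $\mu$.
   Context: $\mathcal{A}_Q(\mathbb{R}^m)$ is the set of unordered $Q$-tuples $\sum_{i=1}^Q[\![T_i]\!]$, $T_i\in\mathbb{R}^m$ ($[\![T]\!]$ being the Dirac mass at $T$), with metric $\mathcal{G}(\sum_i[\![R_i]\!],\sum_i[\![T_i]\!])=\min_{\sigma\in S_Q}(\sum_i|R_i-T_{\sigma(i)}|^2)^{1/2}$, where $S_Q$ is the group of permutations of $\{1,\dots,Q\}$; $|T|=\mathcal{G}(T,Q[\![0]\!])$. A $Q$-valued polynomial is $P=\sum_{i=1}^Q[\![p_i]\!]$ with $p_i:\mathbb{R}^n\to\mathbb{R}^m$ having polynomial components, its degree being the maximal degree of these. $\mathcal{P}_k$ denotes the multi-valued polynomials of degree $\le k$; here they are allowed to be $Q_i$-valued into $\mathbb{R}^{m_i}$ for any $i$, and in every expression $\mathcal{G}(u_i,P)$ (including those quantified over $P$) $P$ is understood to be $Q_i$-valued into $\mathbb{R}^{m_i}$. $B_\rho(x)$ is the ball in $\mathbb{R}^n$ of radius $\rho$ centred at $x$. A $Q$-valued function $u=\sum_i[\![u_i]\!]$ is differentiable at $x_0$ if there are $A_1,\dots,A_Q\in\mathbb{R}^{m\times n}$ with $\mathcal{G}(u(x_0+h),\sum_i[\![u_i(x_0)+A_ih]\!])=o(|h|)$ as $h\to0$;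 then $Du(x_0)=\sum_i[\![A_i]\!]$. The space $C^{k,\lambda}(\overline{\Omega'};\mathcal{A}_Q(\mathbb{R}^m))$ is defined from this in the natural way: $u,Du,\dots,D^ku$ exist, extend continuously to $\overline{\Omega'}$, and $D^ku$ is $\lambda$-Hölder for $\mathcal{G}$; $\|u\|_{k,\lambda;\overline{\Omega'}}$ is the corresponding "norm", i.e. the sum of $\sup|D^ju|$, $0\le j\le k$, and the $\lambda$-Hölder seminorm of $D^ku$. A bounded domain $\Omega'$ is $A$-weighted (for $A>0$) if $\mathcal{H}^n(\Omega'\cap B_\rho(x))\ge A\rho^n$ for all $x\in\overline{\Omega'}$ and $\rho\in(0,\mathrm{diam}(\Omega')]$, where $\mathcal{H}^n$ is $n$-dimensional Hausdorff measure. $\Omega'\subset\subset\Omega''\subset\subset\overline\Omega$ means: $\Omega',\Omega''$ are relatively open in $\overline\Omega$, $\overline{\Omega'}$ and $\overline{\Omega''}$ are compact, $\overline{\Omega'}\subset\Omega''$ and $\overline{\Omega''}\subset\overline\Omega$. $\mathrm{dist}(\Omega',\Omega'')$ denotes the distance from $\Omega'$ to $\overline\Omega\setminus\Omega''$.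
   Formalization: C may also depend on a positive lower bound for diam(Ω'); 𝔓_0 must contain a Q_i-valued polynomial into R^{m_i} for each i (the claim fails otherwise); u_i is measurable with |u_i|^q integrable on Ω'', and is in C^{k,λ} after change on a null set. *)

theory Defs
  imports "HOL-Analysis.Analysis"
begin

text \<open>
  Since the target dimensions vary with an index inside the statement, a vector of \<open>\<real>\<^sup>I\<close>
  (\<open>I\<close> a finite index set) is a function that vanishes outside \<open>I\<close>. In particular
  \<open>\<real>\<^sup>m\<close> is \<open>vecs {..<m}\<close>. Unordered tuples are multisets.
\<close>

definition vecs :: "'c set \<Rightarrow> ('c \<Rightarrow> real) set" where
  "vecs I = {T. \<forall>c. c \<notin> I \<longrightarrow> T c = 0}"

definition AQ :: "nat \<Rightarrow> 'c set \<Rightarrow> ('c \<Rightarrow> real) multiset set" where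
  "AQ Q I = {M. size M = Q \<and> set_mset M \<subseteq> vecs I}"

text \<open>The enumerations \<open>R\<close>, \<open>T\<close> of the two tuples are arbitrary; the minimum over the permutations
  does not depend on them. The value is only meaningful for tuples of equal size.\<close>

definition GQ :: "'c set \<Rightarrow> ('c \<Rightarrow> real) multiset \<Rightarrow> ('c \<Rightarrow> real) multiset \<Rightarrow> real" where
  "GQ I M N = Min {sqrt (\<Sum>i<size M. (L2_set (\<lambda>c. (R ! i) c - (T ! \<sigma> i) c) I)\<^sup>2) | R T \<sigma>.
      mset R = M \<and> mset T = N \<and> \<sigma> permutes {..<size M}}"

definition absQ :: "'c set \<Rightarrow> ('c \<Rightarrow> real) multiset \<Rightarrow> real" where
  "absQ I M = GQ I M (replicate_mset (size M) (\<lambda>_. 0))"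

text \<open>\<open>AQ Q I\<close> is a separable metric space, so this is Lebesgue measurability of a map into it.\<close>

definition measurableQ ::
    "nat \<Rightarrow> 'c set \<Rightarrow> (real^'n) set \<Rightarrow> (real^'n \<Rightarrow> ('c \<Rightarrow> real) multiset) \<Rightarrow> bool" where
  "measurableQ Q I S u \<longleftrightarrow>
     (\<forall>T\<in>AQ Q I. (\<lambda>x. GQ I (u x) T) \<in> borel_measurable (lebesgue_on S))"

definition poly_deg_le :: "nat \<Rightarrow> (real^'n \<Rightarrow> real) \<Rightarrow> bool" where
  "poly_deg_le k p \<longleftrightarrow> (\<exists>c :: ('n \<Rightarrow> nat) \<Rightarrow> real.
     \<forall>x. p x = (\<Sum>\<alpha> | sum \<alpha> UNIV \<le> k. c \<alpha> * (\<Prod>b\<in>UNIV. x $ b ^ \<alpha> b)))"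

type_synonym 'n mvfun = "real^'n \<Rightarrow> (nat \<Rightarrow> real) multiset"

text \<open>Multi-valued polynomials of degree at most \<open>k\<close>; each carries the number of its values and its
  target dimension, since \<open>vecs {..<m}\<close> is contained in \<open>vecs {..<m'}\<close> for \<open>m \<le> m'\<close>.\<close>

definition multipolys :: "nat \<Rightarrow> (nat \<times> nat \<times> 'n::finite mvfun) set" where
  "multipolys k = {(Q, m, P). Q \<ge> 1 \<and> m \<ge> 1 \<and>
     (\<exists>ps :: (real^'n \<Rightarrow> nat \<Rightarrow> real) multiset. size ps = Q \<and>
        (\<forall>p\<in>#ps. (\<forall>x. p x \<in> vecs {..<m}) \<and> (\<forall>a<m. poly_deg_le k (\<lambda>x. p x a))) \<and>
        P = (\<lambda>x. image_mset (\<lambda>p. p x) ps))}"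

text \<open>
  Derivatives of order \<open>j\<close> of a map into \<open>\<real>\<^sup>m\<close> lie in \<open>\<real>\<^bsup>m n^j\<^esup>\<close>: the entry at
  \<open>(a, [b\<^sub>1, \<dots>, b\<^sub>j])\<close> is the partial derivative of component \<open>a\<close> in the coordinate directions
  \<open>b\<^sub>j\<close>, \dots, \<open>b\<^sub>1\<close> (innermost first). Thus \<open>D(D\<^sup>ju)\<close> is indexed like \<open>D\<^sup>j\<^sup>+\<^sup>1u\<close>, the direction
  of the new differentiation being the head of the list.
\<close>

type_synonym 'n tensor = "nat \<times> 'n list \<Rightarrow> real"

definition tidx :: "nat \<Rightarrow> nat \<Rightarrow> (nat \<times> 'n list) set" where
  "tidx m j = {(a, bs). a < m \<and> length bs = j}"

definition tensor0 :: "(nat \<Rightarrow> real) \<Rightarrow> 'n tensor" where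
  "tensor0 T = (\<lambda>(a, bs). if bs = [] then T a else 0)"

definition tapp :: "'n::finite tensor \<Rightarrow> real^'n \<Rightarrow> 'n tensor" where
  "tapp A h = (\<lambda>(a, bs). \<Sum>b\<in>UNIV. A (a, b # bs) * h $ b)"

text \<open>The multiset \<open>J\<close> of pairs records which \<open>A\<^sub>i\<close> belongs to which value \<open>f\<^sub>i(x)\<close>.\<close>

definition has_derivQ ::
    "(nat \<times> 'n list) set \<Rightarrow> (real^'n::finite \<Rightarrow> 'n tensor multiset) \<Rightarrow> 'n tensor multiset \<Rightarrow> real^'n \<Rightarrow> bool"
  where
  "has_derivQ I f D x \<longleftrightarrow> (\<exists>J :: ('n tensor \<times> 'n tensor) multiset.
     image_mset fst J = f x \<and> image_mset snd J = D \<and>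
     ((\<lambda>h. GQ I (f (x + h)) (image_mset (\<lambda>(T, A) c. T c + tapp A h c) J) / norm h) \<longlongrightarrow> 0) (at 0))"

definition continuousQ_on ::
    "(real^'n) set \<Rightarrow> 'c set \<Rightarrow> (real^'n \<Rightarrow> ('c \<Rightarrow> real) multiset) \<Rightarrow> bool" where
  "continuousQ_on S I f \<longleftrightarrow> (\<forall>x\<in>S. ((\<lambda>y. GQ I (f y) (f x)) \<longlongrightarrow> 0) (at x within S))"

text \<open>
  \<open>holderQ Q m k \<lambda> S v U\<close>: \<open>v\<close> belongs to \<open>C\<^bsup>k,\<lambda>\<^esup>\<close> of the closure of \<open>S\<close>, with values in the
  \<open>Q\<close>-tuples of \<open>\<real>\<^sup>m\<close>, and \<open>U j\<close> is \<open>D\<^sup>jv\<close>, continuously extended to the closure.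
\<close>

definition holderQ ::
    "nat \<Rightarrow> nat \<Rightarrow> nat \<Rightarrow> real \<Rightarrow> (real^'n) set \<Rightarrow> 'n::finite mvfun \<Rightarrow>
     (nat \<Rightarrow> real^'n \<Rightarrow> 'n tensor multiset) \<Rightarrow> bool" where
  "holderQ Q m k lam S v U \<longleftrightarrow>
     (\<forall>x\<in>closure S. v x \<in> AQ Q {..<m} \<and> U 0 x = image_mset tensor0 (v x)) \<and>
     (\<forall>j\<le>k. \<forall>x\<in>closure S. U j x \<in> AQ Q (tidx m j)) \<and>
     (\<forall>j<k. \<forall>x\<in>interior S. has_derivQ (tidx m j) (U j) (U (Suc j) x) x) \<and>
     (\<forall>j\<le>k. continuousQ_on (closure S) (tidx m j) (U j)) \<and>
     (\<exists>L. \<forall>x\<in>closure S. \<forall>y\<in>closure S.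
        GQ (tidx m k) (U k x) (U k y) \<le> L * dist x y powr lam)"

text \<open>Pairs \<open>x = y\<close> contribute \<open>0 / 0 = 0\<close> to the seminorm.\<close>

definition holder_normQ ::
    "nat \<Rightarrow> nat \<Rightarrow> real \<Rightarrow> (real^'n) set \<Rightarrow> (nat \<Rightarrow> real^'n::finite \<Rightarrow> 'n tensor multiset) \<Rightarrow> real" where
  "holder_normQ m k lam S U =
     (\<Sum>j\<le>k. SUP x\<in>closure S. absQ (tidx m j) (U j x)) +
     (SUP (x, y)\<in>closure S \<times> closure S. GQ (tidx m k) (U k x) (U k y) / dist x y powr lam)"

definition weighted :: "real \<Rightarrow> (real^'n) set \<Rightarrow> bool" where
  "weighted A S \<longleftrightarrow> bounded S \<and>
     (\<forall>x\<in>closure S. \<forall>\<rho>. 0 < \<rho> \<and> \<rho> \<le> diameter S \<longrightarrow>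
        A * \<rho> ^ CARD('n) \<le> measure lebesgue (S \<inter> ball x \<rho>))"

definition nested :: "(real^'n) set \<Rightarrow> (real^'n) set \<Rightarrow> (real^'n) set \<Rightarrow> bool" where
  "nested \<Omega>' \<Omega>'' \<Omega> \<longleftrightarrow>
     openin (top_of_set (closure \<Omega>)) \<Omega>' \<and> openin (top_of_set (closure \<Omega>)) \<Omega>'' \<and>
     compact (closure \<Omega>') \<and> compact (closure \<Omega>'') \<and>
     closure \<Omega>' \<subseteq> \<Omega>'' \<and> closure \<Omega>'' \<subseteq> closure \<Omega>"

text \<open>Unlike \<open>setdist\<close>, this is infinite when one of the sets is empty; here \<open>\<Omega>''\<close> may be all of
  the closure of a bounded \<open>\<Omega>\<close>.\<close>

definition edist_sets :: "(real^'n) set \<Rightarrow> (real^'n) set \<Rightarrow> ennreal" where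
  "edist_sets S T = (INF (x, y)\<in>S \<times> T. ennreal (dist x y))"

text \<open>The quantity \<open>\<sigma>\<^bsup>-n-kq\<^esup> \<integral> g\<close> over \<open>B\<^sub>\<sigma>(x) \<inter> \<Omega>\<close>, possibly infinite.\<close>

definition scaled_int ::
    "(real^'n) set \<Rightarrow> nat \<Rightarrow> real \<Rightarrow> real^'n \<Rightarrow> real \<Rightarrow> (real^'n \<Rightarrow> real) \<Rightarrow> ennreal" where
  "scaled_int \<Omega> k q x \<sigma> g =
     ennreal (\<sigma> powr (- real CARD('n) - real k * q)) *
     (\<integral>\<^sup>+ y \<in> ball x \<sigma> \<inter> \<Omega>. ennreal (g y) \<partial>lebesgue)"

end

theory Submission
  imports Defs "HOL-Combinatorics.Permutations" "HOL-Computational_Algebra.Polynomial"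
begin

text \<open>
  The regularity of \<open>u\<close> is read off from polynomials. Every point \<open>x\<close> of the closure of \<open>\<Omega>'\<close> receives
  one multi-valued polynomial \<open>P\<^sub>x\<close> of degree at most \<open>k\<close> such that, for all \<open>\<sigma> \<le> S\<close>,
  the integral of \<open>\<G>(u, P\<^sub>x)\<^sup>q\<close> over \<open>B\<^sub>\<sigma>(x) \<inter> \<Omega>\<close> is at most \<open>C K\<^sup>q \<sigma>\<^sup>n\<^sup>+\<^sup>k\<^sup>q\<^sup>+\<^sup>q\<^sup>\<mu>\<close>, where
  \<open>K\<^sup>q\<close> is \<open>\<beta>\<^sup>q\<close> plus the integral of \<open>\<Sum>\<bar>u\<^sub>i\<bar>\<^sup>q\<close> over \<open>\<Omega>''\<close> and \<open>C\<close>, \<open>S\<close> do not depend on \<open>x\<close>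
  (\<open>decay_on_closure\<close>). On \<open>\<Gamma>\<close> this is hypothesis (I) started at one fixed radius. At a point of \<open>\<Gamma>\<^sub>i\<close>
  with distance \<open>r\<close> from \<open>\<Gamma>\<close>, hypothesis (II) at radius \<open>r\<close> is applied to the polynomial of the nearest
  point of \<open>\<Gamma>\<close>. For \<open>\<sigma> \<le> r/2\<close> the decay is immediate; for larger \<open>\<sigma>\<close> the two polynomials are shown to be
  close at scale \<open>r\<close>, and the growth of polynomials carries this to scale \<open>\<sigma>\<close> (\<open>near_point_decay\<close>).
  If \<open>r\<close> is not small, any polynomial bounded by \<open>\<beta>\<close> replaces that of the nearest point. Hypothesis (III)
  treats the remaining points in the same way, with \<open>\<Gamma> \<union> \<Gamma>\<^sub>i\<close> for \<open>\<Gamma>\<close>.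

  Two multi-valued polynomials that approximate the same \<open>u\<close> on \<open>B\<^sub>r(x) \<inter> \<Omega>\<close> are compared as follows
  (\<open>comparison_of_approximations\<close>). By Chebyshev's inequality their distance is small on a large part of
  that set. At each of its points some permutation matches the values, so one of the \<open>Q!\<close> permutations
  does so on a set of measure at least \<open>c r\<^sup>n\<close>. A Remez inequality (\<open>remez_ball\<close>) extends the closeness of
  the matched polynomials to the whole ball, and Markov's inequality gives all derivatives, for the same
  permutation. That \<open>B\<^sub>r(x) \<inter> \<Omega>\<close> has measure at least \<open>c r\<^sup>n\<close> follows by shrinking a piece of the weighted
  set \<open>\<Omega>'\<close> towards \<open>x\<close> (\<open>convex_density_near_weighted_subset\<close>).

  Now put \<open>v(x) = P\<^sub>x(x)\<close> and \<open>D\<^sup>jv(x) = D\<^sup>jP\<^sub>x(x)\<close>. Comparing \<open>P\<^sub>x\<close> and \<open>P\<^sub>y\<close> at the scale of \<open>\<bar>x - y\<bar>\<close>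
  shows that \<open>D\<^sup>jP\<^sub>x(y)\<close> and \<open>D\<^sup>jP\<^sub>y(y)\<close> differ by at most \<open>C K \<bar>x - y\<bar>\<^sup>k\<^sup>+\<^sup>\<mu>\<^sup>-\<^sup>j\<close>. For \<open>j < k\<close> the exponent exceeds
  1, which gives differentiability; for \<open>j = k\<close> the tensor \<open>D\<^sup>kP\<^sub>x\<close> is constant, and the estimate is the
  Hoelder condition (locale \<open>jet_field\<close>). Comparing \<open>P\<^sub>x\<close> with \<open>0\<close> bounds its derivatives by \<open>C K\<close>.
  Finally the integral of \<open>\<G>(u, v)\<^sup>q\<close> over \<open>B\<^sub>r(x)\<close> is of smaller order than \<open>r\<^sup>n\<close>, uniformly in \<open>x\<close>, and a
  bounded set is covered by \<open>O(r\<^sup>-\<^sup>n)\<close> such balls, so \<open>v = u\<close> almost everywhere.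

  At each point the decay holds against one polynomial at all scales. No series over dyadic scales is
  summed, the constants stay bounded as \<open>\<mu> \<rightarrow> 0\<close>, and the Hoelder exponent is \<open>\<mu>\<close> itself.
\<close>

section \<open>The metric on unordered tuples\<close>

definition vdist :: "'c set \<Rightarrow> ('c \<Rightarrow> real) \<Rightarrow> ('c \<Rightarrow> real) \<Rightarrow> real" where
  "vdist I x y = L2_set (\<lambda>c. x c - y c) I"

text \<open>Tuples are handled through enumerating lists of equal length. The permutation in the definition of
\<open>GQ\<close> is absorbed by the choice of the second list, and \<open>GQ\<close> is the least \<open>ldist\<close> over all pairs of
enumerations (\<open>GQ_le_ldist\<close>, \<open>GQ_attained\<close>).\<close>

definition ldist :: "'c set \<Rightarrow> ('c \<Rightarrow> real) list \<Rightarrow> ('c \<Rightarrow> real) list \<Rightarrow> real" where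
  "ldist I R T = L2_set (\<lambda>i. vdist I (R ! i) (T ! i)) {..<length R}"

lemma vdist_nonneg [simp]: "0 \<le> vdist I x y"
  by (simp add: vdist_def L2_set_nonneg)

lemma vdist_commute: "vdist I x y = vdist I y x"
  by (simp add: vdist_def L2_set_def power2_commute)

lemma vdist_triangle: "vdist I x z \<le> vdist I x y + vdist I y z"
proof -
  have "vdist I x z = L2_set (\<lambda>c. (x c - y c) + (y c - z c)) I"
    by (simp add: vdist_def)
  also have "\<dots> \<le> vdist I x y + vdist I y z"
    unfolding vdist_def by (rule L2_set_triangle_ineq)
  finally show ?thesis .
qed

lemma component_le_vdist: "finite I \<Longrightarrow> c \<in> I \<Longrightarrow> \<bar>x c - y c\<bar> \<le> vdist I x y"
proof -
  assume "finite I" "c \<in> I"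
  then have "L2_set (\<lambda>c. \<bar>x c - y c\<bar>) I \<ge> \<bar>x c - y c\<bar>"
    by (intro member_le_L2_set)
  then show ?thesis by (simp add: vdist_def L2_set_def)
qed

lemma vdist_le_sum: "vdist I x y \<le> (\<Sum>c\<in>I. \<bar>x c - y c\<bar>)"
  unfolding vdist_def by (rule L2_set_le_sum_abs)

lemma vdist_eq_0_imp_eq:
  assumes "finite I" "vdist I x y = 0" "x \<in> vecs I" "y \<in> vecs I"
  shows "x = y"
proof
  fix c
  show "x c = y c"
    using assms component_le_vdist[of I c x y] by (cases "c \<in> I") (auto simp: vecs_def)
qed

lemma ldist_nonneg [simp]: "0 \<le> ldist I R T"
  by (simp add: ldist_def L2_set_nonneg)

lemma ldist_commute: "length R = length T \<Longrightarrow> ldist I R T = ldist I T R"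
  unfolding ldist_def by (simp add: vdist_commute)

lemma ldist_triangle:
  assumes "length R = length S"
  shows "ldist I R T \<le> ldist I R S + ldist I S T"
proof -
  have "ldist I R T \<le> L2_set (\<lambda>i. vdist I (R ! i) (S ! i) + vdist I (S ! i) (T ! i)) {..<length R}"
    unfolding ldist_def by (intro L2_set_mono) (auto simp: vdist_triangle)
  also have "\<dots> \<le> ldist I R S + ldist I S T"
    unfolding ldist_def assms by (rule L2_set_triangle_ineq)
  finally show ?thesis .
qed

lemma vdist_le_ldist: "i < length R \<Longrightarrow> vdist I (R ! i) (T ! i) \<le> ldist I R T"
  unfolding ldist_def by (rule member_le_L2_set) auto

lemma ldist_le_sum: "ldist I R T \<le> (\<Sum>i<length R. vdist I (R ! i) (T ! i))"
  unfolding ldist_def by (rule L2_set_le_sum) auto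

lemma ldist_permute_list:
  assumes "\<tau> permutes {..<length R}" "length R = length T"
  shows "ldist I (permute_list \<tau> R) (permute_list \<tau> T) = ldist I R T"
proof -
  have "(\<Sum>i<length R. (vdist I (R ! \<tau> i) (T ! \<tau> i))\<^sup>2) = (\<Sum>i<length R. (vdist I (R ! i) (T ! i))\<^sup>2)"
    by (rule sum.permute[OF assms(1), of "\<lambda>i. (vdist I (R ! i) (T ! i))\<^sup>2", symmetric, unfolded comp_def])
  then show ?thesis
    using assms by (simp add: ldist_def L2_set_def permute_list_nth)
qed

lemma ldist_permuted_eq:
  assumes "\<sigma> permutes {..<length R}" "length R = length T"
  shows "sqrt (\<Sum>i<length R. (L2_set (\<lambda>c. (R ! i) c - (T ! \<sigma> i) c) I)\<^sup>2) = ldist I R (permute_list \<sigma> T)"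
  using assms by (simp add: ldist_def L2_set_def vdist_def permute_list_nth)

lemma GQ_set_eq:
  assumes "size M = size N"
  shows "{sqrt (\<Sum>i<size M. (L2_set (\<lambda>c. (R ! i) c - (T ! \<sigma> i) c) I)\<^sup>2) | R T \<sigma>.
      mset R = M \<and> mset T = N \<and> \<sigma> permutes {..<size M}} =
    (\<lambda>(R, T). ldist I R T) ` {(R, T). mset R = M \<and> mset T = N}" (is "?A = ?B")
proof (intro set_eqI iffI)
  fix x assume "x \<in> ?A"
  then obtain R T \<sigma> where *: "mset R = M" "mset T = N" "\<sigma> permutes {..<size M}"
    and x: "x = sqrt (\<Sum>i<size M. (L2_set (\<lambda>c. (R ! i) c - (T ! \<sigma> i) c) I)\<^sup>2)" by blast
  have len: "length R = size M" "length T = size M"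
    using * assms by (auto simp flip: size_mset)
  have "x = ldist I R (permute_list \<sigma> T)"
    using ldist_permuted_eq[of \<sigma> R T I] * len x by simp
  moreover have "mset (permute_list \<sigma> T) = N"
    using * len by simp
  ultimately show "x \<in> ?B" using *(1) by blast
next
  fix x assume "x \<in> ?B"
  then obtain R T where *: "mset R = M" "mset T = N" and x: "x = ldist I R T" by auto
  have len: "length R = size M"
    using * by (auto simp flip: size_mset)
  have "x = sqrt (\<Sum>i<size M. (L2_set (\<lambda>c. (R ! i) c - (T ! id i) c) I)\<^sup>2)"
    by (simp add: x ldist_def L2_set_def vdist_def len)
  then show "x \<in> ?A" using * permutes_id by blast
qed

lemma finite_enumerations: "finite {R. mset R = M}"
proof -
  obtain R where "mset R = M" using ex_mset by blast
  then have "{R. mset R = M} = {T. mset T = mset R}" by simp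
  then show ?thesis using mset_eq_finite by metis
qed

lemma finite_list_pairs: "finite {(R, T). mset R = M \<and> mset T = N}"
proof -
  have "{(R, T). mset R = M \<and> mset T = N} = {R. mset R = M} \<times> {T. mset T = N}" by auto
  then show ?thesis by (simp add: finite_enumerations)
qed

lemma GQ_le_ldist:
  assumes "length R = length T"
  shows "GQ I (mset R) (mset T) \<le> ldist I R T"
  unfolding GQ_def using assms
  by (subst GQ_set_eq) (auto intro!: Min_le finite_imageI finite_list_pairs simp del: Collect_case_prod)

lemma GQ_attained:
  assumes "size M = size N"
  obtains R T where "mset R = M" "mset T = N" "GQ I M N = ldist I R T"
proof -
  obtain R T where "mset R = M" "mset T = N" by (metis ex_mset)
  then have "(\<lambda>(R, T). ldist I R T) ` {(R, T). mset R = M \<and> mset T = N} \<noteq> {}" by auto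
  then have "GQ I M N \<in> (\<lambda>(R, T). ldist I R T) ` {(R, T). mset R = M \<and> mset T = N}"
    unfolding GQ_def GQ_set_eq[OF assms]
    by (intro Min_in finite_imageI finite_list_pairs)
  then show ?thesis using that by auto
qed

text \<open>Any enumeration of the first tuple occurs in an optimal matching.\<close>

lemma GQ_attained_left:
  assumes "size M = length R"
  obtains T where "mset T = M" "length T = length R" "GQ I (mset R) M = ldist I R T"
proof -
  obtain R' T' where *: "mset R' = mset R" "mset T' = M" "GQ I (mset R) M = ldist I R' T'"
    using GQ_attained[of "mset R" M I] assms by auto
  then obtain \<tau> where \<tau>: "\<tau> permutes {..<length R'}" "permute_list \<tau> R' = R"
    using mset_eq_permutation by metis
  have len: "length R' = length T'"
    using * assms by (metis size_mset)
  show ?thesis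
  proof (rule that)
    show "mset (permute_list \<tau> T') = M" using * \<tau> len by simp
    show "length (permute_list \<tau> T') = length R" using len \<tau> by (metis length_permute_list)
    show "GQ I (mset R) M = ldist I R (permute_list \<tau> T')"
      using ldist_permute_list[OF \<tau>(1) len] * \<tau>(2) by simp
  qed
qed

lemma GQ_nonneg: "size M = size N \<Longrightarrow> 0 \<le> GQ I M N"
  by (metis GQ_attained ldist_nonneg)

lemma GQ_commute_le:
  assumes "size M = size N"
  shows "GQ I N M \<le> GQ I M N"
proof -
  obtain R T where *: "mset R = M" "mset T = N" "GQ I M N = ldist I R T"
    using GQ_attained[OF assms] by metis
  then have "length R = length T" using assms by (metis size_mset)
  then show ?thesis
    using GQ_le_ldist[of T R I] * by (simp add: ldist_commute)
qed

lemma GQ_commute: "size M = size N \<Longrightarrow> GQ I M N = GQ I N M"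
  by (intro antisym GQ_commute_le) auto

lemma GQ_triangle:
  assumes "size M = size N" "size N = size K"
  shows "GQ I M K \<le> GQ I M N + GQ I N K"
proof -
  \<comment> \<open>The enumeration of the middle tuple is chosen once, so that the two optimal matchings compose.\<close>
  obtain R S where 1: "mset R = M" "mset S = N" "GQ I M N = ldist I R S"
    using GQ_attained[OF assms(1)] by metis
  obtain T where 2: "mset T = K" "length T = length S" "GQ I N K = ldist I S T"
    using GQ_attained_left[of K S I] assms 1 by (metis size_mset)
  have "length R = length S" using 1 assms by (metis size_mset)
  then show ?thesis
    using GQ_le_ldist[of R T I] ldist_triangle[of R S I T] 1 2 by simp
qed

lemma GQ_eq_0_imp_eq:
  assumes "finite I" "M \<in> AQ Q I" "N \<in> AQ Q I" "GQ I M N = 0"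
  shows "M = N"
proof -
  have sz: "size M = size N" using assms by (simp add: AQ_def)
  obtain R T where *: "mset R = M" "mset T = N" "GQ I M N = ldist I R T"
    using GQ_attained[OF sz] by metis
  have len: "length R = length T" using * sz by (metis size_mset)
  have "R = T"
  proof (rule nth_equalityI[OF len])
    fix i assume i: "i < length R"
    have "vdist I (R ! i) (T ! i) = 0"
      using vdist_le_ldist[OF i, of I T] * assms(4) vdist_nonneg[of I "R ! i" "T ! i"] by linarith
    moreover have "R ! i \<in> vecs I" "T ! i \<in> vecs I"
      using i len assms(2,3) unfolding AQ_def *(1,2)[symmetric] by (auto dest: nth_mem)
    ultimately show "R ! i = T ! i" using vdist_eq_0_imp_eq assms(1) by blast
  qed
  then show ?thesis using * by simp
qed

lemma GQ_self: "GQ I M M = 0"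
proof -
  obtain R where R: "mset R = M" using ex_mset by blast
  have "ldist I R R = 0" by (simp add: ldist_def vdist_def L2_set_def)
  then show ?thesis using GQ_le_ldist[of R R I] GQ_nonneg[of M M I] R by simp
qed

lemma GQ_le_sum_components:
  assumes "length R = length T"
    and "\<And>i c. i < length R \<Longrightarrow> c \<in> I \<Longrightarrow> \<bar>(R ! i) c - (T ! i) c\<bar> \<le> t"
  shows "GQ I (mset R) (mset T) \<le> real (length R * card I) * t"
proof -
  have "GQ I (mset R) (mset T) \<le> (\<Sum>i<length R. \<Sum>c\<in>I. \<bar>(R ! i) c - (T ! i) c\<bar>)"
    by (intro order_trans[OF GQ_le_ldist[OF assms(1)] order_trans[OF ldist_le_sum]] sum_mono vdist_le_sum)
  also have "\<dots> \<le> (\<Sum>i<length R. \<Sum>c\<in>I. t)"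
    by (intro sum_mono assms(2)) auto
  finally show ?thesis by simp
qed

text \<open>This is how closeness in \<open>GQ\<close> is used: with the first tuple enumerated, some enumeration of
the second is close in every component.\<close>

lemma GQ_components_small:
  assumes "finite I" "size M = length R"
  obtains T where "mset T = M" "length T = length R"
    "\<And>i c. i < length R \<Longrightarrow> c \<in> I \<Longrightarrow> \<bar>(R ! i) c - (T ! i) c\<bar> \<le> GQ I (mset R) M"
proof -
  obtain T where T: "mset T = M" "length T = length R" "GQ I (mset R) M = ldist I R T"
    using GQ_attained_left[OF assms(2)] by metis
  show ?thesis
  proof (rule that[OF T(1,2)])
    fix i c assume "i < length R" "c \<in> I"
    then show "\<bar>(R ! i) c - (T ! i) c\<bar> \<le> GQ I (mset R) M"
      using component_le_vdist[OF assms(1), of c "R ! i" "T ! i"] vdist_le_ldist[of i R I T] T(3)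
      by linarith
  qed
qed

lemma absQ_triangle_bound:
  assumes "size M = size N"
  shows "GQ I M N \<le> absQ I M + absQ I N" "absQ I M \<le> GQ I M N + absQ I N"
proof -
  let ?Z = "replicate_mset (size N) (\<lambda>_. 0) :: ('a \<Rightarrow> real) multiset"
  show "GQ I M N \<le> absQ I M + absQ I N"
    using GQ_triangle[of M ?Z N I] GQ_commute[of N ?Z I] assms by (simp add: absQ_def)
  show "absQ I M \<le> GQ I M N + absQ I N"
    using GQ_triangle[of M N ?Z I] assms by (simp add: absQ_def)
qed

section \<open>Polynomials in several variables and Remez' inequality\<close>

text \<open>Dividing \<open>f - f(x\<^sub>0)\<close> by \<open>x - x\<^sub>0\<close> for one node \<open>x\<^sub>0\<close> lowers the degree, keeps the top
coefficient, and multiplies the bound at the other nodes by at most \<open>2 / \<eta>\<close>.\<close>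

lemma coeff_bound_nodes:
  fixes f :: "real poly"
  assumes "0 < \<eta>" and "degree f \<le> k" and "finite X" and "card X = Suc k"
    and "\<And>x y. x \<in> X \<Longrightarrow> y \<in> X \<Longrightarrow> x \<noteq> y \<Longrightarrow> \<eta> \<le> \<bar>x - y\<bar>"
    and "\<And>x. x \<in> X \<Longrightarrow> \<bar>poly f x\<bar> \<le> t"
  shows "\<bar>coeff f k\<bar> \<le> (2 / \<eta>) ^ k * t"
  using assms(2-)
proof (induction k arbitrary: f X t)
  case 0
  then obtain x where "x \<in> X" by (metis card.empty ex_in_conv nat.simps(3))
  moreover obtain c where "f = [:c:]" using 0 degree_eq_zeroE by blast
  ultimately show ?case using 0(5)[of x] by simp
next
  case (Suc k)
  then obtain x0 where x0: "x0 \<in> X" by (metis card.empty ex_in_conv nat.simps(3))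
  define g where "g = synthetic_div f x0"
  have f: "f = [:- x0, 1:] * g + [:poly f x0:]"
    unfolding g_def by (rule synthetic_div_correct'[symmetric])
  have deg: "degree g \<le> k" using Suc.prems(1) by (simp add: g_def degree_synthetic_div)
  have "coeff f (Suc k) = coeff ([:- x0, 1:] * g + [:poly f x0:]) (Suc k)" using f by simp
  also have "\<dots> = coeff g k" using deg by (simp add: coeff_eq_0)
  finally have lead: "coeff f (Suc k) = coeff g k" .
  have "\<bar>coeff g k\<bar> \<le> (2 / \<eta>) ^ k * (2 / \<eta> * t)"
  proof (rule Suc.IH[OF deg, of "X - {x0}"])
    show "finite (X - {x0})" "card (X - {x0}) = Suc k" using Suc.prems x0 by auto
    show "\<eta> \<le> \<bar>x - y\<bar>" if "x \<in> X - {x0}" "y \<in> X - {x0}" "x \<noteq> y" for x y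
      using that Suc.prems(4) by auto
  next
    fix y assume y: "y \<in> X - {x0}"
    have "poly f y = (y - x0) * poly g y + poly f x0"
      by (subst f) (simp add: algebra_simps)
    then have "\<bar>y - x0\<bar> * \<bar>poly g y\<bar> \<le> \<bar>poly f y\<bar> + \<bar>poly f x0\<bar>"
      by (metis abs_mult abs_triangle_ineq4 add_diff_cancel_right')
    also have "\<dots> \<le> 2 * t" using Suc.prems(5)[of y] Suc.prems(5)[OF x0] y by simp
    finally have "\<bar>y - x0\<bar> * \<bar>poly g y\<bar> \<le> 2 * t" .
    moreover have "\<eta> * \<bar>poly g y\<bar> \<le> \<bar>y - x0\<bar> * \<bar>poly g y\<bar>"
      using Suc.prems(4)[of y x0] x0 y by (intro mult_right_mono) auto
    ultimately show "\<bar>poly g y\<bar> \<le> 2 / \<eta> * t"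
      using assms(1) by (simp add: field_simps)
  qed
  then show ?case by (simp add: lead mult_ac)
qed

text \<open>The top coefficient is bounded through the \<open>k + 1\<close> equidistant nodes in \<open>[0, 1)\<close>; subtracting
the leading monomial reduces to a smaller degree.\<close>

lemma coeffs_bound_unit_interval:
  "\<exists>C\<ge>1. \<forall>(f :: real poly) t. degree f \<le> k \<longrightarrow> (\<forall>s\<in>{0..<1}. \<bar>poly f s\<bar> \<le> t) \<longrightarrow>
     (\<forall>i. \<bar>coeff f i\<bar> \<le> C * t)"
proof (induction k)
  case 0
  show ?case
  proof (intro exI[of _ 1] conjI allI impI)
    fix f :: "real poly" and t i
    assume "degree f \<le> 0" and *: "\<forall>s\<in>{0..<1}. \<bar>poly f s\<bar> \<le> t"
    then obtain c where f: "f = [:c:]" using degree_eq_zeroE by blast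
    then have "\<bar>c\<bar> \<le> t" using *[rule_format, of 0] by simp
    then show "\<bar>coeff f i\<bar> \<le> 1 * t" by (cases i) (auto simp: f)
  qed simp
next
  case (Suc k)
  then obtain C where C: "C \<ge> 1" and IH: "\<And>(f :: real poly) t i. degree f \<le> k \<Longrightarrow>
     (\<forall>s\<in>{0..<1}. \<bar>poly f s\<bar> \<le> t) \<Longrightarrow> \<bar>coeff f i\<bar> \<le> C * t" by blast
  define L where "L = (2 / (1 / real (k + 2))) ^ Suc k"
  have L: "L \<ge> 0" by (simp add: L_def)
  show ?case
  proof (intro exI[of _ "C * (1 + L) + L"] conjI allI impI)
    have "1 * 1 \<le> C * (1 + L)" using C L by (intro mult_mono) auto
    then show "1 \<le> C * (1 + L) + L" using L by simp
  next
    fix f :: "real poly" and t i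
    assume deg: "degree f \<le> Suc k" and *: "\<forall>s\<in>{0..<1}. \<bar>poly f s\<bar> \<le> t"
    have t: "0 \<le> t" using *[rule_format, of 0] by simp
    have lead: "\<bar>coeff f (Suc k)\<bar> \<le> L * t"
      unfolding L_def
    proof (rule coeff_bound_nodes[OF _ deg, of _ "(\<lambda>j. real j / real (k + 2)) ` {..Suc k}"])
      have "inj_on (\<lambda>j. real j / real (k + 2)) {..Suc k}" by (auto intro!: inj_onI)
      then show "card ((\<lambda>j. real j / real (k + 2)) ` {..Suc k}) = Suc (Suc k)"
        by (simp add: card_image)
    next
      fix x y assume "x \<in> (\<lambda>j. real j / real (k + 2)) ` {..Suc k}"
        "y \<in> (\<lambda>j. real j / real (k + 2)) ` {..Suc k}" "x \<noteq> y"
      then obtain a b :: nat where ab: "x = real a / real (k + 2)" "y = real b / real (k + 2)" "a \<noteq> b"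
        by blast
      have "x - y = (real a - real b) / real (k + 2)" by (simp add: ab diff_divide_distrib)
      moreover have "1 \<le> \<bar>real a - real b\<bar>" using ab(3) by linarith
      ultimately show "1 / real (k + 2) \<le> \<bar>x - y\<bar>"
        by (simp add: divide_right_mono)
    next
      fix x assume "x \<in> (\<lambda>j. real j / real (k + 2)) ` {..Suc k}"
      then show "\<bar>poly f x\<bar> \<le> t" using * by (auto simp: field_simps)
    qed auto
    define g where "g = f - monom (coeff f (Suc k)) (Suc k)"
    have "degree g \<le> k"
    proof (rule degree_le, intro allI impI)
      fix i assume "k < i"
      then show "coeff g i = 0"
        using deg by (cases "i = Suc k") (auto simp: g_def coeff_eq_0)
    qed
    moreover have "\<forall>s\<in>{0..<1}. \<bar>poly g s\<bar> \<le> (1 + L) * t"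
    proof
      fix s :: real assume s: "s \<in> {0..<1}"
      have "\<bar>poly g s\<bar> \<le> \<bar>poly f s\<bar> + \<bar>coeff f (Suc k) * s ^ Suc k\<bar>"
        by (simp only: g_def poly_diff poly_monom abs_triangle_ineq4)
      also have "\<bar>coeff f (Suc k) * s ^ Suc k\<bar> \<le> \<bar>coeff f (Suc k)\<bar> * 1"
        unfolding abs_mult using s by (intro mult_left_mono) (auto simp: power_le_one simp del: power_Suc)
      finally show "\<bar>poly g s\<bar> \<le> (1 + L) * t"
        using * s lead by (force simp: algebra_simps)
    qed
    ultimately have g: "\<bar>coeff g i\<bar> \<le> C * ((1 + L) * t)" for i by (rule IH)
    have "\<bar>coeff f i\<bar> \<le> \<bar>coeff g i\<bar> + L * t"
      using lead t L by (cases "i = Suc k") (auto simp: g_def)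
    also have "\<dots> \<le> (C * (1 + L) + L) * t"
      using g[of i] by (simp add: algebra_simps)
    finally show "\<bar>coeff f i\<bar> \<le> (C * (1 + L) + L) * t" .
  qed
qed

definition monomial :: "('n \<Rightarrow> nat) \<Rightarrow> real^'n \<Rightarrow> real" where
  "monomial \<alpha> x = (\<Prod>b\<in>UNIV. x $ b ^ \<alpha> b)"

lemma finite_multiindices: "finite {\<alpha> :: 'n::finite \<Rightarrow> nat. sum \<alpha> UNIV \<le> k}"
proof (rule finite_subset)
  show "{\<alpha> :: 'n \<Rightarrow> nat. sum \<alpha> UNIV \<le> k} \<subseteq> UNIV \<rightarrow>\<^sub>E {..k}"
  proof
    fix \<alpha> :: "'n \<Rightarrow> nat" assume "\<alpha> \<in> {\<alpha>. sum \<alpha> UNIV \<le> k}"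
    then have "\<alpha> b \<le> k" for b using member_le_sum[of b UNIV \<alpha>] by simp
    then show "\<alpha> \<in> UNIV \<rightarrow>\<^sub>E {..k}" by (auto simp: PiE_UNIV_domain)
  qed
  show "finite (UNIV \<rightarrow>\<^sub>E {..k} :: ('n \<Rightarrow> nat) set)" by (intro finite_PiE) auto
qed

lemma poly_deg_le_altdef:
  "poly_deg_le k (p :: real^'n::finite \<Rightarrow> real) \<longleftrightarrow>
     (\<exists>c. p = (\<lambda>x. \<Sum>\<alpha> | sum \<alpha> UNIV \<le> k. c \<alpha> * monomial \<alpha> x))"
  by (auto simp: poly_deg_le_def monomial_def fun_eq_iff)

lemma poly_deg_le_monomial:
  assumes "sum \<alpha> UNIV \<le> k"
  shows "poly_deg_le k (monomial \<alpha>)"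
  unfolding poly_deg_le_altdef
proof (intro exI ext)
  fix x
  have "(\<Sum>\<beta> | sum \<beta> UNIV \<le> k. (if \<beta> = \<alpha> then 1 else 0) * monomial \<beta> x)
      = (\<Sum>\<beta> | sum \<beta> UNIV \<le> k. if \<beta> = \<alpha> then monomial \<alpha> x else 0)"
    by (intro sum.cong) auto
  also have "\<dots> = monomial \<alpha> x" using assms by (simp add: finite_multiindices)
  finally show "monomial \<alpha> x = (\<Sum>\<beta> | sum \<beta> UNIV \<le> k. (if \<beta> = \<alpha> then 1 else 0) * monomial \<beta> x)" ..
qed

lemma poly_deg_le_0: "poly_deg_le k (\<lambda>x. 0)"
  unfolding poly_deg_le_def by (intro exI[of _ "\<lambda>_. 0"]) simp

lemma poly_deg_le_add:
  assumes "poly_deg_le k p" "poly_deg_le k q"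
  shows "poly_deg_le k (\<lambda>x. p x + q x)"
proof -
  obtain c d where "p = (\<lambda>x. \<Sum>\<alpha> | sum \<alpha> UNIV \<le> k. c \<alpha> * monomial \<alpha> x)"
    "q = (\<lambda>x. \<Sum>\<alpha> | sum \<alpha> UNIV \<le> k. d \<alpha> * monomial \<alpha> x)"
    using assms unfolding poly_deg_le_altdef by blast
  then show ?thesis unfolding poly_deg_le_altdef
    by (intro exI[of _ "\<lambda>\<alpha>. c \<alpha> + d \<alpha>"]) (simp add: sum.distrib distrib_right)
qed

lemma poly_deg_le_cmult:
  assumes "poly_deg_le k p"
  shows "poly_deg_le k (\<lambda>x. a * p x)"
proof -
  obtain c where "p = (\<lambda>x. \<Sum>\<alpha> | sum \<alpha> UNIV \<le> k. c \<alpha> * monomial \<alpha> x)"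
    using assms unfolding poly_deg_le_altdef by blast
  then show ?thesis unfolding poly_deg_le_altdef
    by (intro exI[of _ "\<lambda>\<alpha>. a * c \<alpha>"]) (simp add: sum_distrib_left mult.assoc)
qed

lemma poly_deg_le_diff:
  assumes "poly_deg_le k p" "poly_deg_le k q"
  shows "poly_deg_le k (\<lambda>x. p x - q x)"
  using poly_deg_le_add[OF assms(1) poly_deg_le_cmult[OF assms(2), of "-1"]] by simp

lemma poly_deg_le_sum:
  assumes "\<And>i. i \<in> S \<Longrightarrow> poly_deg_le k (p i)"
  shows "poly_deg_le k (\<lambda>x. \<Sum>i\<in>S. p i x)"
  using assms by (induction S rule: infinite_finite_induct) (auto simp: poly_deg_le_0 poly_deg_le_add)

lemma monomial_0 [simp]: "monomial (\<lambda>_. 0) x = 1"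
  by (simp add: monomial_def)

lemma poly_deg_le_const: "poly_deg_le k (\<lambda>x :: real^'n::finite. a)"
proof -
  have "poly_deg_le k (\<lambda>x :: real^'n. a * monomial (\<lambda>_. 0) x)"
    by (intro poly_deg_le_cmult poly_deg_le_monomial) simp
  then show ?thesis by simp
qed

lemma monomial_mult: "monomial \<alpha> x * monomial \<beta> x = monomial (\<lambda>b. \<alpha> b + \<beta> b) x"
  by (simp add: monomial_def power_add prod.distrib)

lemma poly_deg_le_mult:
  assumes "poly_deg_le j p" "poly_deg_le k q"
  shows "poly_deg_le (j + k) (\<lambda>x. p x * q x)"
proof -
  obtain c d where p: "p = (\<lambda>x. \<Sum>\<alpha> | sum \<alpha> UNIV \<le> j. c \<alpha> * monomial \<alpha> x)"
    and q: "q = (\<lambda>x. \<Sum>\<alpha> | sum \<alpha> UNIV \<le> k. d \<alpha> * monomial \<alpha> x)"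
    using assms unfolding poly_deg_le_altdef by blast
  have "(\<lambda>x. p x * q x) = (\<lambda>x. \<Sum>\<alpha> | sum \<alpha> UNIV \<le> j. \<Sum>\<beta> | sum \<beta> UNIV \<le> k.
      (c \<alpha> * d \<beta>) * monomial (\<lambda>b. \<alpha> b + \<beta> b) x)"
    by (simp add: p q sum_product monomial_mult[symmetric] mult_ac)
  moreover have "poly_deg_le (j + k) \<dots>"
    by (intro poly_deg_le_sum poly_deg_le_cmult poly_deg_le_monomial)
      (auto simp: sum.distrib intro: add_mono)
  ultimately show ?thesis by simp
qed

lemma poly_deg_le_power:
  "poly_deg_le j p \<Longrightarrow> poly_deg_le (i * j) (\<lambda>x. p x ^ i)"
  by (induction i) (auto simp: poly_deg_le_const intro: poly_deg_le_mult)

lemma poly_deg_le_prod: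
  assumes "\<And>i. i \<in> S \<Longrightarrow> poly_deg_le (d i) (p i)"
  shows "poly_deg_le (\<Sum>i\<in>S. d i) (\<lambda>x. \<Prod>i\<in>S. p i x)"
  using assms
  by (induction S rule: infinite_finite_induct) (auto simp: poly_deg_le_const intro: poly_deg_le_mult)

lemma poly_deg_le_mono:
  assumes "poly_deg_le j (p :: real^'n::finite \<Rightarrow> real)" "j \<le> k"
  shows "poly_deg_le k p"
proof -
  obtain c where p: "p = (\<lambda>x. \<Sum>\<alpha> | sum \<alpha> UNIV \<le> j. c \<alpha> * monomial \<alpha> x)"
    using assms unfolding poly_deg_le_altdef by blast
  show ?thesis unfolding p
    by (intro poly_deg_le_sum poly_deg_le_cmult poly_deg_le_monomial) (use assms in auto)
qed

lemma poly_deg_le_component: "poly_deg_le 1 (\<lambda>x :: real^'n::finite. x $ b)"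
proof -
  have "monomial (\<lambda>b'. if b' = b then 1 else 0) x = x $ b" for x :: "real^'n"
  proof -
    have "monomial (\<lambda>b'. if b' = b then 1 else 0) x = (\<Prod>b'\<in>UNIV. if b' = b then x $ b else 1)"
      unfolding monomial_def by (intro prod.cong) auto
    then show ?thesis by simp
  qed
  moreover have "poly_deg_le 1 (monomial (\<lambda>b'. if b' = b then 1 else 0) :: real^'n \<Rightarrow> real)"
    by (rule poly_deg_le_monomial) simp
  ultimately show ?thesis by presburger
qed

lemma poly_deg_le_affine:
  assumes "poly_deg_le k (p :: real^'n::finite \<Rightarrow> real)"
  shows "poly_deg_le k (\<lambda>x. p (x0 + r *\<^sub>R x))"
proof -
  obtain c where p: "p = (\<lambda>x. \<Sum>\<alpha> | sum \<alpha> UNIV \<le> k. c \<alpha> * monomial \<alpha> x)"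
    using assms unfolding poly_deg_le_altdef by blast
  have "poly_deg_le k (\<lambda>x. monomial \<alpha> (x0 + r *\<^sub>R x))" if "sum \<alpha> UNIV \<le> k" for \<alpha>
  proof -
    have "poly_deg_le 1 (\<lambda>x :: real^'n. x0 $ b + r * x $ b)" for b
      by (intro poly_deg_le_add poly_deg_le_const poly_deg_le_cmult poly_deg_le_component)
    then have "poly_deg_le (\<Sum>b\<in>UNIV. \<alpha> b * 1) (\<lambda>x :: real^'n. \<Prod>b\<in>UNIV. (x0 $ b + r * x $ b) ^ \<alpha> b)"
      by (intro poly_deg_le_prod poly_deg_le_power)
    then show ?thesis using that by (simp add: monomial_def poly_deg_le_mono)
  qed
  then show ?thesis unfolding p
    by (intro poly_deg_le_sum poly_deg_le_cmult) auto
qed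

lemma poly_deg_le_0_const:
  assumes "poly_deg_le 0 p"
  shows "p x = p y"
proof -
  have "{\<alpha> :: 'a \<Rightarrow> nat. sum \<alpha> UNIV \<le> 0} = {\<lambda>_. 0}" by auto
  then show ?thesis using assms by (auto simp: poly_deg_le_def)
qed

lemma continuous_on_poly_deg_le: "poly_deg_le k p \<Longrightarrow> continuous_on S p"
  unfolding poly_deg_le_altdef monomial_def by (auto intro!: continuous_intros)

lemma coeff_mult_top:
  fixes p q :: "'a::comm_semiring_1 poly"
  assumes "degree p \<le> i" "degree q \<le> j"
  shows "coeff (p * q) (i + j) = coeff p i * coeff q j"
proof -
  have "coeff p a * coeff q (i + j - a) = 0" if "a \<le> i + j" "a \<noteq> i" for a
    using that assms by (cases "a < i") (auto simp: coeff_eq_0)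
  then have "(\<Sum>a\<le>i+j. coeff p a * coeff q (i + j - a)) = (\<Sum>a\<in>{i}. coeff p a * coeff q (i + j - a))"
    by (intro sum.mono_neutral_right) auto
  then show ?thesis by (simp add: coeff_mult)
qed

lemma coeff_prod_top:
  fixes f :: "'b \<Rightarrow> 'a::comm_semiring_1 poly"
  assumes "finite S" "\<And>b. b \<in> S \<Longrightarrow> degree (f b) \<le> d b"
  shows "degree (\<Prod>b\<in>S. f b) \<le> sum d S \<and> coeff (\<Prod>b\<in>S. f b) (sum d S) = (\<Prod>b\<in>S. coeff (f b) (d b))"
  using assms
proof (induction S rule: finite_induct)
  case (insert b S)
  then have "degree (f b * (\<Prod>b\<in>S. f b)) \<le> d b + sum d S"
    by (meson add_mono degree_mult_le insertCI order_trans)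
  then show ?case using insert coeff_mult_top[of "f b" "d b" "\<Prod>b\<in>S. f b" "sum d S"] by simp
qed simp

lemma coeff_linear_power_top:
  "degree ([:x, y:] ^ i) \<le> i \<and> coeff ([:x, y:] ^ i) i = (y :: 'a::comm_semiring_1) ^ i"
proof (induction i)
  case (Suc i)
  have "degree ([:x, y:] * [:x, y:] ^ i) \<le> degree [:x, y:] + degree ([:x, y:] ^ i)"
    by (rule degree_mult_le)
  also have "\<dots> \<le> 1 + i" using Suc by (intro add_mono) auto
  finally show ?case using coeff_mult_top[of "[:x, y:]" 1 "[:x, y:] ^ i" i] Suc by simp
qed simp

lemma monomial_on_line:
  fixes x e :: "real^'n::finite" and \<alpha> :: "'n \<Rightarrow> nat"
  defines "f \<equiv> \<Prod>b\<in>UNIV. [:x $ b, e $ b:] ^ \<alpha> b"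
  shows "monomial \<alpha> (x + s *\<^sub>R e) = poly f s" "degree f \<le> sum \<alpha> UNIV"
    "coeff f (sum \<alpha> UNIV) = monomial \<alpha> e"
proof -
  show "monomial \<alpha> (x + s *\<^sub>R e) = poly f s"
    by (simp add: f_def monomial_def poly_prod)
  have "degree ([:x $ b, e $ b:] ^ \<alpha> b) \<le> \<alpha> b" for b using coeff_linear_power_top by blast
  then show "degree f \<le> sum \<alpha> UNIV" "coeff f (sum \<alpha> UNIV) = monomial \<alpha> e"
    using coeff_prod_top[of UNIV "\<lambda>b. [:x $ b, e $ b:] ^ \<alpha> b" \<alpha>]
    by (auto simp: f_def monomial_def coeff_linear_power_top[THEN conjunct2])
qed

text \<open>\<open>H\<close> is the homogeneous part of degree \<open>k\<close>. Its value at \<open>e\<close> is the top coefficient of \<open>p\<close> along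
every line of direction \<open>e\<close>, wherever the line is placed.\<close>

lemma poly_deg_le_top_part:
  assumes "poly_deg_le k (p :: real^'n::finite \<Rightarrow> real)"
  obtains H where
    "\<And>x e. \<exists>f. degree f \<le> k \<and> coeff f k = H e \<and> (\<forall>s. p (x + s *\<^sub>R e) = poly f s)"
    "k = 0 \<Longrightarrow> p = H" "\<And>j. k = Suc j \<Longrightarrow> poly_deg_le j (\<lambda>x. p x - H x)"
proof -
  obtain c where p: "p = (\<lambda>x. \<Sum>\<alpha> | sum \<alpha> UNIV \<le> k. c \<alpha> * monomial \<alpha> x)"
    using assms unfolding poly_deg_le_altdef by blast
  define H where "H = (\<lambda>x :: real^'n. \<Sum>\<alpha> | sum \<alpha> UNIV = k. c \<alpha> * monomial \<alpha> x)"
  have fin: "finite {\<alpha> :: 'n \<Rightarrow> nat. sum \<alpha> UNIV \<le> k}" by (rule finite_multiindices)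
  have sub: "{\<alpha> :: 'n \<Rightarrow> nat. sum \<alpha> UNIV = k} \<subseteq> {\<alpha>. sum \<alpha> UNIV \<le> k}" by auto
  show ?thesis
  proof (rule that)
    fix x e :: "real^'n"
    define g where "g = (\<lambda>\<alpha>. \<Prod>b\<in>UNIV. [:x $ b, e $ b:] ^ \<alpha> b)"
    have g: "monomial \<alpha> (x + s *\<^sub>R e) = poly (g \<alpha>) s" "degree (g \<alpha>) \<le> sum \<alpha> UNIV"
      "coeff (g \<alpha>) (sum \<alpha> UNIV) = monomial \<alpha> e" for \<alpha> s
      unfolding g_def by (rule monomial_on_line)+
    show "\<exists>f. degree f \<le> k \<and> coeff f k = H e \<and> (\<forall>s. p (x + s *\<^sub>R e) = poly f s)"
    proof (intro exI conjI allI)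
      define f where "f = (\<Sum>\<alpha> | sum \<alpha> UNIV \<le> k. smult (c \<alpha>) (g \<alpha>))"
      show "degree f \<le> k" unfolding f_def
      proof (rule degree_sum_le[OF fin])
        fix \<alpha> :: "'n \<Rightarrow> nat" assume "\<alpha> \<in> {\<alpha>. sum \<alpha> UNIV \<le> k}"
        then show "degree (smult (c \<alpha>) (g \<alpha>)) \<le> k"
          using degree_smult_le[of "c \<alpha>" "g \<alpha>"] g(2)[of \<alpha>] by simp
      qed
      have "coeff f k = (\<Sum>\<alpha> | sum \<alpha> UNIV \<le> k. c \<alpha> * coeff (g \<alpha>) k)"
        by (simp add: f_def coeff_sum)
      also have "\<dots> = (\<Sum>\<alpha> | sum \<alpha> UNIV = k. c \<alpha> * coeff (g \<alpha>) k)"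
      proof (intro sum.mono_neutral_right fin sub ballI)
        fix \<alpha> :: "'n \<Rightarrow> nat" assume "\<alpha> \<in> {\<alpha>. sum \<alpha> UNIV \<le> k} - {\<alpha>. sum \<alpha> UNIV = k}"
        then have "degree (g \<alpha>) < k" using g(2)[of \<alpha>] by simp
        then show "c \<alpha> * coeff (g \<alpha>) k = 0" by (simp add: coeff_eq_0)
      qed
      also have "\<dots> = H e" unfolding H_def using g(3) by (intro sum.cong) auto
      finally show "coeff f k = H e" .
      show "p (x + s *\<^sub>R e) = poly f s" for s
        by (simp add: p f_def g(1) poly_sum)
    qed
  next
    assume "k = 0"
    then have "{\<alpha> :: 'n \<Rightarrow> nat. sum \<alpha> UNIV = k} = {\<alpha>. sum \<alpha> UNIV \<le> k}" by auto
    then show "p = H" by (simp add: p H_def)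
  next
    fix j assume k: "k = Suc j"
    have "p x - H x = (\<Sum>\<alpha> | sum \<alpha> UNIV \<le> j. c \<alpha> * monomial \<alpha> x)" for x
    proof -
      have "p x - H x = (\<Sum>\<alpha> \<in> {\<alpha>. sum \<alpha> UNIV \<le> k} - {\<alpha>. sum \<alpha> UNIV = k}. c \<alpha> * monomial \<alpha> x)"
        unfolding p H_def by (rule sum_diff[OF fin sub, symmetric])
      also have "{\<alpha> :: 'n \<Rightarrow> nat. sum \<alpha> UNIV \<le> k} - {\<alpha>. sum \<alpha> UNIV = k} = {\<alpha>. sum \<alpha> UNIV \<le> j}"
        using k by auto
      finally show ?thesis .
    qed
    then show "poly_deg_le j (\<lambda>x. p x - H x)" unfolding poly_deg_le_altdef by auto
  qed
qed

lemma poly_deg_le_on_line: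
  assumes "poly_deg_le k (p :: real^'n::finite \<Rightarrow> real)"
  obtains f where "degree f \<le> k" "\<And>s. p (x + s *\<^sub>R e) = poly f s"
  using poly_deg_le_top_part[OF assms] by metis


lemma affine_image_lmeasurable:
  fixes S :: "(real^'n::finite) set"
  assumes "S \<in> lmeasurable" "t \<noteq> 0"
  shows "(\<lambda>w. a + t *\<^sub>R w) ` S \<in> lmeasurable"
    "measure lebesgue ((\<lambda>w. a + t *\<^sub>R w) ` S) = \<bar>t\<bar> ^ CARD('n) * measure lebesgue S"
proof -
  have im: "(\<lambda>w. a + t *\<^sub>R w) ` S = (+) a ` ((*\<^sub>R) t ` S)" by (simp add: image_image)
  have "(*\<^sub>R) t ` S = (*\<^sub>R) (1 / t) -` S \<inter> space lebesgue"
    using assms(2) by (force simp: image_iff)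
  also have "\<dots> \<in> sets lebesgue"
    using lebesgue_measurable_scaling fmeasurableD[OF assms(1)] by (rule measurable_sets)
  finally have "(*\<^sub>R) t ` S \<in> sets lebesgue" .
  then have m: "(\<lambda>w. a + t *\<^sub>R w) ` S \<in> sets lebesgue"
    unfolding im by (rule lebesgue_sets_translation)
  have e: "emeasure lebesgue ((\<lambda>w. a + t *\<^sub>R w) ` S) = \<bar>t\<bar> ^ CARD('n) * emeasure lebesgue S"
    using emeasure_lebesgue_affine[of t a S] by (simp add: add.commute)
  then have "emeasure lebesgue ((\<lambda>w. a + t *\<^sub>R w) ` S) < \<infinity>"
    using fmeasurableD2[OF assms(1)] by (simp add: ennreal_mult_less_top less_top[symmetric] ennreal_mult_eq_top_iff)
  then show "(\<lambda>w. a + t *\<^sub>R w) ` S \<in> lmeasurable" using m by (intro fmeasurableI) auto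
  show "measure lebesgue ((\<lambda>w. a + t *\<^sub>R w) ` S) = \<bar>t\<bar> ^ CARD('n) * measure lebesgue S"
    using measure_lebesgue_affine[of t a S] by (simp add: add.commute)
qed

text \<open>The translates of \<open>E\<close> by \<open>-(j/M) e\<close> lie in the ball of radius 2. If no point belonged to more than
\<open>k\<close> of these \<open>M\<close> translates, integrating the sum of their indicators would give \<open>M \<bar>E\<bar> \<le> k \<bar>B\<^sub>2\<bar>\<close>.\<close>

lemma collinear_nodes_in_set:
  fixes E :: "(real^'n::finite) set"
  assumes E: "E \<in> lmeasurable" "E \<subseteq> ball 0 1" and e: "norm e \<le> 1"
    and M: "real k * measure lebesgue (ball 0 2 :: (real^'n) set) < real M * measure lebesgue E"
  obtains z J where "J \<subseteq> {..<M}" "card J = Suc k" "\<And>j. j \<in> J \<Longrightarrow> z + (real j / real M) *\<^sub>R e \<in> E"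
proof -
  define F where "F = (\<lambda>j. (+) (- ((real j / real M) *\<^sub>R e)) ` E)"
  have F: "F j \<in> lmeasurable" "measure lebesgue (F j) = measure lebesgue E" for j
    unfolding F_def by (rule measurable_translation[OF E(1)], rule measure_translation)
  have intF: "integrable lebesgue (indicator (F j) :: _ \<Rightarrow> real)" for j
    using F(1)[of j] by (intro integrable_real_indicator) (auto simp: fmeasurable_def)
  have inF: "z \<in> F j \<longleftrightarrow> z + (real j / real M) *\<^sub>R e \<in> E" for z j
    by (auto simp: F_def image_iff algebra_simps)
  have "\<exists>z. Suc k \<le> card {j \<in> {..<M}. z \<in> F j}"
  proof (rule ccontr)
    assume "\<not> ?thesis"
    then have small: "card {j \<in> {..<M}. z \<in> F j} \<le> k" for z
      by (meson not_less_eq_eq)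
    have pt: "(\<Sum>j<M. indicator (F j) z) \<le> real k * indicator (ball 0 2) z" for z
    proof (cases "z \<in> ball 0 2")
      case True
      have "(\<Sum>j<M. indicator (F j) z) = real (card {j \<in> {..<M}. z \<in> F j})"
        by (simp add: indicator_def sum.If_cases Int_def)
      then show ?thesis using small[of z] True by simp
    next
      case False
      have "z \<notin> F j" if "j < M" for j
      proof
        assume "z \<in> F j"
        then have "norm (z + (real j / real M) *\<^sub>R e) < 1" using E(2) inF by auto
        moreover have "norm ((real j / real M) *\<^sub>R e) \<le> 1"
          using that e by (simp add: mult_le_one del: times_divide_eq_left)
        moreover have "norm z \<le> norm (z + (real j / real M) *\<^sub>R e) + norm ((real j / real M) *\<^sub>R e)"
          by (metis add_diff_cancel_right' norm_triangle_ineq4)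
        ultimately show False using False by simp
      qed
      then have "(\<Sum>j<M. indicator (F j) z) = (0::real)" by (intro sum.neutral) auto
      then show ?thesis by simp
    qed
    have "real M * measure lebesgue E = (\<Sum>j<M. \<integral>z. indicator (F j) z \<partial>lebesgue)"
      by (simp add: F(2))
    also have "\<dots> = (\<integral>z. (\<Sum>j<M. indicator (F j) z) \<partial>lebesgue)"
      by (intro Bochner_Integration.integral_sum[symmetric] intF)
    also have "\<dots> \<le> (\<integral>z. real k * indicator (ball (0 :: real^'n) 2) z \<partial>lebesgue)"
    proof (rule Bochner_Integration.integral_mono)
      show "integrable lebesgue (\<lambda>z. \<Sum>j<M. indicator (F j) z :: real)"
        by (intro Bochner_Integration.integrable_sum intF)
      show "integrable lebesgue (\<lambda>z :: real^'n. real k * indicator (ball 0 2) z)"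
        using lmeasurable_ball[of "0 :: real^'n" 2] by (auto simp: fmeasurable_def)
    qed (rule pt)
    also have "\<dots> = real k * measure lebesgue (ball 0 2 :: (real^'n) set)" by simp
    finally show False using M by simp
  qed
  then obtain z where "Suc k \<le> card {j \<in> {..<M}. z \<in> F j}" ..
  then obtain J where "J \<subseteq> {j \<in> {..<M}. z \<in> F j}" "card J = Suc k"
    by (metis obtain_subset_with_card_n)
  then show ?thesis using that[of J z] inF by auto
qed

text \<open>A set of measure at least \<open>c\<close> contains, for every direction \<open>e\<close>, \<open>k + 1\<close> points of one line of
direction \<open>e\<close> with gaps at least \<open>1/M\<close>, where \<open>M\<close> depends only on \<open>c\<close>, \<open>k\<close> and the dimension. So the bound
on \<open>E\<close> controls the top homogeneous part at \<open>e\<close>. Subtracting this part lowers the degree.\<close>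

lemma remez_unit_ball:
  assumes "0 < c"
  shows "\<exists>C\<ge>1. \<forall>(p :: real^'n::finite \<Rightarrow> real) E t. poly_deg_le k p \<longrightarrow> E \<in> lmeasurable \<longrightarrow>
     E \<subseteq> ball 0 1 \<longrightarrow> c \<le> measure lebesgue E \<longrightarrow> (\<forall>x\<in>E. \<bar>p x\<bar> \<le> t) \<longrightarrow> (\<forall>x\<in>ball 0 1. \<bar>p x\<bar> \<le> C * t)"
proof -
  have "\<exists>C\<ge>1. \<forall>(p :: real^'n \<Rightarrow> real) E t. poly_deg_le k p \<longrightarrow> E \<in> lmeasurable \<longrightarrow>
     E \<subseteq> ball 0 1 \<longrightarrow> c \<le> measure lebesgue E \<longrightarrow> (\<forall>x\<in>E. \<bar>p x\<bar> \<le> t) \<longrightarrow> (\<forall>x\<in>ball 0 1. \<bar>p x\<bar> \<le> C * t)"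
  proof (induction k)
    case 0
    show ?case
    proof (intro exI[of _ 1] conjI allI impI ballI)
      fix p :: "real^'n \<Rightarrow> real" and E t and x :: "real^'n"
      assume p: "poly_deg_le 0 p" and "c \<le> measure lebesgue E" and bd: "\<forall>x\<in>E. \<bar>p x\<bar> \<le> t"
      then have "E \<noteq> {}" using assms by auto
      then obtain y where "y \<in> E" by blast
      then show "\<bar>p x\<bar> \<le> 1 * t" using bd poly_deg_le_0_const[OF p, of x y] by auto
    qed simp
  next
    case (Suc k)
    then obtain C where C: "C \<ge> 1" and IH0: "\<forall>(p :: real^'n \<Rightarrow> real) E t. poly_deg_le k p \<longrightarrow> E \<in> lmeasurable \<longrightarrow>
     E \<subseteq> ball 0 1 \<longrightarrow> c \<le> measure lebesgue E \<longrightarrow> (\<forall>x\<in>E. \<bar>p x\<bar> \<le> t) \<longrightarrow> (\<forall>x\<in>ball 0 1. \<bar>p x\<bar> \<le> C * t)"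
      by (elim exE conjE)
    note IH = IH0[rule_format]
    define V where "V = measure lebesgue (ball 0 2 :: (real^'n) set)"
    obtain M :: nat where M: "real (Suc k) * V / c < real M" using reals_Archimedean2 by blast
    have V: "V \<ge> 0" by (simp add: V_def)
    have M0: "M > 0"
    proof (rule ccontr)
      assume "\<not> M > 0"
      then have "real (Suc k) * V / c < 0" using M by simp
      moreover have "0 \<le> real (Suc k) * V / c" using V assms by (intro divide_nonneg_pos mult_nonneg_nonneg) auto
      ultimately show False by linarith
    qed
    define L where "L = (2 / (1 / real M)) ^ Suc k"
    have L: "L \<ge> 0" by (simp add: L_def)
    show ?case
    proof (intro exI[of _ "C * (1 + L) + L"] conjI allI impI ballI)
      have "1 * 1 \<le> C * (1 + L)" using C L by (intro mult_mono) auto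
      then show "1 \<le> C * (1 + L) + L" using L by simp
    next
      fix p :: "real^'n \<Rightarrow> real" and E t and x :: "real^'n"
      assume p: "poly_deg_le (Suc k) p" and E: "E \<in> lmeasurable" "E \<subseteq> ball 0 1"
        "c \<le> measure lebesgue E" and bd: "\<forall>x\<in>E. \<bar>p x\<bar> \<le> t" and x: "x \<in> ball 0 1"
      obtain H where H: "\<And>x e. \<exists>f. degree f \<le> Suc k \<and> coeff f (Suc k) = H e \<and> (\<forall>s. p (x + s *\<^sub>R e) = poly f s)"
        and low: "poly_deg_le k (\<lambda>x. p x - H x)"
        by (rule poly_deg_le_top_part[OF p]) (rule that, assumption, simp)
      have top: "\<bar>H e\<bar> \<le> L * t" if e: "norm e \<le> 1" for e
      proof -
        have "real (Suc k) * V < real M * c" using M assms by (simp add: field_simps)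
        also have "\<dots> \<le> real M * measure lebesgue E" using E(3) by (intro mult_left_mono) auto
        finally have "real (Suc k) * V < real M * measure lebesgue E" .
        then obtain z J where J: "J \<subseteq> {..<M}" "card J = Suc (Suc k)"
          and z: "\<And>j. j \<in> J \<Longrightarrow> z + (real j / real M) *\<^sub>R e \<in> E"
          unfolding V_def by (rule collinear_nodes_in_set[OF E(1,2) e]) (rule that)
        obtain f where f: "degree f \<le> Suc k" "coeff f (Suc k) = H e" "\<And>s. p (z + s *\<^sub>R e) = poly f s"
          using H[of e z] by blast
        show ?thesis unfolding L_def f(2)[symmetric]
        proof (rule coeff_bound_nodes[OF _ f(1), of _ "(\<lambda>j. real j / real M) ` J"])
          show "0 < 1 / real M" using M0 by simp
          show "finite ((\<lambda>j. real j / real M) ` J)" using J finite_subset by auto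
          have "inj_on (\<lambda>j. real j / real M) J" using M0 by (auto intro!: inj_onI)
          then show "card ((\<lambda>j. real j / real M) ` J) = Suc (Suc k)"
            using J by (simp add: card_image)
        next
          fix x y assume "x \<in> (\<lambda>j. real j / real M) ` J" "y \<in> (\<lambda>j. real j / real M) ` J" "x \<noteq> y"
          then obtain a b :: nat where ab: "x = real a / real M" "y = real b / real M" "a \<noteq> b"
            by blast
          have "x - y = (real a - real b) / real M" by (simp add: ab diff_divide_distrib)
          moreover have "1 \<le> \<bar>real a - real b\<bar>" using ab(3) by linarith
          ultimately show "1 / real M \<le> \<bar>x - y\<bar>"
            by (simp add: divide_right_mono)
        next
          fix x assume "x \<in> (\<lambda>j. real j / real M) ` J"
          then show "\<bar>poly f x\<bar> \<le> t" using z bd by (auto simp flip: f(3))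
        qed
      qed
      have bd': "\<bar>p y - H y\<bar> \<le> (1 + L) * t" if y: "y \<in> E" for y
      proof -
        have "norm y \<le> 1" using E(2) y by force
        then show "\<bar>p y - H y\<bar> \<le> (1 + L) * t" using bd y top[of y] by (force simp: algebra_simps)
      qed
      have "\<bar>p x - H x\<bar> \<le> C * ((1 + L) * t)" by (rule IH[OF low E bd' x])
      moreover have "\<bar>H x\<bar> \<le> L * t" using x by (intro top) simp
      ultimately show "\<bar>p x\<bar> \<le> (C * (1 + L) + L) * t" by (simp add: algebra_simps)
    qed
  qed
  then show ?thesis .
qed

lemma remez_ball:
  assumes "0 < c"
  shows "\<exists>C\<ge>1. \<forall>(p :: real^'n::finite \<Rightarrow> real) E t x0 r. poly_deg_le k p \<longrightarrow> E \<in> lmeasurable \<longrightarrow> 0 < r \<longrightarrow>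
     E \<subseteq> ball x0 r \<longrightarrow> c * r ^ CARD('n) \<le> measure lebesgue E \<longrightarrow> (\<forall>x\<in>E. \<bar>p x\<bar> \<le> t) \<longrightarrow>
     (\<forall>x\<in>ball x0 r. \<bar>p x\<bar> \<le> C * t)"
proof -
  obtain C where C: "C \<ge> 1" and unit0: "\<forall>(p :: real^'n \<Rightarrow> real) E t. poly_deg_le k p \<longrightarrow> E \<in> lmeasurable \<longrightarrow>
     E \<subseteq> ball 0 1 \<longrightarrow> c \<le> measure lebesgue E \<longrightarrow> (\<forall>x\<in>E. \<bar>p x\<bar> \<le> t) \<longrightarrow> (\<forall>x\<in>ball 0 1. \<bar>p x\<bar> \<le> C * t)"
    using remez_unit_ball[OF assms, where k = k and ?'n = 'n] by (elim exE conjE)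
  note unit = unit0[rule_format]
  show ?thesis
  proof (intro exI[of _ C] conjI allI impI ballI)
    fix p :: "real^'n \<Rightarrow> real" and E t x0 and r :: real and x :: "real^'n"
    assume p: "poly_deg_le k p" and E: "E \<in> lmeasurable" and r: "0 < r" and sub: "E \<subseteq> ball x0 r"
      and m: "c * r ^ CARD('n) \<le> measure lebesgue E" and bd: "\<forall>x\<in>E. \<bar>p x\<bar> \<le> t" and x: "x \<in> ball x0 r"
    define h where "h = (\<lambda>w. - (1 / r) *\<^sub>R x0 + (1 / r) *\<^sub>R w)"
    have h: "h w = (1 / r) *\<^sub>R (w - x0)" and inv: "x0 + r *\<^sub>R h w = w" for w
      using r by (simp_all add: h_def algebra_simps)
    have norm_h: "w \<in> ball x0 r \<Longrightarrow> h w \<in> ball 0 1" for w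
      using r by (simp add: h dist_norm norm_minus_commute)
    have "\<bar>p (x0 + r *\<^sub>R h x)\<bar> \<le> C * t"
    proof (rule unit[OF poly_deg_le_affine[OF p], where E = "h ` E"])
      show "h ` E \<in> lmeasurable"
        unfolding h_def using r by (intro affine_image_lmeasurable[OF E]) auto
      have "measure lebesgue (h ` E) = \<bar>1 / r\<bar> ^ CARD('n) * measure lebesgue E"
        unfolding h_def using r by (intro affine_image_lmeasurable[OF E]) auto
      then have "measure lebesgue (h ` E) = measure lebesgue E / r ^ CARD('n)"
        using r by (simp add: power_divide)
      then show "c \<le> measure lebesgue (h ` E)" using m r by (simp add: pos_le_divide_eq)
      show "h ` E \<subseteq> ball 0 1" using sub norm_h by blast
      show "h x \<in> ball 0 1" using x norm_h by blast
      show "\<bar>p (x0 + r *\<^sub>R y)\<bar> \<le> t" if "y \<in> h ` E" for y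
        using that bd inv by auto
    qed
    then show "\<bar>p x\<bar> \<le> C * t" by (simp add: inv)
  qed (rule C)
qed

text \<open>Along the segment from the centre through \<open>z\<close> the polynomial is one of a single variable whose
coefficients are bounded by its values on the part inside the ball.\<close>

lemma poly_growth:
  "\<exists>C\<ge>1. \<forall>(p :: real^'n::finite \<Rightarrow> real) t x0 r s z. poly_deg_le k p \<longrightarrow> 0 < r \<longrightarrow>
     (\<forall>x\<in>ball x0 r. \<bar>p x\<bar> \<le> t) \<longrightarrow> r \<le> s \<longrightarrow> dist x0 z \<le> s \<longrightarrow> \<bar>p z\<bar> \<le> C * t * (s / r) ^ k"
proof -
  obtain C where C: "C \<ge> 1" and coeffs: "\<And>(f :: real poly) t i. degree f \<le> k \<Longrightarrow>
    (\<forall>s\<in>{0..<1}. \<bar>poly f s\<bar> \<le> t) \<Longrightarrow> \<bar>coeff f i\<bar> \<le> C * t"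
    using coeffs_bound_unit_interval[of k] by metis
  show ?thesis
  proof (intro exI[of _ "real (Suc k) * C"] conjI allI impI)
    have "1 * 1 \<le> real (Suc k) * C" using C by (intro mult_mono) auto
    then show "1 \<le> real (Suc k) * C" by simp
  next
    fix p :: "real^'n \<Rightarrow> real" and t r s x0 z
    assume p: "poly_deg_le k p" and r: "0 < r" and bd: "\<forall>x\<in>ball x0 r. \<bar>p x\<bar> \<le> t"
      and s: "r \<le> s" and z: "dist x0 z \<le> s"
    define e where "e = (r / s) *\<^sub>R (z - x0)"
    have "norm e = r * (dist x0 z / s)"
      using r s by (simp add: e_def dist_norm norm_minus_commute)
    also have "\<dots> \<le> r * 1" using r s z by (intro mult_left_mono) auto
    finally have e: "norm e \<le> r" by simp
    obtain f where f: "degree f \<le> k" "\<And>\<tau>. p (x0 + \<tau> *\<^sub>R e) = poly f \<tau>"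
      using poly_deg_le_on_line[OF p, of x0 e] by metis
    have "\<forall>\<tau>\<in>{0..<1}. \<bar>poly f \<tau>\<bar> \<le> t"
    proof
      fix \<tau> :: real assume \<tau>: "\<tau> \<in> {0..<1}"
      then have "\<tau> * norm e \<le> \<tau> * r" using e by (intro mult_left_mono) auto
      also have "\<tau> * r < r" using \<tau> r by simp
      finally have "x0 + \<tau> *\<^sub>R e \<in> ball x0 r" using \<tau> by (simp add: dist_norm)
      then show "\<bar>poly f \<tau>\<bar> \<le> t" using bd by (simp flip: f(2))
    qed
    then have co: "\<bar>coeff f i\<bar> \<le> C * t" for i by (rule coeffs[OF f(1)])
    have "z = x0 + (s / r) *\<^sub>R e" using r s by (simp add: e_def)
    then have "p z = poly f (s / r)" using f(2) by metis
    also have "\<dots> = (\<Sum>i\<le>k. coeff f i * (s / r) ^ i)"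
      unfolding poly_altdef using f(1)
      by (intro sum.mono_neutral_left) (auto simp: coeff_eq_0)
    finally have "\<bar>p z\<bar> \<le> (\<Sum>i\<le>k. \<bar>coeff f i * (s / r) ^ i\<bar>)" by simp
    also have "\<dots> \<le> (\<Sum>i\<le>k. C * t * (s / r) ^ k)"
    proof (intro sum_mono)
      fix i assume i: "i \<in> {..k}"
      have "\<bar>(s / r) ^ i\<bar> = (s / r) ^ i" using r s by simp
      also have "\<dots> \<le> (s / r) ^ k" using r s i by (intro power_increasing) auto
      finally have "\<bar>(s / r) ^ i\<bar> \<le> (s / r) ^ k" .
      then show "\<bar>coeff f i * (s / r) ^ i\<bar> \<le> C * t * (s / r) ^ k"
        unfolding abs_mult using co[of i] by (intro mult_mono) auto
    qed
    also have "\<dots> = real (Suc k) * C * t * (s / r) ^ k" by simp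
    finally show "\<bar>p z\<bar> \<le> real (Suc k) * C * t * (s / r) ^ k" .
  qed
qed

section \<open>Derivatives of polynomials and Markov's inequality\<close>

definition pderiv_at :: "'n::finite \<Rightarrow> (real^'n \<Rightarrow> real) \<Rightarrow> real^'n \<Rightarrow> real" where
  "pderiv_at b p x = deriv (\<lambda>t. p (x + t *\<^sub>R axis b 1)) 0"

text \<open>The head of the list is the direction of the last differentiation, as in the indices of the
tensors \<open>D\<^sup>ju\<close>.\<close>

primrec pderivs :: "'n::finite list \<Rightarrow> (real^'n \<Rightarrow> real) \<Rightarrow> real^'n \<Rightarrow> real" where
  "pderivs [] p = p"
| "pderivs (b # bs) p = pderiv_at b (pderivs bs p)"

lemma pderiv_at_line:
  assumes "\<And>t. p (x + t *\<^sub>R axis b 1) = poly f t"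
  shows "pderiv_at b p x = coeff f 1"
proof -
  have "(\<lambda>t. p (x + t *\<^sub>R axis b 1)) = poly f" using assms by auto
  then have "pderiv_at b p x = poly (pderiv f) 0"
    unfolding pderiv_at_def by (auto intro: DERIV_imp_deriv poly_DERIV)
  then show ?thesis by (simp add: poly_0_coeff_0 coeff_pderiv)
qed

lemma pderiv_at_DERIV:
  assumes "((\<lambda>t. p (x + t *\<^sub>R axis b 1)) has_field_derivative D) (at 0)"
  shows "pderiv_at b p x = D"
  unfolding pderiv_at_def using assms by (rule DERIV_imp_deriv)

lemma monomial_DERIV:
  fixes x :: "real^'n::finite"
  shows "((\<lambda>t. monomial \<alpha> (x + t *\<^sub>R axis b 1)) has_field_derivative
    real (\<alpha> b) * monomial (\<alpha>(b := \<alpha> b - 1)) x) (at 0)"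
proof -
  have split: "monomial \<beta> y = y $ b ^ \<beta> b * (\<Prod>a\<in>UNIV - {b}. y $ a ^ \<beta> a)" for \<beta> and y :: "real^'n"
    unfolding monomial_def by (rule prod.remove) auto
  have eq: "monomial \<alpha> (x + t *\<^sub>R axis b 1) = (x $ b + t) ^ \<alpha> b * (\<Prod>a\<in>UNIV - {b}. x $ a ^ \<alpha> a)" for t
    unfolding split by (auto simp: axis_def intro!: prod.cong)
  have "((\<lambda>t. (x $ b + t) ^ \<alpha> b * (\<Prod>a\<in>UNIV - {b}. x $ a ^ \<alpha> a)) has_field_derivative
    real (\<alpha> b) * x $ b ^ (\<alpha> b - 1) * (\<Prod>a\<in>UNIV - {b}. x $ a ^ \<alpha> a)) (at 0)"
    by (auto intro!: derivative_eq_intros)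
  moreover have "real (\<alpha> b) * monomial (\<alpha>(b := \<alpha> b - 1)) x =
      real (\<alpha> b) * x $ b ^ (\<alpha> b - 1) * (\<Prod>a\<in>UNIV - {b}. x $ a ^ \<alpha> a)"
    unfolding split by (auto intro!: prod.cong)
  ultimately show ?thesis by (simp only: eq)
qed

lemma poly_deg_le_pderiv_at:
  assumes "poly_deg_le k (p :: real^'n::finite \<Rightarrow> real)"
  shows "poly_deg_le (k - 1) (pderiv_at b p)"
proof -
  obtain c where p: "p = (\<lambda>x. \<Sum>\<alpha> | sum \<alpha> UNIV \<le> k. c \<alpha> * monomial \<alpha> x)"
    using assms unfolding poly_deg_le_altdef by blast
  have "pderiv_at b p x = (\<Sum>\<alpha> | sum \<alpha> UNIV \<le> k. c \<alpha> * (real (\<alpha> b) * monomial (\<alpha>(b := \<alpha> b - 1)) x))" for x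
    by (rule pderiv_at_DERIV) (unfold p, intro DERIV_sum DERIV_cmult monomial_DERIV)
  then have eq: "pderiv_at b p = (\<lambda>x. \<Sum>\<alpha> | sum \<alpha> UNIV \<le> k. c \<alpha> * (real (\<alpha> b) * monomial (\<alpha>(b := \<alpha> b - 1)) x))"
    by auto
  have low: "poly_deg_le (k - 1) (\<lambda>x. real (\<alpha> b) * monomial (\<alpha>(b := \<alpha> b - 1)) x)" if "sum \<alpha> UNIV \<le> k" for \<alpha>
  proof (cases "\<alpha> b = 0")
    case False
    have "sum \<alpha> UNIV = \<alpha> b + sum \<alpha> (UNIV - {b})" by (rule sum.remove) auto
    moreover have "sum (\<alpha>(b := \<alpha> b - 1)) UNIV = (\<alpha> b - 1) + sum (\<alpha>(b := \<alpha> b - 1)) (UNIV - {b})"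
      by (subst sum.remove[of _ b]) auto
    moreover have "sum (\<alpha>(b := \<alpha> b - 1)) (UNIV - {b}) = sum \<alpha> (UNIV - {b})"
      by (rule sum.cong) auto
    ultimately show ?thesis using that False
      by (intro poly_deg_le_cmult poly_deg_le_monomial) auto
  qed (simp add: poly_deg_le_0)
  show ?thesis unfolding eq by (intro poly_deg_le_sum poly_deg_le_cmult[OF low]) auto
qed

lemma poly_deg_le_pderivs:
  "poly_deg_le k p \<Longrightarrow> poly_deg_le (k - length bs) (pderivs bs p)"
proof (induction bs)
  case (Cons b bs)
  then have "poly_deg_le (k - length bs - 1) (pderiv_at b (pderivs bs p))"
    by (intro poly_deg_le_pderiv_at) auto
  then show ?case by simp
qed simp

lemma pderiv_at_diff:
  assumes "poly_deg_le k (p :: real^'n::finite \<Rightarrow> real)" "poly_deg_le k q"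
  shows "pderiv_at b (\<lambda>x. p x - q x) = (\<lambda>x. pderiv_at b p x - pderiv_at b q x)"
proof
  fix x
  obtain f where f: "\<And>s. p (x + s *\<^sub>R axis b 1) = poly f s"
    using poly_deg_le_on_line[OF assms(1), of x "axis b 1"] by metis
  obtain g where g: "\<And>s. q (x + s *\<^sub>R axis b 1) = poly g s"
    using poly_deg_le_on_line[OF assms(2), of x "axis b 1"] by metis
  have "p (x + s *\<^sub>R axis b 1) - q (x + s *\<^sub>R axis b 1) = poly (f - g) s" for s
    by (simp add: f g)
  then have "pderiv_at b (\<lambda>x. p x - q x) x = coeff (f - g) 1" by (rule pderiv_at_line)
  then show "pderiv_at b (\<lambda>x. p x - q x) x = pderiv_at b p x - pderiv_at b q x"
    using pderiv_at_line[of p x b f, OF f] pderiv_at_line[of q x b g, OF g] by simp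
qed

lemma pderivs_diff:
  assumes "poly_deg_le k (p :: real^'n::finite \<Rightarrow> real)" "poly_deg_le k q"
  shows "pderivs bs (\<lambda>x. p x - q x) = (\<lambda>x. pderivs bs p x - pderivs bs q x)"
proof (induction bs)
  case (Cons b bs)
  show ?case
    using pderiv_at_diff[OF poly_deg_le_pderivs[OF assms(1), of bs] poly_deg_le_pderivs[OF assms(2), of bs]]
    by (simp add: Cons)
qed simp

lemma pderiv_at_0: "pderiv_at b (\<lambda>x. 0) = (\<lambda>x. 0)"
  using pderiv_at_line[of "\<lambda>x. 0" _ b 0] by auto

lemma pderivs_0: "pderivs bs (\<lambda>x. 0) = (\<lambda>x. 0)"
  by (induction bs) (auto simp: pderiv_at_0)

lemma poly_has_derivative:
  assumes "poly_deg_le k (p :: real^'n::finite \<Rightarrow> real)"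
  shows "(p has_derivative (\<lambda>h. \<Sum>b\<in>UNIV. pderiv_at b p x * h $ b)) (at x)"
proof -
  obtain c where p: "p = (\<lambda>x. \<Sum>\<alpha> | sum \<alpha> UNIV \<le> k. c \<alpha> * (\<Prod>b\<in>UNIV. x $ b ^ \<alpha> b))"
    using assms unfolding poly_deg_le_altdef monomial_def by blast
  have diff1: "(\<lambda>x :: real^'n. \<Prod>b\<in>S. x $ b ^ \<alpha> b) differentiable (at x)" if "finite S" for S and \<alpha> :: "'n \<Rightarrow> nat"
    using that
  proof (induction S rule: finite_induct)
    case (insert b S)
    have "(\<lambda>x :: real^'n. x $ b) differentiable (at x)"
      using bounded_linear_vec_nth bounded_linear_imp_has_derivative differentiable_def by blast
    then show ?case using insert by (simp add: differentiable_mult differentiable_power)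
  qed simp
  have "p differentiable (at x)" unfolding p
    by (intro differentiable_sum differentiable_mult differentiable_const finite_multiindices ballI diff1) auto
  then obtain f' where f': "(p has_derivative f') (at x)" by (auto simp: differentiable_def)
  have axis: "pderiv_at b p x = f' (axis b 1)" for b
  proof (rule pderiv_at_DERIV)
    have "((\<lambda>t. x + t *\<^sub>R axis b 1) has_derivative (\<lambda>t. t *\<^sub>R axis b 1)) (at 0)"
      by (auto intro!: derivative_eq_intros)
    moreover have "(p has_derivative f') (at (x + 0 *\<^sub>R axis b 1))" using f' by simp
    ultimately have "((\<lambda>t. p (x + t *\<^sub>R axis b 1)) has_derivative (\<lambda>t. f' (t *\<^sub>R axis b 1))) (at 0)"
      by (rule has_derivative_compose)
    moreover have "(\<lambda>t. f' (t *\<^sub>R axis b 1)) = (*) (f' (axis b 1))"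
      using has_derivative_linear[OF f'] by (auto simp: linear_cmul)
    ultimately show "((\<lambda>t. p (x + t *\<^sub>R axis b 1)) has_field_derivative f' (axis b 1)) (at 0)"
      by (simp add: has_field_derivative_def)
  qed
  have "f' = (\<lambda>h. \<Sum>b\<in>UNIV. pderiv_at b p x * h $ b)"
  proof
    fix h :: "real^'n"
    have "f' h = f' (\<Sum>b\<in>UNIV. h $ b *\<^sub>R axis b 1)"
      using basis_expansion[of h] by (simp add: scalar_mult_eq_scaleR)
    also have "\<dots> = (\<Sum>b\<in>UNIV. pderiv_at b p x * h $ b)"
      using has_derivative_linear[OF f'] by (simp add: linear_sum linear_cmul axis mult.commute)
    finally show "f' h = (\<Sum>b\<in>UNIV. pderiv_at b p x * h $ b)" .
  qed
  then show ?thesis using f' by simp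
qed

text \<open>On the segment of length \<open>r\<close> in direction \<open>b\<close>, which stays in the ball of radius \<open>2 r\<close>, the polynomial
is bounded by \<open>poly_growth\<close>; its derivative at the starting point is a coefficient in one variable.\<close>

lemma markov_pderiv_at:
  "\<exists>C\<ge>1. \<forall>(p :: real^'n::finite \<Rightarrow> real) t x0 r b. poly_deg_le k p \<longrightarrow> 0 < r \<longrightarrow>
     (\<forall>x\<in>ball x0 r. \<bar>p x\<bar> \<le> t) \<longrightarrow> (\<forall>x\<in>ball x0 r. \<bar>pderiv_at b p x\<bar> \<le> C * t / r)"
proof -
  obtain C where C: "C \<ge> 1" and coeffs: "\<And>(f :: real poly) t i. degree f \<le> k \<Longrightarrow>
    (\<forall>s\<in>{0..<1}. \<bar>poly f s\<bar> \<le> t) \<Longrightarrow> \<bar>coeff f i\<bar> \<le> C * t"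
    using coeffs_bound_unit_interval[of k] by metis
  obtain G where G: "G \<ge> 1" and growth0: "\<forall>(p :: real^'n::finite \<Rightarrow> real) t x0 r s z. poly_deg_le k p \<longrightarrow> 0 < r \<longrightarrow>
     (\<forall>x\<in>ball x0 r. \<bar>p x\<bar> \<le> t) \<longrightarrow> r \<le> s \<longrightarrow> dist x0 z \<le> s \<longrightarrow> \<bar>p z\<bar> \<le> G * t * (s / r) ^ k"
    using poly_growth[of k, where ?'n = 'n] by (elim exE conjE)
  note growth = growth0[rule_format]
  show ?thesis
  proof (intro exI[of _ "C * (G * 2 ^ k)"] conjI allI impI ballI)
    have "1 * (1 * 1) \<le> C * (G * 2 ^ k)" using C G by (intro mult_mono) auto
    then show "1 \<le> C * (G * 2 ^ k)" by simp
  next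
    fix p :: "real^'n \<Rightarrow> real" and t r x0 b x
    assume p: "poly_deg_le k p" and r: "0 < r" and bd: "\<forall>x\<in>ball x0 r. \<bar>p x\<bar> \<le> t"
      and x: "x \<in> ball x0 r"
    obtain f where f: "degree f \<le> k" "\<And>s. p (x + s *\<^sub>R axis b 1) = poly f s"
      using poly_deg_le_on_line[OF p, of x "axis b 1"] by metis
    \<comment> \<open>The rescaling to the unit interval produces the factor 1 / r.\<close>
    define g where "g = pcompose f [:0, r:]"
    have "degree g \<le> k"
      unfolding g_def using degree_pcompose_le[of f "[:0, r:]"] f(1) r by simp
    moreover have "\<forall>s\<in>{0..<1}. \<bar>poly g s\<bar> \<le> G * t * 2 ^ k"
    proof
      fix s :: real assume s: "s \<in> {0..<1}"
      have "dist x0 (x + (s * r) *\<^sub>R axis b 1) \<le> dist x0 x + s * r"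
        using dist_triangle[of x0 "x + (s * r) *\<^sub>R axis b 1" x] s r by (simp add: dist_norm)
      moreover have "s * r \<le> r" using s r by simp
      ultimately have "dist x0 (x + (s * r) *\<^sub>R axis b 1) \<le> 2 * r" using x by simp
      then have "\<bar>p (x + (s * r) *\<^sub>R axis b 1)\<bar> \<le> G * t * (2 * r / r) ^ k"
        using growth[OF p r bd[rule_format], of x0 "2 * r"] r by simp
      then show "\<bar>poly g s\<bar> \<le> G * t * 2 ^ k"
        using r by (simp add: g_def poly_pcompose f(2) mult.commute)
    qed
    ultimately have "\<bar>coeff g 1\<bar> \<le> C * (G * t * 2 ^ k)" by (rule coeffs)
    moreover have "coeff g 1 = r * coeff f 1"
      by (simp add: g_def coeff_pcompose_linear)
    ultimately show "\<bar>pderiv_at b p x\<bar> \<le> C * (G * 2 ^ k) * t / r"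
      using pderiv_at_line[of p x b f, OF f(2)] r by (simp add: abs_mult field_simps)
  qed
qed

lemma markov_pderivs:
  "\<exists>C\<ge>1. \<forall>(p :: real^'n::finite \<Rightarrow> real) t x0 r bs. poly_deg_le k p \<longrightarrow> 0 < r \<longrightarrow>
     (\<forall>x\<in>ball x0 r. \<bar>p x\<bar> \<le> t) \<longrightarrow> length bs \<le> k \<longrightarrow>
     (\<forall>x\<in>ball x0 r. \<bar>pderivs bs p x\<bar> \<le> C * t / r ^ length bs)"
proof -
  obtain C where C: "C \<ge> 1" and markov0: "\<forall>(p :: real^'n::finite \<Rightarrow> real) t x0 r b. poly_deg_le k p \<longrightarrow> 0 < r \<longrightarrow>
     (\<forall>x\<in>ball x0 r. \<bar>p x\<bar> \<le> t) \<longrightarrow> (\<forall>x\<in>ball x0 r. \<bar>pderiv_at b p x\<bar> \<le> C * t / r)"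
    using markov_pderiv_at[of k, where ?'n = 'n] by (elim exE conjE)
  note markov = markov0[rule_format]
  show ?thesis
  proof (intro exI[of _ "C ^ k"] conjI allI impI)
    show "1 \<le> C ^ k" using C by simp
  next
    fix p :: "real^'n \<Rightarrow> real" and t r x0 bs
    assume p: "poly_deg_le k p" and r: "0 < r" and bd: "\<forall>x\<in>ball x0 r. \<bar>p x\<bar> \<le> t"
      and len: "length (bs :: 'n list) \<le> k"
    have t: "0 \<le> t" using bd[rule_format, of x0] r by simp
    have iter: "\<forall>x\<in>ball x0 r. \<bar>pderivs bs p x\<bar> \<le> C ^ length bs * t / r ^ length bs" for bs
    proof (induction bs)
      case (Cons b bs)
      have "poly_deg_le k (pderivs bs p)"
        using poly_deg_le_mono[OF poly_deg_le_pderivs[OF p]] by simp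
      then show ?case
        using markov[of "pderivs bs p" r x0 "C ^ length bs * t / r ^ length bs"] Cons r
        by (auto simp: mult_ac)
    qed (use bd in simp)
    have "C ^ length bs * t / r ^ length bs \<le> C ^ k * t / r ^ length bs"
      using C t r len by (intro divide_right_mono mult_right_mono power_increasing) auto
    then show "\<forall>x\<in>ball x0 r. \<bar>pderivs bs p x\<bar> \<le> C ^ k * t / r ^ length bs"
      using iter[of bs] by force
  qed
qed

section \<open>Measurability of distances between tuple-valued maps\<close>

definition rational_tuples :: "nat \<Rightarrow> nat \<Rightarrow> (nat \<Rightarrow> real) multiset set" where
  "rational_tuples Q m =
     (\<lambda>ls :: rat list list. mset (map (\<lambda>l c. if c < m then of_rat (l ! c) else 0) ls)) ` {ls. length ls = Q}"

lemma countable_rational_tuples: "countable (rational_tuples Q m)"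
  unfolding rational_tuples_def by (intro countable_image) simp

lemma rational_tuples_AQ: "rational_tuples Q m \<subseteq> AQ Q {..<m}"
  by (auto simp: rational_tuples_def AQ_def vecs_def)

text \<open>Separability reduces the measurability of the distance of two tuple-valued maps to that of the
distances to fixed tuples.\<close>

lemma rational_tuples_dense:
  assumes M: "M \<in> AQ Q {..<m}" and "0 < e"
  shows "\<exists>T\<in>rational_tuples Q m. GQ {..<m} M T < e"
proof -
  obtain R where R: "mset R = M" using ex_mset by blast
  have len: "length R = Q" using M R by (auto simp: AQ_def)
  define t where "t = e / (real (Q * m) + 1)"
  have pos: "0 < real (Q * m) + 1" by (rule add_nonneg_pos) auto
  have t: "0 < t" unfolding t_def using assms(2) pos by (rule divide_pos_pos)
  have "\<exists>r :: rat. \<bar>x - of_rat r\<bar> \<le> t" for x :: real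
  proof -
    obtain r where "x - t < of_rat r" "of_rat r < x" using of_rat_dense[of "x - t" x] t by auto
    then show ?thesis by (intro exI[of _ r]) simp
  qed
  then obtain f :: "real \<Rightarrow> rat" where f: "\<And>x. \<bar>x - of_rat (f x)\<bar> \<le> t" by metis
  define T where "T = map (\<lambda>v. map (\<lambda>c. f (v c)) [0..<m]) R"
  define T' where "T' = map (\<lambda>l c. if c < m then real_of_rat (l ! c) else 0) T"
  have "mset T' \<in> rational_tuples Q m"
    unfolding rational_tuples_def T'_def using len by (intro imageI) (simp add: T_def)
  moreover have "GQ {..<m} (mset R) (mset T') \<le> real (length R * card {..<m}) * t"
    by (rule GQ_le_sum_components) (auto simp: T'_def T_def f)
  moreover have "real (Q * m) * t < e"
  proof -
    have "real (Q * m) * t < (real (Q * m) + 1) * t" using t by simp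
    also have "\<dots> = e" using pos by (simp add: t_def)
    finally show ?thesis .
  qed
  ultimately have "GQ {..<m} M (mset T') < e" using R len by simp
  then show ?thesis using \<open>mset T' \<in> rational_tuples Q m\<close> by blast
qed

text \<open>By density, \<open>GQ (u x) (w x) < a\<close> holds iff \<open>GQ (u x) T + GQ (w x) T < a\<close> for some tuple \<open>T\<close> in a
countable set.\<close>

lemma measurable_GQ:
  fixes m :: nat
  assumes u: "\<And>x. x \<in> S \<Longrightarrow> u x \<in> AQ Q {..<m}" and w: "\<And>x. x \<in> S \<Longrightarrow> w x \<in> AQ Q {..<m}"
    and mu: "measurableQ Q {..<m} S u" and mw: "measurableQ Q {..<m} S w" and S: "S \<in> sets lebesgue"
  shows "(\<lambda>x. GQ {..<m} (u x) (w x)) \<in> borel_measurable (lebesgue_on S)"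
  unfolding borel_measurable_iff_less
proof
  fix a
  define D where "D = rational_tuples Q m"
  have D: "countable D" "\<And>T. T \<in> D \<Longrightarrow> T \<in> AQ Q {..<m}"
    using countable_rational_tuples subsetD[OF rational_tuples_AQ] unfolding D_def by blast+
  have "{x \<in> space (lebesgue_on S). GQ {..<m} (u x) (w x) < a}
      = (\<Union>T\<in>D. {x \<in> space (lebesgue_on S). GQ {..<m} (u x) T + GQ {..<m} (w x) T < a})" (is "?L = ?R")
  proof (intro set_eqI iffI)
    fix x assume "x \<in> ?L"
    then have x: "x \<in> S" "GQ {..<m} (u x) (w x) < a" by auto
    obtain T where T: "T \<in> D" "GQ {..<m} (w x) T < (a - GQ {..<m} (u x) (w x)) / 2"
      using rational_tuples_dense[OF w[OF x(1)]] x(2) unfolding D_def by (metis diff_gt_0_iff_gt half_gt_zero)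
    have "GQ {..<m} (u x) T \<le> GQ {..<m} (u x) (w x) + GQ {..<m} (w x) T"
      using u[OF x(1)] w[OF x(1)] D(2)[OF T(1)] by (intro GQ_triangle) (auto simp: AQ_def)
    then show "x \<in> ?R" using T x by (auto intro!: bexI[of _ T])
  next
    fix x assume "x \<in> ?R"
    then obtain T where T: "x \<in> S" "T \<in> D" "GQ {..<m} (u x) T + GQ {..<m} (w x) T < a" by auto
    have sz: "size (u x) = size T" "size T = size (w x)"
      using u[OF T(1)] w[OF T(1)] D(2)[OF T(2)] by (auto simp: AQ_def)
    have "GQ {..<m} (u x) (w x) \<le> GQ {..<m} (u x) T + GQ {..<m} (w x) T"
      using GQ_triangle[OF sz, of "{..<m}"] GQ_commute[OF sz(2), of "{..<m}"] by simp
    then show "x \<in> ?L" using T by simp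
  qed
  also have "\<dots> \<in> sets (lebesgue_on S)"
  proof (intro sets.countable_UN'' D(1))
    fix T assume "T \<in> D"
    then have [measurable]: "(\<lambda>x. GQ {..<m} (u x) T) \<in> borel_measurable (lebesgue_on S)"
      "(\<lambda>x. GQ {..<m} (w x) T) \<in> borel_measurable (lebesgue_on S)"
      using mu mw D(2) by (auto simp: measurableQ_def)
    show "{x \<in> space (lebesgue_on S). GQ {..<m} (u x) T + GQ {..<m} (w x) T < a} \<in> sets (lebesgue_on S)"
      by measurable
  qed
  finally show "{x \<in> space (lebesgue_on S). GQ {..<m} (u x) (w x) < a} \<in> sets (lebesgue_on S)" .
qed

lemma measurableQ_continuous:
  fixes m :: nat
  assumes w: "\<And>x. x \<in> S \<Longrightarrow> w x \<in> AQ Q {..<m}" and cont: "continuousQ_on S {..<m} w"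
    and S: "S \<in> sets lebesgue"
  shows "measurableQ Q {..<m} S w"
  unfolding measurableQ_def
proof
  fix T assume T: "T \<in> AQ Q {..<m}"
  have "continuous_on S (\<lambda>x. GQ {..<m} (w x) T)"
    unfolding continuous_on_def
  proof
    fix x assume x: "x \<in> S"
    have "((\<lambda>y. GQ {..<m} (w y) T - GQ {..<m} (w x) T) \<longlongrightarrow> 0) (at x within S)"
    proof (rule Lim_null_comparison)
      show "((\<lambda>y. GQ {..<m} (w y) (w x)) \<longlongrightarrow> 0) (at x within S)"
        using cont x by (simp add: continuousQ_on_def)
      show "\<forall>\<^sub>F y in at x within S. norm (GQ {..<m} (w y) T - GQ {..<m} (w x) T) \<le> GQ {..<m} (w y) (w x)"
        unfolding eventually_at_filter
      proof (rule always_eventually, intro allI impI)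
        fix y assume "y \<in> S"
        then have sz: "size (w y) = size (w x)" "size (w x) = size T" "size (w y) = size T"
          using w[OF x] w[of y] T by (auto simp: AQ_def)
        show "norm (GQ {..<m} (w y) T - GQ {..<m} (w x) T) \<le> GQ {..<m} (w y) (w x)"
          using GQ_triangle[OF sz(1,2), of "{..<m}"] GQ_triangle[OF sz(1)[symmetric] sz(3), of "{..<m}"]
            GQ_commute[OF sz(1), of "{..<m}"] by (simp add: abs_le_iff)
      qed
    qed
    then show "((\<lambda>y. GQ {..<m} (w y) T) \<longlongrightarrow> GQ {..<m} (w x) T) (at x within S)"
      by (simp add: LIM_zero_iff)
  qed
  then show "(\<lambda>x. GQ {..<m} (w x) T) \<in> borel_measurable (lebesgue_on S)"
    using S by (rule continuous_imp_measurable_on_sets_lebesgue)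
qed

lemma measurableQ_subset:
  assumes "measurableQ Q I S u" "T \<subseteq> S" "S \<in> sets lebesgue" "T \<in> sets lebesgue"
  shows "measurableQ Q I T u"
  using assms measurable_restrict_mono unfolding measurableQ_def by blast

section \<open>Matching multi-valued polynomials by one permutation\<close>

definition polymap :: "nat \<Rightarrow> nat \<Rightarrow> (real^'n::finite \<Rightarrow> nat \<Rightarrow> real) \<Rightarrow> bool" where
  "polymap k m p \<longleftrightarrow> (\<forall>x. p x \<in> vecs {..<m}) \<and> (\<forall>a<m. poly_deg_le k (\<lambda>x. p x a))"

text \<open>A multi-valued polynomial is represented by a list of polynomial maps: a choice of enumeration that
is global in \<open>x\<close>, to which permutations can be applied.\<close>

definition polytuple :: "nat \<Rightarrow> nat \<Rightarrow> nat \<Rightarrow> (real^'n::finite \<Rightarrow> nat \<Rightarrow> real) list \<Rightarrow> bool" where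
  "polytuple k Q m R \<longleftrightarrow> length R = Q \<and> (\<forall>p\<in>set R. polymap k m p)"

definition evalQ :: "('x \<Rightarrow> 'y) list \<Rightarrow> 'x \<Rightarrow> 'y multiset" where
  "evalQ R x = mset (map (\<lambda>p. p x) R)"

lemma multipolys_evalQ:
  assumes "(Q, m, P) \<in> multipolys k"
  obtains R where "polytuple k Q m R" "P = evalQ R"
proof -
  obtain ps where ps: "size ps = Q"
    "\<forall>p\<in>#ps. (\<forall>x. p x \<in> vecs {..<m}) \<and> (\<forall>a<m. poly_deg_le k (\<lambda>x. p x a))"
    "P = (\<lambda>x. image_mset (\<lambda>p. p x) ps)"
    using assms unfolding multipolys_def by auto
  obtain R where R: "mset R = ps" using ex_mset by blast
  show ?thesis
  proof (rule that)
    show "polytuple k Q m R" using ps R by (auto simp: polytuple_def polymap_def)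
    show "P = evalQ R" using ps R by (auto simp: evalQ_def)
  qed
qed

lemma evalQ_AQ: "polytuple k Q m R \<Longrightarrow> evalQ R x \<in> AQ Q {..<m}"
  by (auto simp: polytuple_def polymap_def evalQ_def AQ_def)

lemma evalQ_mset_eq: "mset R = mset T \<Longrightarrow> evalQ R = evalQ T"
  unfolding evalQ_def by (simp add: fun_eq_iff)

lemma polytuple_mset_eq: "mset R = mset T \<Longrightarrow> polytuple k Q m R \<Longrightarrow> polytuple k Q m T"
  unfolding polytuple_def by (metis size_mset set_mset_mset)

lemma polytuple_component:
  "polytuple k Q m R \<Longrightarrow> i < Q \<Longrightarrow> a < m \<Longrightarrow> poly_deg_le k (\<lambda>x. (R ! i) x a)"
  unfolding polytuple_def polymap_def by (metis nth_mem)

lemma GQ_evalQ_le: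
  fixes m :: nat
  assumes "length R = Q" "length T = Q"
    and "\<And>i a. i < Q \<Longrightarrow> a < m \<Longrightarrow> \<bar>(R ! i) x a - (T ! i) x a\<bar> \<le> t"
  shows "GQ {..<m} (evalQ R x) (evalQ T x) \<le> real (Q * m) * t"
  unfolding evalQ_def
  using GQ_le_sum_components[of "map (\<lambda>p. p x) R" "map (\<lambda>p. p x) T" "{..<m}" t] assms by auto

lemma continuousQ_evalQ:
  assumes R: "polytuple k Q m R"
  shows "continuousQ_on S {..<m} (evalQ R)"
  unfolding continuousQ_on_def
proof
  fix x assume "x \<in> S"
  show "((\<lambda>y. GQ {..<m} (evalQ R y) (evalQ R x)) \<longlongrightarrow> 0) (at x within S)"
  proof (rule Lim_null_comparison)
    have len: "length R = Q" using R by (simp add: polytuple_def)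
    have "((\<lambda>y. (R ! i) y a) \<longlongrightarrow> (R ! i) x a) (at x within S)" if "i < Q" "a < m" for i a
      using continuous_on_poly_deg_le[OF polytuple_component[OF R that], of UNIV]
      by (auto simp: continuous_on_def intro: tendsto_within_subset)
    then have "((\<lambda>y. \<Sum>i<Q. \<Sum>a<m. \<bar>(R ! i) y a - (R ! i) x a\<bar>) \<longlongrightarrow>
        (\<Sum>i<Q. \<Sum>a<m. \<bar>(R ! i) x a - (R ! i) x a\<bar>)) (at x within S)"
      by (intro tendsto_intros) auto
    then show "((\<lambda>y. real (Q * m) * (\<Sum>i<Q. \<Sum>a<m. \<bar>(R ! i) y a - (R ! i) x a\<bar>)) \<longlongrightarrow> 0) (at x within S)"
      by (intro tendsto_mult_right_zero) simp
    show "\<forall>\<^sub>F y in at x within S. norm (GQ {..<m} (evalQ R y) (evalQ R x))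
        \<le> real (Q * m) * (\<Sum>i<Q. \<Sum>a<m. \<bar>(R ! i) y a - (R ! i) x a\<bar>)"
    proof (rule always_eventually, rule allI)
      fix y
      let ?s = "\<Sum>i<Q. \<Sum>a<m. \<bar>(R ! i) y a - (R ! i) x a\<bar>"
      have "\<bar>(R ! i) y a - (R ! i) x a\<bar> \<le> ?s" if "i < Q" "a < m" for i a
      proof -
        have "\<bar>(R ! i) y a - (R ! i) x a\<bar> \<le> (\<Sum>a<m. \<bar>(R ! i) y a - (R ! i) x a\<bar>)"
          using that by (intro member_le_sum) auto
        also have "\<dots> \<le> ?s"
          using that by (intro member_le_sum[where f = "\<lambda>i. \<Sum>a<m. \<bar>(R ! i) y a - (R ! i) x a\<bar>"])
            (auto intro: sum_nonneg)
        finally show ?thesis .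
      qed
      then have "GQ {..<m} (mset (map (\<lambda>p. p y) R)) (mset (map (\<lambda>p. p x) R)) \<le> real (Q * m) * ?s"
        using GQ_le_sum_components[of "map (\<lambda>p. p y) R" "map (\<lambda>p. p x) R" "{..<m}" ?s] len by auto
      then show "norm (GQ {..<m} (evalQ R y) (evalQ R x)) \<le> real (Q * m) * ?s"
        by (simp add: evalQ_def GQ_nonneg)
    qed
  qed
qed

lemma measurableQ_evalQ:
  "polytuple k Q m R \<Longrightarrow> S \<in> sets lebesgue \<Longrightarrow> measurableQ Q {..<m} S (evalQ R)"
  by (intro measurableQ_continuous evalQ_AQ continuousQ_evalQ)

lemma measurable_GQ_evalQ:
  assumes "polytuple k Q m R" "polytuple k Q m T" "S \<in> sets lebesgue"
  shows "(\<lambda>x. GQ {..<m} (evalQ R x) (evalQ T x)) \<in> borel_measurable (lebesgue_on S)"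
  using assms by (intro measurable_GQ evalQ_AQ measurableQ_evalQ)

text \<open>The matching depends on the point \<open>x\<close>, but it permutes the polynomial maps and not only their values
at \<open>x\<close>; there are finitely many candidates.\<close>

lemma good_matching_at_point:
  fixes m :: nat
  assumes "length R = Q" "length T = Q" "GQ {..<m} (evalQ R x) (evalQ T x) \<le> s"
  obtains \<tau> where "\<tau> permutes {..<Q}"
    "\<And>i a. i < Q \<Longrightarrow> a < m \<Longrightarrow> \<bar>(R ! i) x a - (permute_list \<tau> T ! i) x a\<bar> \<le> s"
proof -
  have "size (evalQ T x) = length (map (\<lambda>p. p x) R)" using assms by (simp add: evalQ_def)
  then obtain Y where Y: "mset Y = evalQ T x" "length Y = length (map (\<lambda>p. p x) R)"
    and close: "\<And>i a. i < length (map (\<lambda>p. p x) R) \<Longrightarrow> a \<in> {..<m} \<Longrightarrow>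
      \<bar>(map (\<lambda>p. p x) R ! i) a - (Y ! i) a\<bar> \<le> GQ {..<m} (mset (map (\<lambda>p. p x) R)) (evalQ T x)"
    by (rule GQ_components_small[OF finite_lessThan]) (rule that)
  from Y(1) have "mset Y = mset (map (\<lambda>p. p x) T)" by (simp add: evalQ_def)
  then obtain \<tau> where \<tau>: "\<tau> permutes {..<length (map (\<lambda>p. p x) T)}" "permute_list \<tau> (map (\<lambda>p. p x) T) = Y"
    by (rule mset_eq_permutation)
  have "\<bar>(R ! i) x a - (permute_list \<tau> T ! i) x a\<bar> \<le> s" if "i < Q" "a < m" for i a
  proof -
    have "\<tau> i < Q" using permutes_in_image[of \<tau> "{..<Q}" i] \<tau>(1) that assms(2) by simp
    then have "Y ! i = (permute_list \<tau> T ! i) x"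
      using \<tau> that assms(2) by (auto simp flip: \<tau>(2) simp: permute_list_nth)
    then show ?thesis using close[of i a] assms(1,3) that by (simp add: evalQ_def)
  qed
  then show ?thesis using that[of \<tau>] \<tau>(1) assms(2) by simp
qed

text \<open>The factor \<open>1 + 2/c\<close> makes the exceptional set at most half as large as the lower bound for \<open>S\<close>.
It works for every exponent \<open>q \<ge> 1\<close>, because \<open>(1 + 2/c)\<^sup>-\<^sup>q \<le> (1 + 2/c)\<^sup>-\<^sup>1 \<le> c/2\<close>.\<close>

lemma chebyshev_half:
  fixes g :: "real^'n::finite \<Rightarrow> real"
  assumes c: "0 < c" and q: "1 \<le> q" and t: "0 < t" and r: "0 < r" and S: "S \<in> lmeasurable"
    and big: "c * r ^ CARD('n) \<le> measure lebesgue S"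
    and g: "g \<in> borel_measurable (lebesgue_on S)"
    and le: "(\<integral>\<^sup>+x\<in>S. ennreal (g x powr q) \<partial>lebesgue) \<le> ennreal (t powr q * r ^ CARD('n))"
  shows "{x\<in>S. g x \<le> t * (1 + 2 / c)} \<in> lmeasurable"
    "c / 2 * r ^ CARD('n) \<le> measure lebesgue {x\<in>S. g x \<le> t * (1 + 2 / c)}"
proof -
  define s where "s = t * (1 + 2 / c)"
  have s: "0 < s" using t c by (auto simp: s_def intro!: mult_pos_pos add_pos_pos)
  have SS: "S \<in> sets lebesgue" using S by auto
  have meas: "{x\<in>S. g x \<in> B} \<in> sets lebesgue" if "B \<in> sets borel" for B
  proof -
    have "{x \<in> space (lebesgue_on S). g x \<in> B} \<in> sets (lebesgue_on S)"
      using g that by measurable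
    then show ?thesis using SS by (simp add: sets_restrict_space_iff)
  qed
  have G1: "{x\<in>S. g x \<le> s} \<in> sets lebesgue" using meas[of "{..s}"] by simp
  have G2: "{x\<in>S. g x > s} \<in> sets lebesgue" using meas[of "{s<..}"] by simp
  have L1: "{x\<in>S. g x \<le> s} \<in> lmeasurable" by (rule fmeasurableI2[OF S _ G1]) auto
  have L2: "{x\<in>S. g x > s} \<in> lmeasurable" by (rule fmeasurableI2[OF S _ G2]) auto
  show "{x\<in>S. g x \<le> t * (1 + 2 / c)} \<in> lmeasurable" using L1 by (simp add: s_def)
  have "ennreal (s powr q * measure lebesgue {x\<in>S. g x > s}) = ennreal (s powr q) * emeasure lebesgue {x\<in>S. g x > s}"
    using L2 by (simp add: ennreal_mult emeasure_eq_measure2)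
  also have "\<dots> = (\<integral>\<^sup>+x. ennreal (s powr q) * indicator {x\<in>S. g x > s} x \<partial>lebesgue)"
    using G2 by (simp add: nn_integral_cmult_indicator)
  also have "\<dots> \<le> (\<integral>\<^sup>+x\<in>S. ennreal (g x powr q) \<partial>lebesgue)"
    using s q by (intro nn_integral_mono) (auto simp: indicator_def intro!: powr_mono2)
  also have "\<dots> \<le> ennreal (t powr q * r ^ CARD('n))" by (rule le)
  finally have "s powr q * measure lebesgue {x\<in>S. g x > s} \<le> t powr q * r ^ CARD('n)"
    using r by (simp add: ennreal_le_iff)
  then have "measure lebesgue {x\<in>S. g x > s} \<le> (t powr q * r ^ CARD('n)) / s powr q"
    using s by (simp add: pos_le_divide_eq mult.commute)
  also have "\<dots> = (t / s) powr q * r ^ CARD('n)" using s t by (simp add: powr_divide)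
  also have "\<dots> \<le> (c / 2) * r ^ CARD('n)"
  proof (rule mult_right_mono)
    have ts: "t / s = 1 / (1 + 2 / c)" using t by (simp add: s_def)
    have "(t / s) powr q \<le> (t / s) powr 1"
      using q c by (intro powr_mono') (auto simp: ts field_simps)
    also have "\<dots> \<le> c / 2" using c unfolding ts by (simp add: field_simps add_pos_pos)
    finally show "(t / s) powr q \<le> c / 2" .
  qed (use r in simp)
  finally have small: "measure lebesgue {x\<in>S. g x > s} \<le> (c / 2) * r ^ CARD('n)" .
  have "S = {x\<in>S. g x \<le> s} \<union> {x\<in>S. g x > s}" by auto
  then have "measure lebesgue S \<le> measure lebesgue {x\<in>S. g x \<le> s} + measure lebesgue {x\<in>S. g x > s}"
    using measure_Un_le[OF G1 G2] by simp
  then have "c / 2 * r ^ CARD('n) \<le> measure lebesgue {x\<in>S. g x \<le> s}"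
    using small big by (simp add: field_simps)
  then show "c / 2 * r ^ CARD('n) \<le> measure lebesgue {x\<in>S. g x \<le> t * (1 + 2 / c)}"
    by (simp add: s_def)
qed

text \<open>The good points are covered by \<open>Q!\<close> sets, one for each permutation, so one of these sets has
measure at least \<open>c r\<^sup>n / (2 Q!)\<close>. On it the matched components are uniformly close, and the Remez
inequality extends this to the ball. The point is that a single permutation serves the whole ball.\<close>

lemma matching_of_polytuples:
  assumes c: "0 < c" and q: "1 \<le> q"
  shows "\<exists>C\<ge>1. \<forall>(R :: (real^'n::finite \<Rightarrow> nat \<Rightarrow> real) list) T x0 r t S.
    polytuple k Q m R \<longrightarrow> polytuple k Q m T \<longrightarrow> 0 < r \<longrightarrow> 0 < t \<longrightarrow> S \<in> lmeasurable \<longrightarrow> S \<subseteq> ball x0 r \<longrightarrow>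
    c * r ^ CARD('n) \<le> measure lebesgue S \<longrightarrow>
    (\<integral>\<^sup>+x\<in>S. ennreal (GQ {..<m} (evalQ R x) (evalQ T x) powr q) \<partial>lebesgue) \<le> ennreal (t powr q * r ^ CARD('n)) \<longrightarrow>
    (\<exists>T'. mset T' = mset T \<and>
      (\<forall>i<Q. \<forall>a<m. \<forall>x\<in>ball x0 r. \<bar>(R ! i) x a - (T' ! i) x a\<bar> \<le> C * t))"
proof -
  define c' where "c' = c / 2 / fact Q"
  have c': "0 < c'" using c by (simp add: c'_def)
  obtain C where C: "C \<ge> 1" and remez0: "\<forall>(p :: real^'n::finite \<Rightarrow> real) E t x0 r. poly_deg_le k p \<longrightarrow> E \<in> lmeasurable \<longrightarrow> 0 < r \<longrightarrow>
     E \<subseteq> ball x0 r \<longrightarrow> c' * r ^ CARD('n) \<le> measure lebesgue E \<longrightarrow> (\<forall>x\<in>E. \<bar>p x\<bar> \<le> t) \<longrightarrow>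
     (\<forall>x\<in>ball x0 r. \<bar>p x\<bar> \<le> C * t)"
    using remez_ball[OF c', of k, where ?'n = 'n] by (elim exE conjE)
  note remez = remez0[rule_format]
  show ?thesis
  proof (intro exI[of _ "C * (1 + 2 / c)"] conjI allI impI)
    have "1 * 1 \<le> C * (1 + 2 / c)" using C c by (intro mult_mono) auto
    then show "1 \<le> C * (1 + 2 / c)" by simp
  next
    fix R T :: "(real^'n \<Rightarrow> nat \<Rightarrow> real) list" and x0 r t S
    assume R: "polytuple k Q m R" and T: "polytuple k Q m T" and r: "(0::real) < r" and t: "(0::real) < t"
      and S: "S \<in> lmeasurable" and sub: "S \<subseteq> ball x0 r" and big: "c * r ^ CARD('n) \<le> measure lebesgue S"
      and le: "(\<integral>\<^sup>+x\<in>S. ennreal (GQ {..<m} (evalQ R x) (evalQ T x) powr q) \<partial>lebesgue) \<le> ennreal (t powr q * r ^ CARD('n))"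
    define s where "s = t * (1 + 2 / c)"
    define B where "B = {x\<in>S. GQ {..<m} (evalQ R x) (evalQ T x) \<le> s}"
    have B: "B \<in> lmeasurable" "c / 2 * r ^ CARD('n) \<le> measure lebesgue B"
      unfolding B_def s_def
      using chebyshev_half[OF c q t r S big measurable_GQ_evalQ[OF R T] le] S by auto
    define E where "E = (\<lambda>\<tau>. {x\<in>S. \<forall>i<Q. \<forall>a<m. \<bar>(R ! i) x a - (permute_list \<tau> T ! i) x a\<bar> \<le> s})"
    define PP where "PP = {\<tau>. \<tau> permutes {..<Q}}"
    have PP: "finite PP" "card PP = fact Q"
      unfolding PP_def by (auto simp: finite_permutations card_permutations)
    have perm: "polytuple k Q m (permute_list \<tau> T)" if "\<tau> \<in> PP" for \<tau>
      using that T polytuple_mset_eq[of T "permute_list \<tau> T"] by (simp add: PP_def polytuple_def)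
    have E: "E \<tau> \<in> lmeasurable" if \<tau>: "\<tau> \<in> PP" for \<tau>
    proof -
      have "closed {x. \<bar>(R ! i) x a - (permute_list \<tau> T ! i) x a\<bar> \<le> s}" if "i < Q" "a < m" for i a
        by (intro closed_Collect_le continuous_intros
              continuous_on_poly_deg_le[OF polytuple_component[OF R that]]
              continuous_on_poly_deg_le[OF polytuple_component[OF perm[OF \<tau>] that]])
      then have "closed (\<Inter>i\<in>{..<Q}. \<Inter>a\<in>{..<m}. {x. \<bar>(R ! i) x a - (permute_list \<tau> T ! i) x a\<bar> \<le> s})"
        by (intro closed_INT) auto
      moreover have "E \<tau> = S \<inter> (\<Inter>i\<in>{..<Q}. \<Inter>a\<in>{..<m}. {x. \<bar>(R ! i) x a - (permute_list \<tau> T ! i) x a\<bar> \<le> s})"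
        by (auto simp: E_def)
      ultimately show ?thesis
        using S by (intro fmeasurableI2[OF S]) auto
    qed
    have "B \<subseteq> (\<Union>\<tau>\<in>PP. E \<tau>)"
    proof
      fix x assume x: "x \<in> B"
      then obtain \<tau> where "\<tau> permutes {..<Q}"
        "\<And>i a. i < Q \<Longrightarrow> a < m \<Longrightarrow> \<bar>(R ! i) x a - (permute_list \<tau> T ! i) x a\<bar> \<le> s"
        using good_matching_at_point[of R Q T m x s] R T by (auto simp: B_def polytuple_def)
      then show "x \<in> (\<Union>\<tau>\<in>PP. E \<tau>)" using x by (auto simp: PP_def E_def B_def)
    qed
    then have "measure lebesgue B \<le> measure lebesgue (\<Union>\<tau>\<in>PP. E \<tau>)"
      using B E PP by (intro measure_mono_fmeasurable fmeasurable.finite_UN) (auto dest: fmeasurableD)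
    also have "\<dots> \<le> (\<Sum>\<tau>\<in>PP. measure lebesgue (E \<tau>))"
      using E PP by (intro measure_UNION_le) auto
    finally have le_sum: "c / 2 * r ^ CARD('n) \<le> (\<Sum>\<tau>\<in>PP. measure lebesgue (E \<tau>))" using B by simp
    have "\<exists>\<tau>\<in>PP. c' * r ^ CARD('n) \<le> measure lebesgue (E \<tau>)"
    proof (rule ccontr)
      assume "\<not> ?thesis"
      then have "\<And>\<tau>. \<tau> \<in> PP \<Longrightarrow> measure lebesgue (E \<tau>) < c' * r ^ CARD('n)" by force
      moreover have "PP \<noteq> {}" using PP by (metis card.empty fact_nonzero of_nat_0 of_nat_fact)
      ultimately have "(\<Sum>\<tau>\<in>PP. measure lebesgue (E \<tau>)) < (\<Sum>\<tau>\<in>PP. c' * r ^ CARD('n))"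
        using PP by (intro sum_strict_mono) auto
      also have "\<dots> = c / 2 * r ^ CARD('n)" by (simp add: PP c'_def)
      finally show False using le_sum by simp
    qed
    then obtain \<tau> where \<tau>: "\<tau> \<in> PP" "c' * r ^ CARD('n) \<le> measure lebesgue (E \<tau>)" by blast
    show "\<exists>T'. mset T' = mset T \<and>
      (\<forall>i<Q. \<forall>a<m. \<forall>x\<in>ball x0 r. \<bar>(R ! i) x a - (T' ! i) x a\<bar> \<le> C * (1 + 2 / c) * t)"
    proof (intro exI conjI allI impI ballI)
      show "mset (permute_list \<tau> T) = mset T" using \<tau>(1) T by (simp add: PP_def polytuple_def)
      fix i a x assume ia: "i < Q" "a < m" and x: "x \<in> ball x0 r"
      have "\<bar>(R ! i) x a - (permute_list \<tau> T ! i) x a\<bar> \<le> C * s"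
      proof (rule remez[OF _ E[OF \<tau>(1)] r _ \<tau>(2) _ x])
        show "poly_deg_le k (\<lambda>x. (R ! i) x a - (permute_list \<tau> T ! i) x a)"
          by (intro poly_deg_le_diff polytuple_component[OF R ia] polytuple_component[OF perm[OF \<tau>(1)] ia])
        show "E \<tau> \<subseteq> ball x0 r" using sub by (auto simp: E_def)
        show "\<bar>(R ! i) y a - (permute_list \<tau> T ! i) y a\<bar> \<le> s" if "y \<in> E \<tau>" for y
          using that ia by (auto simp: E_def)
      qed
      then show "\<bar>(R ! i) x a - (permute_list \<tau> T ! i) x a\<bar> \<le> C * (1 + 2 / c) * t"
        by (simp add: s_def mult_ac)
    qed
  qed
qed

section \<open>Comparison of two approximations of the same function\<close>

text \<open>The unscaled integral over \<open>B\<^sub>\<rho>(x) \<inter> \<Omega>\<close>. With the powers of the radius moved to the other side, the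
hypotheses of the theorem compare excesses at two radii with the factor \<open>(\<sigma> / \<rho>)\<^sup>e\<close>,
\<open>e = n + k q + q \<mu>\<close>.\<close>

definition excess ::
  "nat \<Rightarrow> real \<Rightarrow> (real^'n::finite) set \<Rightarrow> 'n mvfun \<Rightarrow> 'n mvfun \<Rightarrow> real^'n \<Rightarrow> real \<Rightarrow> ennreal" where
  "excess m q \<Omega> u P x \<rho> =
     (\<integral>\<^sup>+y\<in>ball x \<rho> \<inter> \<Omega>. ennreal (GQ {..<m} (u y) (P y) powr q) \<partial>lebesgue)"

lemma excess_mono:
  assumes "dist x y + \<sigma> \<le> \<rho>"
  shows "excess m q \<Omega> u P x \<sigma> \<le> excess m q \<Omega> u P y \<rho>"
proof -
  have "ball x \<sigma> \<subseteq> ball y \<rho>"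
  proof
    fix z assume "z \<in> ball x \<sigma>"
    then show "z \<in> ball y \<rho>" using assms dist_triangle[of y z x] by (simp add: dist_commute)
  qed
  then show ?thesis unfolding excess_def
    by (intro nn_integral_mono) (auto simp: indicator_def)
qed

lemma powr_add_le:
  assumes "0 \<le> a" "0 \<le> b" "1 \<le> (q::real)"
  shows "(a + b) powr q \<le> 2 powr q * (a powr q + b powr q)"
proof -
  have "(a + b) powr q \<le> (2 * max a b) powr q" using assms by (intro powr_mono2) auto
  also have "\<dots> = 2 powr q * max a b powr q" by (simp add: powr_mult)
  also have "max a b powr q \<le> a powr q + b powr q" by (simp add: max_def)
  finally show ?thesis by simp
qed

lemma borel_measurable_powr_indicator:
  fixes w :: "'a::euclidean_space \<Rightarrow> real"
  assumes w: "w \<in> borel_measurable (lebesgue_on B)" and B: "B \<in> sets lebesgue"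
  shows "(\<lambda>x. ennreal (w x powr q) * indicator B x) \<in> borel_measurable lebesgue"
proof -
  have 1: "(\<lambda>x. ennreal (w x powr q)) \<in> borel_measurable (lebesgue_on B)" using w by measurable
  have 2: "B \<inter> space lebesgue \<in> sets lebesgue" using B by simp
  show ?thesis by (rule iffD1[OF borel_measurable_restrict_space_iff_ennreal[OF 2] 1])
qed

lemma nn_integral_powr_triangle:
  fixes f g h :: "'a::euclidean_space \<Rightarrow> real"
  assumes "1 \<le> q" and B: "B \<in> sets lebesgue"
    and f: "f \<in> borel_measurable (lebesgue_on B)" and g: "g \<in> borel_measurable (lebesgue_on B)"
    and le: "\<And>x. x \<in> B \<Longrightarrow> 0 \<le> f x \<and> 0 \<le> g x \<and> 0 \<le> h x \<and> h x \<le> f x + g x"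
  shows "(\<integral>\<^sup>+x\<in>B. ennreal (h x powr q) \<partial>lebesgue) \<le>
    ennreal (2 powr q) * ((\<integral>\<^sup>+x\<in>B. ennreal (f x powr q) \<partial>lebesgue) + (\<integral>\<^sup>+x\<in>B. ennreal (g x powr q) \<partial>lebesgue))"
proof -
  have "(\<integral>\<^sup>+x\<in>B. ennreal (h x powr q) \<partial>lebesgue) \<le>
     (\<integral>\<^sup>+x. ennreal (2 powr q) * (ennreal (f x powr q) * indicator B x + ennreal (g x powr q) * indicator B x) \<partial>lebesgue)"
  proof (rule nn_integral_mono)
    fix x :: 'a
    have "h x powr q \<le> 2 powr q * (f x powr q + g x powr q)" if "x \<in> B"
    proof -
      have "h x powr q \<le> (f x + g x) powr q" using le[OF that] assms(1) by (intro powr_mono2) auto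
      also have "\<dots> \<le> 2 powr q * (f x powr q + g x powr q)"
        using le[OF that] assms(1) by (intro powr_add_le) auto
      finally show ?thesis .
    qed
    then show "ennreal (h x powr q) * indicator B x \<le>
      ennreal (2 powr q) * (ennreal (f x powr q) * indicator B x + ennreal (g x powr q) * indicator B x)"
      by (auto simp: indicator_def simp flip: ennreal_plus ennreal_mult intro!: ennreal_leI)
  qed
  also have "\<dots> = ennreal (2 powr q) * ((\<integral>\<^sup>+x\<in>B. ennreal (f x powr q) \<partial>lebesgue) + (\<integral>\<^sup>+x\<in>B. ennreal (g x powr q) \<partial>lebesgue))"
    using borel_measurable_powr_indicator[OF f B] borel_measurable_powr_indicator[OF g B] by (simp add: nn_integral_cmult nn_integral_add)
  finally show ?thesis .
qed

text \<open>The norm of a tuple is its distance to this polynomial tuple, so that bounds for \<open>u\<close> are special cases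
of bounds for excesses.\<close>

definition zero_tuple :: "nat \<Rightarrow> (real^'n::finite \<Rightarrow> nat \<Rightarrow> real) list" where
  "zero_tuple Q = replicate Q (\<lambda>x c. 0)"

lemma polytuple_zero: "polytuple k Q m (zero_tuple Q)"
  by (simp add: polytuple_def polymap_def zero_tuple_def vecs_def poly_deg_le_0)

lemma evalQ_zero_tuple: "evalQ (zero_tuple Q) x = replicate_mset Q (\<lambda>_. 0)"
  by (simp add: evalQ_def zero_tuple_def)

lemma absQ_eq_GQ_zero: "M \<in> AQ Q {..<m} \<Longrightarrow> absQ {..<m} M = GQ {..<m} M (evalQ (zero_tuple Q) x)"
  by (simp add: absQ_def evalQ_zero_tuple AQ_def)

lemma GQ_nonneg_AQ: "M \<in> AQ Q I \<Longrightarrow> N \<in> AQ Q I \<Longrightarrow> 0 \<le> GQ I M N"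
  by (intro GQ_nonneg) (simp add: AQ_def)

lemma GQ_triangle_AQ: "M \<in> AQ Q I \<Longrightarrow> N \<in> AQ Q I \<Longrightarrow> K \<in> AQ Q I \<Longrightarrow> GQ I M K \<le> GQ I M N + GQ I N K"
  by (intro GQ_triangle) (simp_all add: AQ_def)

lemma GQ_commute_AQ: "M \<in> AQ Q I \<Longrightarrow> N \<in> AQ Q I \<Longrightarrow> GQ I M N = GQ I N M"
  by (intro GQ_commute) (simp_all add: AQ_def)

locale measurable_multifun =
  fixes Q m :: nat and \<Omega> :: "(real^'n::finite) set" and u :: "'n mvfun"
  assumes \<Omega>: "open \<Omega>" and u: "\<And>x. x \<in> \<Omega> \<Longrightarrow> u x \<in> AQ Q {..<m}" and mu: "measurableQ Q {..<m} \<Omega> u"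
begin

lemma ball_Int_lmeasurable: "ball x r \<inter> \<Omega> \<in> lmeasurable"
  using \<Omega> by (intro bounded_set_imp_lmeasurable) (auto intro!: borel_open)

lemma measurable_dist:
  assumes "polytuple k Q m R" "B \<subseteq> \<Omega>" "B \<in> sets lebesgue"
  shows "(\<lambda>y. GQ {..<m} (u y) (evalQ R y)) \<in> borel_measurable (lebesgue_on B)"
proof (rule measurable_GQ)
  show "measurableQ Q {..<m} B u"
    using measurableQ_subset[OF mu assms(2) _ assms(3)] \<Omega> by (auto intro!: borel_open)
qed (use assms u evalQ_AQ measurableQ_evalQ in blast)+

lemma excess_polytuples_le:
  assumes q: "1 \<le> q" and R: "polytuple k Q m R" and T: "polytuple k Q m T"
  shows "(\<integral>\<^sup>+y\<in>ball x r \<inter> \<Omega>. ennreal (GQ {..<m} (evalQ R y) (evalQ T y) powr q) \<partial>lebesgue)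
    \<le> ennreal (2 powr q) * (excess m q \<Omega> u (evalQ R) x r + excess m q \<Omega> u (evalQ T) x r)"
  unfolding excess_def
proof (rule nn_integral_powr_triangle[OF q])
  fix y assume "y \<in> ball x r \<inter> \<Omega>"
  then have AQ: "u y \<in> AQ Q {..<m}" "evalQ R y \<in> AQ Q {..<m}" "evalQ T y \<in> AQ Q {..<m}"
    using u evalQ_AQ R T by auto
  show "0 \<le> GQ {..<m} (u y) (evalQ R y) \<and> 0 \<le> GQ {..<m} (u y) (evalQ T y) \<and>
    0 \<le> GQ {..<m} (evalQ R y) (evalQ T y) \<and>
    GQ {..<m} (evalQ R y) (evalQ T y) \<le> GQ {..<m} (u y) (evalQ R y) + GQ {..<m} (u y) (evalQ T y)"
    using GQ_triangle_AQ[OF AQ(2,1,3)] GQ_commute_AQ[OF AQ(1,2)] GQ_nonneg_AQ AQ by auto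
qed (use ball_Int_lmeasurable measurable_dist R T in blast)+

lemma excess_triangle:
  assumes q: "1 \<le> q" and R: "polytuple k Q m R" and T: "polytuple k Q m T"
  shows "excess m q \<Omega> u (evalQ R) x r \<le> ennreal (2 powr q) * (excess m q \<Omega> u (evalQ T) x r +
    (\<integral>\<^sup>+y\<in>ball x r \<inter> \<Omega>. ennreal (GQ {..<m} (evalQ R y) (evalQ T y) powr q) \<partial>lebesgue))"
  unfolding excess_def
proof (rule nn_integral_powr_triangle[OF q])
  fix y assume "y \<in> ball x r \<inter> \<Omega>"
  then have AQ: "u y \<in> AQ Q {..<m}" "evalQ R y \<in> AQ Q {..<m}" "evalQ T y \<in> AQ Q {..<m}"
    using u evalQ_AQ R T by auto
  show "0 \<le> GQ {..<m} (u y) (evalQ T y) \<and> 0 \<le> GQ {..<m} (evalQ R y) (evalQ T y) \<and>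
    0 \<le> GQ {..<m} (u y) (evalQ R y) \<and>
    GQ {..<m} (u y) (evalQ R y) \<le> GQ {..<m} (u y) (evalQ T y) + GQ {..<m} (evalQ R y) (evalQ T y)"
    using GQ_triangle_AQ[OF AQ(1,3,2)] GQ_commute_AQ[OF AQ(2,3)] GQ_nonneg_AQ AQ by auto
next
  show "(\<lambda>y. GQ {..<m} (evalQ R y) (evalQ T y)) \<in> borel_measurable (lebesgue_on (ball x r \<inter> \<Omega>))"
    using R T ball_Int_lmeasurable by (intro measurable_GQ_evalQ) auto
qed (use ball_Int_lmeasurable measurable_dist T in blast)+

end

text \<open>\<open>C\<close> is admissible for the estimate by \<open>t\<close> of two approximations whose excess at radius \<open>r\<close> is at most
\<open>t\<^sup>q r\<^sup>n\<close>. It depends on \<open>\<Omega>\<close> only through the density \<open>c\<close>.\<close>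

definition comparison_bound ::
  "'n::finite itself \<Rightarrow> nat \<Rightarrow> nat \<Rightarrow> nat \<Rightarrow> real \<Rightarrow> real \<Rightarrow> real \<Rightarrow> bool" where
  "comparison_bound _ k Q m q c C \<longleftrightarrow> (\<forall>(\<Omega> :: (real^'n) set) u R T x r t.
    measurable_multifun Q m \<Omega> u \<longrightarrow> polytuple k Q m R \<longrightarrow> polytuple k Q m T \<longrightarrow> 0 < r \<longrightarrow> 0 < t \<longrightarrow>
    c * r ^ CARD('n) \<le> measure lebesgue (ball x r \<inter> \<Omega>) \<longrightarrow>
    excess m q \<Omega> u (evalQ R) x r \<le> ennreal (t powr q * r ^ CARD('n)) \<longrightarrow>
    excess m q \<Omega> u (evalQ T) x r \<le> ennreal (t powr q * r ^ CARD('n)) \<longrightarrow>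
    (\<exists>T'. mset T' = mset T \<and> (\<forall>i<Q. \<forall>a<m.
       (\<forall>z s. r \<le> s \<longrightarrow> dist x z \<le> s \<longrightarrow> \<bar>(R ! i) z a - (T' ! i) z a\<bar> \<le> C * t * (s / r) ^ k) \<and>
       (\<forall>bs. length bs \<le> k \<longrightarrow> (\<forall>z\<in>ball x r.
         \<bar>pderivs bs (\<lambda>y. (R ! i) y a) z - pderivs bs (\<lambda>y. (T' ! i) y a) z\<bar> \<le> C * t / r ^ length bs)))))"

text \<open>Both tuples approximate \<open>u\<close>, hence each other by the triangle inequality in \<open>L\<^sup>q\<close>. The matching found
on the ball of radius \<open>r\<close> is then propagated by polynomial growth to larger balls and by Markov's
inequality to derivatives.\<close>

lemma comparison_of_approximations:
  assumes c: "0 < c" and q: "1 \<le> q"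
  shows "\<exists>C\<ge>1. comparison_bound TYPE('n::finite) k Q m q c C"
proof -
  obtain C where C: "C \<ge> 1" and match0: "\<forall>(R :: (real^'n::finite \<Rightarrow> nat \<Rightarrow> real) list) T x0 r t S.
    polytuple k Q m R \<longrightarrow> polytuple k Q m T \<longrightarrow> 0 < r \<longrightarrow> 0 < t \<longrightarrow> S \<in> lmeasurable \<longrightarrow> S \<subseteq> ball x0 r \<longrightarrow>
    c * r ^ CARD('n) \<le> measure lebesgue S \<longrightarrow>
    (\<integral>\<^sup>+x\<in>S. ennreal (GQ {..<m} (evalQ R x) (evalQ T x) powr q) \<partial>lebesgue) \<le> ennreal (t powr q * r ^ CARD('n)) \<longrightarrow>
    (\<exists>T'. mset T' = mset T \<and>
      (\<forall>i<Q. \<forall>a<m. \<forall>x\<in>ball x0 r. \<bar>(R ! i) x a - (T' ! i) x a\<bar> \<le> C * t))"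
    using matching_of_polytuples[OF c q, of k Q m, where ?'n = 'n] by (elim exE conjE)
  note match = match0[rule_format]
  obtain G where G: "G \<ge> 1" and growth0: "\<forall>(p :: real^'n::finite \<Rightarrow> real) t x0 r s z. poly_deg_le k p \<longrightarrow> 0 < r \<longrightarrow>
     (\<forall>x\<in>ball x0 r. \<bar>p x\<bar> \<le> t) \<longrightarrow> r \<le> s \<longrightarrow> dist x0 z \<le> s \<longrightarrow> \<bar>p z\<bar> \<le> G * t * (s / r) ^ k"
    using poly_growth[of k, where ?'n = 'n] by (elim exE conjE)
  note growth = growth0[rule_format]
  obtain D where D: "D \<ge> 1" and markov0: "\<forall>(p :: real^'n::finite \<Rightarrow> real) t x0 r bs. poly_deg_le k p \<longrightarrow> 0 < r \<longrightarrow>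
     (\<forall>x\<in>ball x0 r. \<bar>p x\<bar> \<le> t) \<longrightarrow> length bs \<le> k \<longrightarrow>
     (\<forall>x\<in>ball x0 r. \<bar>pderivs bs p x\<bar> \<le> D * t / r ^ length bs)"
    using markov_pderivs[of k, where ?'n = 'n] by (elim exE conjE)
  note markov = markov0[rule_format]
  define K where "K = (G + D) * (C * 4)"
  have K: "G * (C * 4) \<le> K" "D * (C * 4) \<le> K" "1 \<le> K"
  proof -
    have "1 * 1 \<le> (G + D) * (C * 4)" using C G D by (intro mult_mono) auto
    then show "1 \<le> K" by (simp add: K_def)
  qed (use C G D in \<open>auto simp: K_def\<close>)
  show ?thesis
  proof (rule exI[of _ K], rule conjI[OF K(3)], unfold comparison_bound_def, intro allI impI)
    fix \<Omega> :: "(real^'n) set" and u and R T :: "(real^'n \<Rightarrow> nat \<Rightarrow> real) list" and x and r t :: real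
    assume mm: "measurable_multifun Q m \<Omega> u" and R: "polytuple k Q m R" and T: "polytuple k Q m T"
      and r: "0 < r" and t: "0 < t" and big: "c * r ^ CARD('n) \<le> measure lebesgue (ball x r \<inter> \<Omega>)"
      and le: "excess m q \<Omega> u (evalQ R) x r \<le> ennreal (t powr q * r ^ CARD('n))"
        "excess m q \<Omega> u (evalQ T) x r \<le> ennreal (t powr q * r ^ CARD('n))"
    interpret measurable_multifun Q m \<Omega> u by (rule mm)
    have "(\<integral>\<^sup>+y\<in>ball x r \<inter> \<Omega>. ennreal (GQ {..<m} (evalQ R y) (evalQ T y) powr q) \<partial>lebesgue)
      \<le> ennreal (2 powr q) * (excess m q \<Omega> u (evalQ R) x r + excess m q \<Omega> u (evalQ T) x r)"
      by (rule excess_polytuples_le[OF q R T])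
    also have "\<dots> \<le> ennreal (2 powr q) * (ennreal (t powr q * r ^ CARD('n)) + ennreal (t powr q * r ^ CARD('n)))"
      by (intro mult_left_mono add_mono le) auto
    also have "\<dots> = ennreal (2 powr q * 2 * (t powr q * r ^ CARD('n)))"
      using r by (simp flip: ennreal_plus ennreal_mult)
    also have "\<dots> \<le> ennreal ((4 * t) powr q * r ^ CARD('n))"
    proof (rule ennreal_leI)
      have "(2::real) powr 1 \<le> 2 powr q" using q by (intro powr_mono) auto
      then have "2 powr q * 2 \<le> (2::real) powr q * 2 powr q" by (intro mult_left_mono) auto
      also have "\<dots> = 4 powr q" by (simp flip: powr_mult)
      finally have "2 powr q * 2 * (t powr q * r ^ CARD('n)) \<le> 4 powr q * (t powr q * r ^ CARD('n))"
        using r by (intro mult_right_mono) auto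
      then show "2 powr q * 2 * (t powr q * r ^ CARD('n)) \<le> (4 * t) powr q * r ^ CARD('n)"
        using t by (simp add: powr_mult mult_ac)
    qed
    finally have "(\<integral>\<^sup>+y\<in>ball x r \<inter> \<Omega>. ennreal (GQ {..<m} (evalQ R y) (evalQ T y) powr q) \<partial>lebesgue)
      \<le> ennreal ((4 * t) powr q * r ^ CARD('n))" .
    then have "\<exists>T'. mset T' = mset T \<and>
      (\<forall>i<Q. \<forall>a<m. \<forall>y\<in>ball x r. \<bar>(R ! i) y a - (T' ! i) y a\<bar> \<le> C * (4 * t))"
      using t by (intro match[OF R T r _ ball_Int_lmeasurable _ big]) auto
    then obtain T' where T': "mset T' = mset T"
      and close: "\<And>i a y. i < Q \<Longrightarrow> a < m \<Longrightarrow> y \<in> ball x r \<Longrightarrow> \<bar>(R ! i) y a - (T' ! i) y a\<bar> \<le> C * (4 * t)"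
      by blast
    have PT': "polytuple k Q m T'" by (rule polytuple_mset_eq[OF T'[symmetric] T])
    show "\<exists>T'. mset T' = mset T \<and> (\<forall>i<Q. \<forall>a<m.
       (\<forall>z s. r \<le> s \<longrightarrow> dist x z \<le> s \<longrightarrow> \<bar>(R ! i) z a - (T' ! i) z a\<bar> \<le> K * t * (s / r) ^ k) \<and>
       (\<forall>bs. length bs \<le> k \<longrightarrow> (\<forall>z\<in>ball x r.
         \<bar>pderivs bs (\<lambda>y. (R ! i) y a) z - pderivs bs (\<lambda>y. (T' ! i) y a) z\<bar> \<le> K * t / r ^ length bs)))"
    proof (rule exI[of _ T'], rule conjI[OF T'], intro allI impI conjI ballI)
      fix i a z s assume ia: "i < Q" "a < m" and s: "r \<le> s" "dist x z \<le> s"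
      have p: "poly_deg_le k (\<lambda>y. (R ! i) y a - (T' ! i) y a)"
        by (intro poly_deg_le_diff polytuple_component[OF R ia] polytuple_component[OF PT' ia])
      have "\<bar>(R ! i) z a - (T' ! i) z a\<bar> \<le> G * (C * (4 * t)) * (s / r) ^ k"
        by (rule growth[OF p r close[OF ia] s])
      also have "\<dots> = (G * (C * 4)) * (t * (s / r) ^ k)" by simp
      also have "\<dots> \<le> K * (t * (s / r) ^ k)" using K(1) t r s(1) by (intro mult_right_mono) auto
      finally show "\<bar>(R ! i) z a - (T' ! i) z a\<bar> \<le> K * t * (s / r) ^ k" by (simp add: mult_ac)
    next
      fix i a and bs :: "'n list" and z assume ia: "i < Q" "a < m" and len: "length bs \<le> k" and z: "z \<in> ball x r"
      have p: "poly_deg_le k (\<lambda>y. (R ! i) y a - (T' ! i) y a)"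
        by (intro poly_deg_le_diff polytuple_component[OF R ia] polytuple_component[OF PT' ia])
      have "\<bar>pderivs bs (\<lambda>y. (R ! i) y a - (T' ! i) y a) z\<bar> \<le> D * (C * (4 * t)) / r ^ length bs"
        by (rule markov[OF p r close[OF ia] len z])
      also have "\<dots> = (D * (C * 4)) * (t / r ^ length bs)" by simp
      also have "\<dots> \<le> K * (t / r ^ length bs)" using K(2) t r by (intro mult_right_mono) auto
      finally show "\<bar>pderivs bs (\<lambda>y. (R ! i) y a) z - pderivs bs (\<lambda>y. (T' ! i) y a) z\<bar> \<le> K * t / r ^ length bs"
        using pderivs_diff[OF polytuple_component[OF R ia] polytuple_component[OF PT' ia], of bs] by simp
    qed
  qed
qed

section \<open>Decay of the excess along the strata\<close>

text \<open>Meant for \<open>e = n + k q + q \<mu>\<close>: after division by the volume, the distance from \<open>u\<close> to \<open>P\<close> is of order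
\<open>\<sigma>\<^sup>k\<^sup>+\<^sup>\<mu>\<close> in the mean.\<close>

definition decays ::
  "nat \<Rightarrow> real \<Rightarrow> (real^'n::finite) set \<Rightarrow> 'n mvfun \<Rightarrow> 'n mvfun \<Rightarrow> real^'n \<Rightarrow> real \<Rightarrow> real \<Rightarrow> real \<Rightarrow> bool" where
  "decays m q \<Omega> u P x M S e \<longleftrightarrow>
     (\<forall>\<sigma>. 0 < \<sigma> \<longrightarrow> \<sigma> \<le> S \<longrightarrow> excess m q \<Omega> u P x \<sigma> \<le> ennreal (M * \<sigma> powr e))"

lemma decays_mono:
  assumes "decays m q \<Omega> u P x M S e" "M \<le> M'" "S' \<le> S"
  shows "decays m q \<Omega> u P x M' S' e"
  unfolding decays_def
proof (intro allI impI)
  fix \<sigma> :: real assume "0 < \<sigma>" "\<sigma> \<le> S'"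
  then have "excess m q \<Omega> u P x \<sigma> \<le> ennreal (M * \<sigma> powr e)" using assms by (auto simp: decays_def)
  also have "\<dots> \<le> ennreal (M' * \<sigma> powr e)" using assms by (intro ennreal_leI mult_right_mono) auto
  finally show "excess m q \<Omega> u P x \<sigma> \<le> ennreal (M' * \<sigma> powr e)" .
qed

lemma emeasure_ball_scaled:
  "0 \<le> r \<Longrightarrow> emeasure lebesgue (ball (x :: real^'n::finite) r) = ennreal (measure lebesgue (ball (0 :: real^'n) 1) * r ^ CARD('n))"
  using content_ball_conv_unit_ball[of r x] lmeasurable_ball[of x r]
  by (simp add: emeasure_eq_measure2 mult.commute)

text \<open>The decay passes from \<open>y\<close> to a point \<open>x\<close> at distance at most \<open>r\<close>. Up to radius \<open>r/2\<close> the assumed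
improvement at \<open>x\<close> gives it directly. At radius \<open>r/2\<close> both polynomial tuples approximate \<open>u\<close>, so they
differ there by a multiple of \<open>r\<^sup>k\<^sup>+\<^sup>\<mu>\<close>. A polynomial of degree \<open>k\<close> grows at most like \<open>(\<sigma>/r)\<^sup>k\<close>, hence
they differ by a multiple of \<open>r\<^sup>\<mu> \<sigma>\<^sup>k \<le> \<sigma>\<^sup>k\<^sup>+\<^sup>\<mu>\<close> on the ball of radius \<open>\<sigma> \<ge> r/2\<close>, where the decay at \<open>y\<close>
takes over. The constant is uniform in \<open>\<mu>\<close> because \<open>e\<close> enters only through powers bounded by their
values at \<open>E = n + k q + q\<close>.\<close>

lemma near_point_decay:
  assumes c: "0 < c" and q: "1 \<le> q" and b: "0 < b"
  shows "\<exists>C\<ge>1. \<forall>(\<Omega> :: (real^'n::finite) set) u R T x y r S M \<mu> e.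
    measurable_multifun Q m \<Omega> u \<longrightarrow> polytuple k Q m R \<longrightarrow> polytuple k Q m T \<longrightarrow> 0 < \<mu> \<longrightarrow> \<mu> < 1 \<longrightarrow>
    e = real CARD('n) + real k * q + q * \<mu> \<longrightarrow> 0 < r \<longrightarrow> 0 < M \<longrightarrow> dist x y \<le> r \<longrightarrow> 2 * r \<le> S \<longrightarrow>
    c * (r / 2) ^ CARD('n) \<le> measure lebesgue (ball x (r / 2) \<inter> \<Omega>) \<longrightarrow>
    (\<forall>\<sigma>. 0 < \<sigma> \<longrightarrow> \<sigma> \<le> r / 2 \<longrightarrow>
       excess m q \<Omega> u (evalQ R) x \<sigma> \<le> ennreal (b * (\<sigma> / r) powr e) * excess m q \<Omega> u (evalQ T) x r) \<longrightarrow>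
    decays m q \<Omega> u (evalQ T) y M S e \<longrightarrow>
    decays m q \<Omega> u (evalQ R) x (C * M) (S / 3) e"
proof -
  obtain K where K: "K \<ge> 1" and comp: "comparison_bound TYPE('n) k Q m q c K"
    using comparison_of_approximations[OF c q] by blast
  note comp0 = comp[unfolded comparison_bound_def]
  define E where "E = real CARD('n) + real k * q + q"
  define V where "V = measure lebesgue (ball (0 :: real^'n) 1)"
  \<comment> \<open>The power of 4 arises because the excess at radius r / 2 about x is taken from radius 2 r about y.\<close>
  define B where "B = (b + 1) * 4 powr E"
  define L where "L = (real (Q * m) * K) powr q * B * V"
  have V: "0 \<le> V" by (simp add: V_def)
  have B: "0 < B" using b by (simp add: B_def)
  have L: "0 \<le> L" using B V by (simp add: L_def)
  define C where "C = b * 2 powr E + 2 powr q * (3 powr E + L) + 1"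
  have C: "C \<ge> 1" "b * 2 powr E \<le> C" "2 powr q * (3 powr E + L) \<le> C"
    using b L by (auto simp: C_def intro!: add_nonneg_nonneg)
  show ?thesis
  proof (rule exI[of _ C], rule conjI[OF C(1)], intro allI impI)
    fix \<Omega> :: "(real^'n) set" and u and R T :: "(real^'n \<Rightarrow> nat \<Rightarrow> real) list" and x y and r S M \<mu> e :: real
    assume mm: "measurable_multifun Q m \<Omega> u" and R: "polytuple k Q m R" and T: "polytuple k Q m T"
      and \<mu>: "0 < \<mu>" "\<mu> < 1" and e: "e = real CARD('n) + real k * q + q * \<mu>"
      and r: "0 < r" and M: "0 < M" and xy: "dist x y \<le> r" and S: "2 * r \<le> S"
      and dens: "c * (r / 2) ^ CARD('n) \<le> measure lebesgue (ball x (r / 2) \<inter> \<Omega>)"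
      and small: "\<forall>\<sigma>. 0 < \<sigma> \<longrightarrow> \<sigma> \<le> r / 2 \<longrightarrow>
       excess m q \<Omega> u (evalQ R) x \<sigma> \<le> ennreal (b * (\<sigma> / r) powr e) * excess m q \<Omega> u (evalQ T) x r"
      and dec: "decays m q \<Omega> u (evalQ T) y M S e"
    interpret measurable_multifun Q m \<Omega> u by (rule mm)
    have eE: "e \<le> E" "0 \<le> e" using \<mu> q by (auto simp: e E_def)
    have pE: "a powr e \<le> a powr E" if "1 \<le> a" for a :: real using that eE by (intro powr_mono)
    have Tdec: "excess m q \<Omega> u (evalQ T) x \<sigma> \<le> ennreal (M * \<rho> powr e)"
      if "dist x y + \<sigma> \<le> \<rho>" "0 < \<rho>" "\<rho> \<le> S" for \<sigma> \<rho>
      using excess_mono[OF that(1), of m q \<Omega> u "evalQ T"] dec that by (force simp: decays_def)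
    have near: "excess m q \<Omega> u (evalQ R) x \<sigma> \<le> ennreal (b * 2 powr e * M * \<sigma> powr e)"
      if \<sigma>: "0 < \<sigma>" "\<sigma> \<le> r / 2" for \<sigma>
    proof -
      have "excess m q \<Omega> u (evalQ R) x \<sigma> \<le> ennreal (b * (\<sigma> / r) powr e) * ennreal (M * (2 * r) powr e)"
        using small \<sigma> xy S r
        by (intro order_trans[OF small[rule_format, OF \<sigma>]] mult_left_mono Tdec) auto
      also have "\<dots> = ennreal (b * (\<sigma> / r) powr e * (M * (2 * r) powr e))"
        using b M by (simp add: ennreal_mult)
      also have "b * (\<sigma> / r) powr e * (M * (2 * r) powr e) = b * 2 powr e * M * \<sigma> powr e"
        using \<sigma> r by (simp add: powr_mult powr_divide)
      finally show ?thesis .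
    qed
    define r' where "r' = r / 2"
    have r': "0 < r'" using r by (simp add: r'_def)
    define M' where "M' = B * M"
    have M': "0 < M'" using B M by (simp add: M'_def)
    \<comment> \<open>Chosen so that both excesses at radius r / 2 are at most t^q times the n-th power of r / 2.\<close>
    define t where "t = M' powr (1 / q) * r' powr (real k + \<mu>)"
    have t: "0 < t" using M' r' by (simp add: t_def)
    have powq: "(M' powr (1 / q) * s powr (real k + \<mu>)) powr q * s ^ CARD('n) = M' * s powr e" if "0 < s" for s
    proof -
      have "(M' powr (1 / q) * s powr (real k + \<mu>)) powr q * s ^ CARD('n)
        = M' * (s powr ((real k + \<mu>) * q) * s powr real CARD('n))"
        using that M' q by (simp add: powr_mult powr_powr powr_realpow)
      also have "\<dots> = M' * s powr e"
        unfolding powr_add[symmetric] e by (simp add: algebra_simps)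
      finally show ?thesis .
    qed
    have "excess m q \<Omega> u (evalQ R) x r' \<le> ennreal (b * 2 powr e * M * r' powr e)"
      using near[of r'] r' by (simp add: r'_def)
    also have "\<dots> \<le> ennreal (M' * r' powr e)"
    proof (intro ennreal_leI mult_right_mono)
      have "(2::real) powr e \<le> 4 powr E"
        by (rule order_trans[OF _ pE]) (use eE in \<open>auto intro: powr_mono2\<close>)
      then have "b * 2 powr e \<le> B" unfolding B_def using b by (intro mult_mono) auto
      then show "b * 2 powr e * M \<le> M'" unfolding M'_def using M by (intro mult_right_mono) auto
    qed simp
    finally have exR: "excess m q \<Omega> u (evalQ R) x r' \<le> ennreal (t powr q * r' ^ CARD('n))"
      using powq[OF r'] by (simp add: t_def)
    have "excess m q \<Omega> u (evalQ T) x r' \<le> ennreal (M * (2 * r) powr e)"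
      using xy r S by (intro Tdec) (auto simp: r'_def)
    also have "\<dots> \<le> ennreal (M' * r' powr e)"
    proof (rule ennreal_leI)
      have "M * (2 * r) powr e = 4 powr e * (M * r' powr e)"
      proof -
        have "2 * r = 4 * r'" by (simp add: r'_def)
        then show ?thesis by (simp only: powr_mult mult_ac)
      qed
      also have "\<dots> \<le> B * (M * r' powr e)"
      proof (rule mult_right_mono)
        have "4 powr e \<le> 1 * 4 powr E" using pE[of 4] by simp
        also have "\<dots> \<le> B" unfolding B_def using b by (intro mult_right_mono) auto
        finally show "4 powr e \<le> B" .
      qed (use M in simp)
      finally show "M * (2 * r) powr e \<le> M' * r' powr e" by (simp add: M'_def)
    qed
    finally have exT: "excess m q \<Omega> u (evalQ T) x r' \<le> ennreal (t powr q * r' ^ CARD('n))"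
      using powq[OF r'] by (simp add: t_def)
    have "\<exists>T'. mset T' = mset T \<and> (\<forall>i<Q. \<forall>a<m.
       (\<forall>z s. r' \<le> s \<longrightarrow> dist x z \<le> s \<longrightarrow> \<bar>(R ! i) z a - (T' ! i) z a\<bar> \<le> K * t * (s / r') ^ k) \<and>
       (\<forall>bs. length bs \<le> k \<longrightarrow> (\<forall>z\<in>ball x r'.
         \<bar>pderivs bs (\<lambda>y. (R ! i) y a) z - pderivs bs (\<lambda>y. (T' ! i) y a) z\<bar> \<le> K * t / r' ^ length bs)))"
      using dens by (intro comp0[rule_format, OF mm R T r' t _ exR exT]) (simp add: r'_def)
    then obtain T' where T': "mset T' = mset T" and growth: "\<And>i a z s. i < Q \<Longrightarrow> a < m \<Longrightarrow> r' \<le> s \<Longrightarrow>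
       dist x z \<le> s \<Longrightarrow> \<bar>(R ! i) z a - (T' ! i) z a\<bar> \<le> K * t * (s / r') ^ k"
      by blast
    have lenT': "length T' = Q" "length R = Q"
      using polytuple_mset_eq[OF T'[symmetric] T] R by (auto simp: polytuple_def)
    show "decays m q \<Omega> u (evalQ R) x (C * M) (S / 3) e"
      unfolding decays_def
    proof (intro allI impI)
      fix \<sigma> assume \<sigma>: "0 < \<sigma>" "\<sigma> \<le> S / 3"
      show "excess m q \<Omega> u (evalQ R) x \<sigma> \<le> ennreal (C * M * \<sigma> powr e)"
      proof (cases "\<sigma> \<le> r'")
        case True
        then have "excess m q \<Omega> u (evalQ R) x \<sigma> \<le> ennreal (b * 2 powr e * M * \<sigma> powr e)"
          using near \<sigma> by (simp add: r'_def)
        also have "\<dots> \<le> ennreal (C * M * \<sigma> powr e)"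
        proof (intro ennreal_leI mult_right_mono)
          have "b * 2 powr e \<le> b * 2 powr E" using b pE[of 2] by simp
          then show "b * 2 powr e \<le> C" using C(2) by simp
        qed (use M in auto)
        finally show ?thesis .
      next
        case False
        \<comment> \<open>W bounds the distance of the two polynomial tuples on the whole ball of radius \<sigma>.\<close>
        define W where "W = real (Q * m) * K * (M' powr (1 / q) * \<sigma> powr (real k + \<mu>))"
        have W: "0 \<le> W" using K by (simp add: W_def)
        have pt: "GQ {..<m} (evalQ R z) (evalQ T z) \<le> W" if "z \<in> ball x \<sigma>" for z
        proof -
          have "GQ {..<m} (evalQ R z) (evalQ T' z) \<le> real (Q * m) * (K * t * (\<sigma> / r') ^ k)"
            using False that lenT' by (intro GQ_evalQ_le growth) auto
          also have "\<dots> \<le> W"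
          proof -
            have "t * (\<sigma> / r') ^ k = M' powr (1 / q) * r' powr \<mu> * \<sigma> powr real k"
              using r' \<sigma> by (simp add: t_def powr_add powr_realpow power_divide)
            also have "\<dots> \<le> M' powr (1 / q) * \<sigma> powr \<mu> * \<sigma> powr real k"
              using r' False \<mu> by (intro mult_right_mono mult_left_mono powr_mono2) auto
            also have "\<dots> = M' powr (1 / q) * \<sigma> powr (real k + \<mu>)" by (simp add: powr_add)
            finally have "real (Q * m) * K * (t * (\<sigma> / r') ^ k) \<le> W"
              unfolding W_def using K by (intro mult_left_mono) auto
            then show ?thesis by (simp add: mult_ac)
          qed
          finally show ?thesis using evalQ_mset_eq[OF T'] by simp
        qed
        have "(\<integral>\<^sup>+z\<in>ball x \<sigma> \<inter> \<Omega>. ennreal (GQ {..<m} (evalQ R z) (evalQ T z) powr q) \<partial>lebesgue)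
            \<le> (\<integral>\<^sup>+z. ennreal (W powr q) * indicator (ball x \<sigma>) z \<partial>lebesgue)"
        proof (rule nn_integral_mono)
          fix z
          show "ennreal (GQ {..<m} (evalQ R z) (evalQ T z) powr q) * indicator (ball x \<sigma> \<inter> \<Omega>) z
            \<le> ennreal (W powr q) * indicator (ball x \<sigma>) z"
            using pt[of z] q GQ_nonneg_AQ[OF evalQ_AQ[OF R] evalQ_AQ[OF T], of z z]
            by (auto simp: indicator_def intro!: ennreal_leI powr_mono2)
        qed
        also have "\<dots> = ennreal (W powr q) * ennreal (V * \<sigma> ^ CARD('n))"
          using emeasure_ball_scaled[of \<sigma> x] \<sigma> by (simp add: nn_integral_cmult_indicator V_def)
        also have "\<dots> = ennreal (W powr q * (V * \<sigma> ^ CARD('n)))"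
          by (simp add: ennreal_mult')
        also have "W powr q * (V * \<sigma> ^ CARD('n)) = (real (Q * m) * K) powr q * V * (M' * \<sigma> powr e)"
        proof -
          have "W powr q = (real (Q * m) * K) powr q * (M' powr (1 / q) * \<sigma> powr (real k + \<mu>)) powr q"
            unfolding W_def using K by (subst powr_mult) auto
          then show ?thesis by (simp flip: powq[OF \<sigma>(1)])
        qed
        also have "\<dots> = L * M * \<sigma> powr e" by (simp add: L_def M'_def)
        finally have RT: "(\<integral>\<^sup>+z\<in>ball x \<sigma> \<inter> \<Omega>. ennreal (GQ {..<m} (evalQ R z) (evalQ T z) powr q) \<partial>lebesgue)
            \<le> ennreal (L * M * \<sigma> powr e)" .
        have "excess m q \<Omega> u (evalQ T) x \<sigma> \<le> ennreal (M * (3 * \<sigma>) powr e)"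
          using xy \<sigma> False by (intro Tdec) (auto simp: r'_def)
        also have "\<dots> \<le> ennreal (3 powr E * M * \<sigma> powr e)"
        proof (rule ennreal_leI)
          have "M * (3 * \<sigma>) powr e = 3 powr e * (M * \<sigma> powr e)" using \<sigma> by (simp add: powr_mult)
          also have "\<dots> \<le> 3 powr E * (M * \<sigma> powr e)" using pE[of 3] M by (intro mult_right_mono) auto
          finally show "M * (3 * \<sigma>) powr e \<le> 3 powr E * M * \<sigma> powr e" by simp
        qed
        finally have Tx: "excess m q \<Omega> u (evalQ T) x \<sigma> \<le> ennreal (3 powr E * M * \<sigma> powr e)" .
        have "excess m q \<Omega> u (evalQ R) x \<sigma> \<le> ennreal (2 powr q) * (ennreal (3 powr E * M * \<sigma> powr e) + ennreal (L * M * \<sigma> powr e))"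
          by (intro order_trans[OF excess_triangle[OF q R T]] mult_left_mono add_mono Tx RT) auto
        also have "\<dots> = ennreal (2 powr q * (3 powr E * M * \<sigma> powr e + L * M * \<sigma> powr e))"
          using M L by (subst ennreal_plus[symmetric]) (auto simp: ennreal_mult'[symmetric] simp del: ennreal_plus)
        also have "\<dots> \<le> ennreal (C * M * \<sigma> powr e)"
        proof (rule ennreal_leI)
          have "2 powr q * (3 powr E * M * \<sigma> powr e + L * M * \<sigma> powr e) = 2 powr q * (3 powr E + L) * (M * \<sigma> powr e)"
            by (simp add: algebra_simps)
          also have "\<dots> \<le> C * (M * \<sigma> powr e)" using C(3) M by (intro mult_right_mono) auto
          finally show "2 powr q * (3 powr E * M * \<sigma> powr e + L * M * \<sigma> powr e) \<le> C * M * \<sigma> powr e" by simp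
        qed
        finally show ?thesis .
      qed
    qed
  qed
qed

lemma scaled_int_decay:
  fixes x x' :: "real^'n::finite"
  assumes "0 < \<sigma>" "0 < \<rho>" "0 < b"
    and le: "scaled_int \<Omega> k q x \<sigma> g \<le> ennreal (b * (\<sigma> / \<rho>) powr (q * \<mu>)) * scaled_int \<Omega> k q x' \<rho> h"
  shows "(\<integral>\<^sup>+y\<in>ball x \<sigma> \<inter> \<Omega>. ennreal (g y) \<partial>lebesgue) \<le>
    ennreal (b * (\<sigma> / \<rho>) powr (real CARD('n) + real k * q + q * \<mu>)) *
    (\<integral>\<^sup>+y\<in>ball x' \<rho> \<inter> \<Omega>. ennreal (h y) \<partial>lebesgue)"
proof -
  define N where "N = real CARD('n) + real k * q"
  define G where "G = (\<integral>\<^sup>+y\<in>ball x \<sigma> \<inter> \<Omega>. ennreal (g y) \<partial>lebesgue)"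
  define H where "H = (\<integral>\<^sup>+y\<in>ball x' \<rho> \<inter> \<Omega>. ennreal (h y) \<partial>lebesgue)"
  have N: "- real CARD('n) - real k * q = - N" by (simp add: N_def)
  have one: "\<sigma> powr N * \<sigma> powr - N = 1" using assms by (simp flip: powr_add)
  have "G = ennreal (\<sigma> powr N) * (ennreal (\<sigma> powr - N) * G)"
    by (simp add: mult.assoc[symmetric] one flip: ennreal_mult)
  also have "\<dots> \<le> ennreal (\<sigma> powr N) * (ennreal (b * (\<sigma> / \<rho>) powr (q * \<mu>)) * (ennreal (\<rho> powr - N) * H))"
    using le unfolding scaled_int_def N G_def H_def by (intro mult_left_mono) auto
  also have "\<dots> = ennreal (\<sigma> powr N * (b * (\<sigma> / \<rho>) powr (q * \<mu>)) * \<rho> powr - N) * H"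
    using assms by (simp add: mult.assoc ennreal_mult)
  also have "\<sigma> powr N * (b * (\<sigma> / \<rho>) powr (q * \<mu>)) * \<rho> powr - N = b * ((\<sigma> / \<rho>) powr N * (\<sigma> / \<rho>) powr (q * \<mu>))"
    using assms by (simp add: powr_divide powr_minus divide_simps)
  also have "\<dots> = b * (\<sigma> / \<rho>) powr (real CARD('n) + real k * q + q * \<mu>)"
    by (simp add: N_def flip: powr_add)
  finally show ?thesis by (simp add: G_def H_def)
qed

text \<open>This starts the decay at a fixed radius: there the excess of a polynomial bounded by \<open>\<beta>\<close> costs only
\<open>\<beta>\<^sup>q\<close> and the integral of \<open>\<bar>u\<bar>\<^sup>q\<close>.\<close>

lemma excess_bounded_approximation:
  fixes x :: "real^'n::finite"
  assumes mm: "measurable_multifun Q m \<Omega> u" and q: "1 \<le> q" and T: "polytuple k Q m T"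
    and \<beta>: "0 < \<beta>" "\<And>y. y \<in> \<Omega> \<Longrightarrow> absQ {..<m} (evalQ T y) \<le> \<beta>" and \<rho>: "0 < \<rho>" "\<rho> \<le> 1" and J: "0 \<le> J"
    and int: "(\<integral>\<^sup>+y\<in>ball x \<rho> \<inter> \<Omega>. ennreal (absQ {..<m} (u y) powr q) \<partial>lebesgue) \<le> ennreal J"
  shows "excess m q \<Omega> u (evalQ T) x \<rho> \<le>
    ennreal (2 powr q * (1 + measure lebesgue (ball (0 :: real^'n) 1)) * (\<beta> powr q + J))"
proof -
  interpret measurable_multifun Q m \<Omega> u by (rule mm)
  define V where "V = measure lebesgue (ball (0 :: real^'n) 1)"
  have V: "0 \<le> V" by (simp add: V_def)
  let ?Z = "zero_tuple Q :: (real^'n \<Rightarrow> nat \<Rightarrow> real) list"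
  have "excess m q \<Omega> u (evalQ T) x \<rho> \<le> ennreal (2 powr q) * (excess m q \<Omega> u (evalQ ?Z) x \<rho> +
    (\<integral>\<^sup>+y\<in>ball x \<rho> \<inter> \<Omega>. ennreal (GQ {..<m} (evalQ T y) (evalQ ?Z y) powr q) \<partial>lebesgue))"
    by (rule excess_triangle[OF q T polytuple_zero])
  also have "\<dots> \<le> ennreal (2 powr q) * (ennreal J + ennreal (\<beta> powr q * V))"
  proof (intro mult_left_mono add_mono)
    have "excess m q \<Omega> u (evalQ ?Z) x \<rho> \<le> (\<integral>\<^sup>+y\<in>ball x \<rho> \<inter> \<Omega>. ennreal (absQ {..<m} (u y) powr q) \<partial>lebesgue)"
      unfolding excess_def
    proof (rule nn_integral_mono)
      fix y :: "real^'n"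
      show "ennreal (GQ {..<m} (u y) (evalQ ?Z y) powr q) * indicator (ball x \<rho> \<inter> \<Omega>) y
        \<le> ennreal (absQ {..<m} (u y) powr q) * indicator (ball x \<rho> \<inter> \<Omega>) y"
        using absQ_eq_GQ_zero[OF u, of y y] by (auto simp: indicator_def)
    qed
    then show "excess m q \<Omega> u (evalQ ?Z) x \<rho> \<le> ennreal J" using int by simp
    have "(\<integral>\<^sup>+y\<in>ball x \<rho> \<inter> \<Omega>. ennreal (GQ {..<m} (evalQ T y) (evalQ ?Z y) powr q) \<partial>lebesgue)
      \<le> (\<integral>\<^sup>+y. ennreal (\<beta> powr q) * indicator (ball x \<rho>) y \<partial>lebesgue)"
    proof (rule nn_integral_mono)
      fix y :: "real^'n"
      have "GQ {..<m} (evalQ T y) (evalQ ?Z y) powr q \<le> \<beta> powr q" if "y \<in> \<Omega>"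
        using \<beta>(2)[OF that] q absQ_eq_GQ_zero[OF evalQ_AQ[OF T], of y y]
          GQ_nonneg_AQ[OF evalQ_AQ[OF T] evalQ_AQ[OF polytuple_zero], of y y]
        by (intro powr_mono2) auto
      then show "ennreal (GQ {..<m} (evalQ T y) (evalQ ?Z y) powr q) * indicator (ball x \<rho> \<inter> \<Omega>) y
        \<le> ennreal (\<beta> powr q) * indicator (ball x \<rho>) y"
        by (auto simp: indicator_def intro!: ennreal_leI)
    qed
    also have "\<dots> = ennreal (\<beta> powr q) * ennreal (V * \<rho> ^ CARD('n))"
      using emeasure_ball_scaled[of \<rho> x] \<rho> by (simp add: nn_integral_cmult_indicator V_def)
    also have "\<dots> = ennreal (\<beta> powr q * (V * \<rho> ^ CARD('n)))"
      by (simp add: ennreal_mult')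
    also have "\<dots> \<le> ennreal (\<beta> powr q * (V * 1))"
      using V \<rho> by (intro ennreal_leI mult_left_mono power_le_one) auto
    finally show "(\<integral>\<^sup>+y\<in>ball x \<rho> \<inter> \<Omega>. ennreal (GQ {..<m} (evalQ T y) (evalQ ?Z y) powr q) \<partial>lebesgue)
      \<le> ennreal (\<beta> powr q * V)" by simp
  qed auto
  also have "\<dots> = ennreal (2 powr q * (J + \<beta> powr q * V))"
    using J V by (subst ennreal_plus[symmetric]) (auto simp: ennreal_mult'[symmetric] simp del: ennreal_plus)
  also have "\<dots> \<le> ennreal (2 powr q * (1 + V) * (\<beta> powr q + J))"
  proof (rule ennreal_leI)
    have "J + \<beta> powr q * V \<le> (1 + V) * (\<beta> powr q + J)"
      using V J by (simp add: algebra_simps)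
    then show "2 powr q * (J + \<beta> powr q * V) \<le> 2 powr q * (1 + V) * (\<beta> powr q + J)" by simp
  qed
  finally show ?thesis by (simp add: V_def)
qed

text \<open>The homothety with centre \<open>x\<close> and ratio \<open>t = \<rho> / (2 D)\<close> maps \<open>\<Omega>' \<inter> B\<^sub>D(w)\<close>, which has measure at least
\<open>A D\<^sup>n\<close> and lies within distance \<open>2 D\<close> of \<open>x\<close>, into \<open>B\<^sub>\<rho>(x)\<close>. By convexity its image lies in \<open>\<Omega>\<close>, even for
\<open>x\<close> on the boundary of \<open>\<Omega>\<close>, once the null set where \<open>\<Omega>'\<close> meets that boundary is discarded.\<close>

lemma convex_density_near_weighted_subset:
  fixes \<Omega> \<Omega>' :: "(real^'n::finite) set"
  assumes \<Omega>: "open \<Omega>" "convex \<Omega>" and sub: "\<Omega>' \<subseteq> closure \<Omega>" and W: "weighted A \<Omega>'" "\<Omega>' \<in> sets lebesgue"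
    and x: "x \<in> closure \<Omega>" and w: "w \<in> \<Omega>'" "dist x w < D" and D: "D \<le> diameter \<Omega>'"
    and \<rho>: "0 < \<rho>" "\<rho> \<le> 2 * D"
  shows "A * (\<rho> / 2) ^ CARD('n) \<le> measure lebesgue (ball x \<rho> \<inter> \<Omega>)"
proof -
  have D0: "0 < D" using w(2) zero_le_dist[of x w] by linarith
  define t where "t = \<rho> / (2 * D)"
  have t: "0 < t" "t \<le> 1" using \<rho> D0 by (auto simp: t_def)
  define S where "S = \<Omega>' \<inter> ball w D \<inter> \<Omega>"
  have O: "\<Omega> \<in> sets lebesgue" using \<Omega> by (auto intro!: borel_open)
  have S: "S \<in> lmeasurable"
    unfolding S_def using W(2) O by (intro bounded_set_imp_lmeasurable sets.Int) (auto intro: bounded_subset[OF bounded_ball])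
  have full: "measure lebesgue (\<Omega>' \<inter> ball w D) = measure lebesgue S"
  proof (rule measure_negligible_symdiff)
    show "S \<in> lmeasurable" by (rule S)
    have "negligible (frontier \<Omega>)" using \<Omega> by (intro negligible_convex_frontier)
    moreover have "(S - \<Omega>' \<inter> ball w D) \<union> (\<Omega>' \<inter> ball w D - S) \<subseteq> frontier \<Omega>"
      using sub \<Omega> by (auto simp: S_def frontier_def interior_open)
    ultimately show "negligible ((S - \<Omega>' \<inter> ball w D) \<union> (\<Omega>' \<inter> ball w D - S))" by (rule negligible_subset)
  qed
  have "A * D ^ CARD('n) \<le> measure lebesgue S"
    using W(1) w closure_subset[of \<Omega>'] D D0 unfolding weighted_def full[symmetric] by blast
  then have "t ^ CARD('n) * (A * D ^ CARD('n)) \<le> t ^ CARD('n) * measure lebesgue S"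
    using t by (intro mult_left_mono) auto
  also have "\<dots> = measure lebesgue ((\<lambda>v. (1 - t) *\<^sub>R x + t *\<^sub>R v) ` S)"
    using affine_image_lmeasurable(2)[OF S, of t] t by simp
  also have "\<dots> \<le> measure lebesgue (ball x \<rho> \<inter> \<Omega>)"
  proof (rule measure_mono_fmeasurable)
    show "(\<lambda>v. (1 - t) *\<^sub>R x + t *\<^sub>R v) ` S \<in> sets lebesgue"
      using affine_image_lmeasurable(1)[OF S, of t] t by auto
    show "ball x \<rho> \<inter> \<Omega> \<in> lmeasurable"
      using O by (intro bounded_set_imp_lmeasurable) auto
    show "(\<lambda>v. (1 - t) *\<^sub>R x + t *\<^sub>R v) ` S \<subseteq> ball x \<rho> \<inter> \<Omega>"
    proof
      fix z assume "z \<in> (\<lambda>v. (1 - t) *\<^sub>R x + t *\<^sub>R v) ` S"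
      then obtain v where v: "v \<in> S" and z: "z = (1 - t) *\<^sub>R x + t *\<^sub>R v" by blast
      have z': "z = x - t *\<^sub>R (x - v)" by (simp add: z algebra_simps)
      have "dist x v < 2 * D"
        using dist_triangle[of x v w] w(2) v by (simp add: S_def)
      then have "t * dist x v < t * (2 * D)" using t by simp
      also have "t * (2 * D) = \<rho>" using D0 by (simp add: t_def)
      finally have "z \<in> ball x \<rho>" using t by (simp add: z' dist_norm)
      moreover have "x - t *\<^sub>R (x - v) \<in> interior \<Omega>"
        using v \<Omega> x t by (intro mem_interior_closure_convex_shrink) (auto simp: S_def interior_open)
      ultimately show "z \<in> ball x \<rho> \<inter> \<Omega>" using \<Omega> by (simp add: z' interior_open)
    qed
  qed
  finally show ?thesis using D0 by (simp add: t_def power_divide power_mult_distrib mult.commute)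
qed


text \<open>\<open>Z\<close> stands for the union of the lower strata, \<open>L\<close> for the polynomials already known to occur on it,
\<open>M\<close> for the decay constant on \<open>Z\<close>, and \<open>F\<close> for the excess allowed at the fixed radius \<open>R\<^sub>1\<close>.\<close>

definition stratum_bound ::
  "'n::finite itself \<Rightarrow> nat \<Rightarrow> nat \<Rightarrow> nat \<Rightarrow> real \<Rightarrow> real \<Rightarrow> real \<Rightarrow> real \<Rightarrow> real \<Rightarrow> bool" where
  "stratum_bound _ k Q m q c b R1 C \<longleftrightarrow> (\<forall>(\<Omega> :: (real^'n) set) u L R Z x S M F \<mu> e.
    measurable_multifun Q m \<Omega> u \<longrightarrow> polytuple k Q m R \<longrightarrow> (\<forall>T\<in>L. polytuple k Q m T) \<longrightarrow> 0 < \<mu> \<longrightarrow> \<mu> < 1 \<longrightarrow>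
    e = real CARD('n) + real k * q + q * \<mu> \<longrightarrow> 0 < M \<longrightarrow> 0 < F \<longrightarrow> 2 * R1 \<le> S \<longrightarrow>
    closed Z \<longrightarrow> Z \<noteq> {} \<longrightarrow> x \<notin> Z \<longrightarrow>
    (\<forall>\<rho>. 0 < \<rho> \<longrightarrow> \<rho> \<le> R1 \<longrightarrow> c * \<rho> ^ CARD('n) \<le> measure lebesgue (ball x \<rho> \<inter> \<Omega>)) \<longrightarrow>
    (\<forall>T\<in>L. \<forall>\<sigma> \<rho>. 0 < \<sigma> \<longrightarrow> \<sigma> \<le> \<rho> / 2 \<longrightarrow> \<rho> \<le> R1 \<longrightarrow> \<rho> \<le> infdist x Z \<longrightarrow>
       excess m q \<Omega> u (evalQ R) x \<sigma> \<le> ennreal (b * (\<sigma> / \<rho>) powr e) * excess m q \<Omega> u (evalQ T) x \<rho>) \<longrightarrow>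
    (\<forall>y\<in>Z. dist x y < R1 \<longrightarrow> (\<exists>T\<in>L. decays m q \<Omega> u (evalQ T) y M S e)) \<longrightarrow>
    (\<exists>T\<in>L. excess m q \<Omega> u (evalQ T) x R1 \<le> ennreal F) \<longrightarrow>
    decays m q \<Omega> u (evalQ R) x (C * (M + F)) (R1 / 2) e)"

text \<open>One step along the strata. Let \<open>r\<close> be the distance from \<open>x\<close> to \<open>Z\<close>. If \<open>r < R\<^sub>1\<close>, the polynomial of a
nearest point of \<open>Z\<close> is used at radius \<open>r\<close>. Otherwise the improvement holds at the fixed radius \<open>R\<^sub>1\<close>, where
some polynomial of \<open>L\<close> has bounded excess.\<close>

lemma stratum_decay:
  assumes c: "0 < c" and q: "1 \<le> q" and b: "0 < b" and R1: "0 < R1" "R1 \<le> 1"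
  shows "\<exists>C\<ge>1. stratum_bound TYPE('n::finite) k Q m q c b R1 C"
proof -
  obtain K where K: "K \<ge> 1" and npd: "\<forall>(\<Omega> :: (real^'n::finite) set) u R T x y r S M \<mu> e.
    measurable_multifun Q m \<Omega> u \<longrightarrow> polytuple k Q m R \<longrightarrow> polytuple k Q m T \<longrightarrow> 0 < \<mu> \<longrightarrow> \<mu> < 1 \<longrightarrow>
    e = real CARD('n) + real k * q + q * \<mu> \<longrightarrow> 0 < r \<longrightarrow> 0 < M \<longrightarrow> dist x y \<le> r \<longrightarrow> 2 * r \<le> S \<longrightarrow>
    c * (r / 2) ^ CARD('n) \<le> measure lebesgue (ball x (r / 2) \<inter> \<Omega>) \<longrightarrow>
    (\<forall>\<sigma>. 0 < \<sigma> \<longrightarrow> \<sigma> \<le> r / 2 \<longrightarrow>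
       excess m q \<Omega> u (evalQ R) x \<sigma> \<le> ennreal (b * (\<sigma> / r) powr e) * excess m q \<Omega> u (evalQ T) x r) \<longrightarrow>
    decays m q \<Omega> u (evalQ T) y M S e \<longrightarrow>
    decays m q \<Omega> u (evalQ R) x (K * M) (S / 3) e"
    using near_point_decay[OF c q b, of Q m k, where ?'n = 'n] by (elim exE conjE)
  define E where "E = real CARD('n) + real k * q + q"
  define C where "C = K + b * R1 powr - E"
  have C: "1 \<le> C" "K \<le> C" "b * R1 powr - E \<le> C" using K b by (auto simp: C_def intro: add_increasing2)
  show ?thesis
  proof (rule exI[of _ C], rule conjI[OF C(1)], unfold stratum_bound_def, intro allI impI)
    fix \<Omega> :: "(real^'n) set" and u L R Z x and S M F \<mu> e :: real
    assume mm: "measurable_multifun Q m \<Omega> u" and R: "polytuple k Q m R" and L: "\<forall>T\<in>L. polytuple k Q m T"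
      and \<mu>: "0 < \<mu>" "\<mu> < 1" and e: "e = real CARD('n) + real k * q + q * \<mu>" and M: "0 < M" and F: "0 < F"
      and S: "2 * R1 \<le> S" and Z: "closed Z" "Z \<noteq> {}" "x \<notin> Z"
      and dens: "\<forall>\<rho>. 0 < \<rho> \<longrightarrow> \<rho> \<le> R1 \<longrightarrow> c * \<rho> ^ CARD('n) \<le> measure lebesgue (ball x \<rho> \<inter> \<Omega>)"
      and H: "\<forall>T\<in>L. \<forall>\<sigma> \<rho>. 0 < \<sigma> \<longrightarrow> \<sigma> \<le> \<rho> / 2 \<longrightarrow> \<rho> \<le> R1 \<longrightarrow> \<rho> \<le> infdist x Z \<longrightarrow>
       excess m q \<Omega> u (evalQ R) x \<sigma> \<le> ennreal (b * (\<sigma> / \<rho>) powr e) * excess m q \<Omega> u (evalQ T) x \<rho>"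
      and near: "\<forall>y\<in>Z. dist x y < R1 \<longrightarrow> (\<exists>T\<in>L. decays m q \<Omega> u (evalQ T) y M S e)"
      and far: "\<exists>T\<in>L. excess m q \<Omega> u (evalQ T) x R1 \<le> ennreal F"
    show "decays m q \<Omega> u (evalQ R) x (C * (M + F)) (R1 / 2) e"
    proof (cases "infdist x Z < R1")
      case True
      obtain y where y: "y \<in> Z" "infdist x Z = dist x y" using infdist_attains_inf[OF Z(1,2)] by blast
      define r where "r = dist x y"
      have r: "0 < r" "r < R1" using y Z(3) True by (auto simp: r_def)
      obtain T where T: "T \<in> L" "decays m q \<Omega> u (evalQ T) y M S e" using near y True by auto
      have "decays m q \<Omega> u (evalQ R) x (K * M) (S / 3) e"
      proof (rule npd[rule_format, OF mm R _ \<mu> e r(1) M _ _ _ _ T(2)])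
        show "polytuple k Q m T" using L T by blast
        show "dist x y \<le> r" by (simp add: r_def)
        show "2 * r \<le> S" using r S by simp
        show "c * (r / 2) ^ CARD('n) \<le> measure lebesgue (ball x (r / 2) \<inter> \<Omega>)" using dens r by simp
        show "excess m q \<Omega> u (evalQ R) x \<sigma> \<le> ennreal (b * (\<sigma> / r) powr e) * excess m q \<Omega> u (evalQ T) x r"
          if "0 < \<sigma>" "\<sigma> \<le> r / 2" for \<sigma>
          using H[rule_format, OF T(1) that] r y(2) by (simp add: r_def)
      qed
      then show ?thesis
      proof (rule decays_mono)
        have "K * M \<le> C * M" using C(2) M by (intro mult_right_mono) auto
        also have "\<dots> \<le> C * (M + F)" using C(1) F by (intro mult_left_mono) auto
        finally show "K * M \<le> C * (M + F)" .
        show "R1 / 2 \<le> S / 3" using S R1 by simp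
      qed
    next
      case False
      obtain T where T: "T \<in> L" "excess m q \<Omega> u (evalQ T) x R1 \<le> ennreal F" using far by blast
      show ?thesis unfolding decays_def
      proof (intro allI impI)
        fix \<sigma> assume \<sigma>: "0 < \<sigma>" "\<sigma> \<le> R1 / 2"
        have "excess m q \<Omega> u (evalQ R) x \<sigma> \<le> ennreal (b * (\<sigma> / R1) powr e) * excess m q \<Omega> u (evalQ T) x R1"
          using H[rule_format, OF T(1) \<sigma>] False by simp
        also have "\<dots> \<le> ennreal (b * (\<sigma> / R1) powr e) * ennreal F" by (intro mult_left_mono T(2)) simp
        also have "\<dots> = ennreal (b * (\<sigma> / R1) powr e * F)" using b F by (simp add: ennreal_mult)
        also have "\<dots> \<le> ennreal (C * (M + F) * \<sigma> powr e)"
        proof (rule ennreal_leI)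
          have "e \<le> E" using \<mu> q by (simp add: e E_def)
          then have "R1 powr - e \<le> R1 powr - E" using R1 by (intro powr_mono') auto
          then have "b * R1 powr - e \<le> C" using C(3) b by (intro order_trans[OF mult_left_mono C(3)]) auto
          then have "b * R1 powr - e * (F * \<sigma> powr e) \<le> C * (F * \<sigma> powr e)" using F by (intro mult_right_mono) auto
          also have "\<dots> \<le> C * ((M + F) * \<sigma> powr e)"
            using C(1) M by (intro mult_left_mono mult_right_mono) auto
          also have "\<dots> = C * (M + F) * \<sigma> powr e" by simp
          finally have "b * R1 powr - e * (F * \<sigma> powr e) \<le> C * (M + F) * \<sigma> powr e" .
          moreover have "b * (\<sigma> / R1) powr e * F = b * R1 powr - e * (F * \<sigma> powr e)"
            using R1 \<sigma> by (simp add: powr_divide powr_minus divide_simps)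
          ultimately show "b * (\<sigma> / R1) powr e * F \<le> C * (M + F) * \<sigma> powr e" by (simp only:)
        qed
        finally show "excess m q \<Omega> u (evalQ R) x \<sigma> \<le> ennreal (C * (M + F) * \<sigma> powr e)" .
      qed
    qed
  qed
qed

text \<open>The points at which decay is needed. The nearest points on the strata may leave the closure of \<open>\<Omega>'\<close>,
but only by a fixed multiple of the basic radius.\<close>

definition close_to :: "(real^'n) set \<Rightarrow> (real^'n) set \<Rightarrow> real \<Rightarrow> real^'n \<Rightarrow> bool" where
  "close_to \<Omega> \<Omega>' s z \<longleftrightarrow> z \<in> closure \<Omega> \<and> (\<exists>w\<in>\<Omega>'. dist z w < s)"

lemma close_to_shift:
  "close_to \<Omega> \<Omega>' s x \<Longrightarrow> y \<in> closure \<Omega> \<Longrightarrow> dist x y \<le> s' - s \<Longrightarrow> close_to \<Omega> \<Omega>' s' y"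
  unfolding close_to_def
proof (elim conjE bexE, intro conjI)
  fix w assume "w \<in> \<Omega>'" "dist x w < s" "dist x y \<le> s' - s"
  then have "dist y w < s'" using dist_triangle[of y w x] by (simp add: dist_commute)
  then show "\<exists>w\<in>\<Omega>'. dist y w < s'" using \<open>w \<in> \<Omega>'\<close> by blast
qed

text \<open>The situation of the theorem for one component \<open>u\<close>, at a basic radius \<open>R\<^sub>0\<close> that is small enough for
all balls in question to stay in \<open>\<Omega>''\<close>. Here \<open>\<Gamma>'\<close> is the stratum \<open>\<Gamma>\<^sub>i\<close>, \<open>L0\<close> and \<open>L1\<close> enumerate the
polynomials of \<open>\<PP>\<^sub>0\<close> and \<open>\<PP>\<^sub>i\<close> with the right number of values and the right target, and \<open>M\<close>, \<open>F\<close> are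
multiples of \<open>K\<^sup>q\<close>. The summed hypothesis (I) enters only as the decay of each component on \<open>\<Gamma>\<close>.\<close>

locale stratified_decay = measurable_multifun Q m \<Omega> u
  for Q m :: nat and \<Omega> :: "(real^'n::finite) set" and u :: "'n mvfun" +
  fixes k :: nat and q c b1 b2 R0 :: real and \<Omega>' \<Gamma> \<Gamma>' :: "(real^'n) set"
    and L0 L1 :: "(real^'n \<Rightarrow> nat \<Rightarrow> real) list set" and M F \<mu> e :: real
  assumes polytuples: "\<And>T. T \<in> L0 \<union> L1 \<Longrightarrow> polytuple k Q m T"
    and \<mu>: "0 < \<mu>" "\<mu> < 1" and e: "e = real CARD('n) + real k * q + q * \<mu>"
    and M: "0 < M" and F: "0 < F"
    and \<Gamma>: "closed \<Gamma>" "\<Gamma> \<noteq> {}" "\<Gamma> \<union> \<Gamma>' \<subseteq> closure \<Omega>" "closure \<Gamma>' \<subseteq> \<Gamma> \<union> \<Gamma>'"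
    and \<Omega>': "\<Omega>' \<subseteq> closure \<Omega>" "\<Omega>' \<noteq> {}" "bounded \<Omega>'" "\<Omega>' \<in> sets lebesgue"
    and density: "\<And>z \<rho>. close_to \<Omega> \<Omega>' (2 * R0) z \<Longrightarrow> 0 < \<rho> \<Longrightarrow> \<rho> \<le> R0 \<Longrightarrow>
      c * \<rho> ^ CARD('n) \<le> measure lebesgue (ball z \<rho> \<inter> \<Omega>)"
    and bounded_approx: "\<And>z \<rho>. close_to \<Omega> \<Omega>' (2 * R0) z \<Longrightarrow> 0 < \<rho> \<Longrightarrow> \<rho> \<le> R0 \<Longrightarrow>
      \<exists>T\<in>L0. excess m q \<Omega> u (evalQ T) z \<rho> \<le> ennreal F"
    and integral_bound: "\<And>z \<rho>. close_to \<Omega> \<Omega>' (2 * R0) z \<Longrightarrow> 0 < \<rho> \<Longrightarrow> \<rho> \<le> R0 \<Longrightarrow>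
      (\<integral>\<^sup>+y\<in>ball z \<rho> \<inter> \<Omega>. ennreal (absQ {..<m} (u y) powr q) \<partial>lebesgue) \<le> ennreal M"
    and decay_\<Gamma>: "\<And>z. z \<in> \<Gamma> \<Longrightarrow> close_to \<Omega> \<Omega>' (2 * R0) z \<Longrightarrow>
      \<exists>T\<in>L0. decays m q \<Omega> u (evalQ T) z M (R0 / 2) e"
    and improve_\<Gamma>': "\<And>z. z \<in> \<Gamma>' - \<Gamma> \<Longrightarrow> close_to \<Omega> \<Omega>' (2 * R0) z \<Longrightarrow>
      \<exists>R\<in>L1. \<forall>T\<in>L0. \<forall>\<sigma> \<rho>. 0 < \<sigma> \<longrightarrow> \<sigma> \<le> \<rho> / 2 \<longrightarrow> \<rho> \<le> R0 \<longrightarrow> \<rho> \<le> infdist z \<Gamma> \<longrightarrow>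
        excess m q \<Omega> u (evalQ R) z \<sigma> \<le> ennreal (b1 * (\<sigma> / \<rho>) powr e) * excess m q \<Omega> u (evalQ T) z \<rho>"
    and improve_off: "\<And>z. z \<notin> \<Gamma> \<union> \<Gamma>' \<Longrightarrow> close_to \<Omega> \<Omega>' (2 * R0) z \<Longrightarrow>
      \<exists>R. polytuple k Q m R \<and> (\<forall>T\<in>L0 \<union> L1. \<forall>\<sigma> \<rho>. 0 < \<sigma> \<longrightarrow> \<sigma> \<le> \<rho> / 2 \<longrightarrow> \<rho> \<le> R0 \<longrightarrow> \<rho> \<le> infdist z (\<Gamma> \<union> \<Gamma>') \<longrightarrow>
        excess m q \<Omega> u (evalQ R) z \<sigma> \<le> ennreal (b2 * (\<sigma> / \<rho>) powr e) * excess m q \<Omega> u (evalQ T) z \<rho>)"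
begin

lemma closed_strata: "closed (\<Gamma> \<union> \<Gamma>')"
proof -
  have "closure (\<Gamma> \<union> \<Gamma>') \<subseteq> \<Gamma> \<union> \<Gamma>'" using \<Gamma>(1,4) by auto
  then show ?thesis by (simp only: closure_subset_eq)
qed

lemma close_to_closure:
  assumes x: "x \<in> closure \<Omega>'" and s: "0 < s"
  shows "close_to \<Omega> \<Omega>' s x"
proof -
  obtain w where "w \<in> \<Omega>'" "dist w x < s"
    using x s closure_approachable[of x \<Omega>'] by blast
  moreover have "x \<in> closure \<Omega>" using x closure_mono[OF \<Omega>'(1)] unfolding closure_closure by blast
  ultimately show ?thesis by (auto simp: close_to_def dist_commute)
qed

end

text \<open>Two steps along the strata: from \<open>\<Gamma>\<close> to \<open>\<Gamma>'\<close>, and from \<open>\<Gamma> \<union> \<Gamma>'\<close> to the remaining points. A step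
requires decay on the lower strata up to twice its threshold radius, and yields decay up to half of that
threshold. This dictates the radii \<open>R\<^sub>0/2\<close> on \<open>\<Gamma>\<close>, the threshold \<open>R\<^sub>0/4\<close> and decay up to \<open>R\<^sub>0/8\<close> on \<open>\<Gamma>'\<close>,
the threshold \<open>R\<^sub>0/16\<close> and decay up to \<open>R\<^sub>0/32\<close> elsewhere.\<close>

lemma decay_on_closure:
  assumes c: "0 < c" and q: "1 \<le> q" and b1: "0 < b1" and b2: "0 < b2" and R0: "0 < R0" "R0 \<le> 1"
  shows "\<exists>C\<ge>1. \<forall>(\<Omega> :: (real^'n::finite) set) u \<Omega>' \<Gamma> \<Gamma>' L0 L1 M F \<mu> e x.
    stratified_decay Q m \<Omega> u k q c b1 b2 R0 \<Omega>' \<Gamma> \<Gamma>' L0 L1 M F \<mu> e \<longrightarrow> x \<in> closure \<Omega>' \<longrightarrow>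
    (\<exists>R. polytuple k Q m R \<and> decays m q \<Omega> u (evalQ R) x (C * (M + F)) (R0 / 32) e)"
proof -
  have R1: "0 < R0 / 4" "R0 / 4 \<le> 1" and R2: "0 < R0 / 16" "R0 / 16 \<le> 1" using R0 by auto
  obtain C1 where C1: "C1 \<ge> 1" and sb1: "stratum_bound TYPE('n) k Q m q c b1 (R0 / 4) C1"
    using stratum_decay[OF c q b1 R1] by blast
  obtain C2 where C2: "C2 \<ge> 1" and sb2: "stratum_bound TYPE('n) k Q m q c b2 (R0 / 16) C2"
    using stratum_decay[OF c q b2 R2] by blast
  note level1 = sb1[unfolded stratum_bound_def] and level2 = sb2[unfolded stratum_bound_def]
  have CC: "1 \<le> 2 * C2 * C1" using mult_mono[of 1 C2 1 C1] C1 C2 by simp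
  show ?thesis
  proof (rule exI[of _ "2 * C2 * C1"], rule conjI[OF CC], intro allI impI)
    fix \<Omega> \<Omega>' :: "(real^'n) set" and u \<Gamma> \<Gamma>' L0 L1 and M F \<mu> e :: real and x
    assume sd: "stratified_decay Q m \<Omega> u k q c b1 b2 R0 \<Omega>' \<Gamma> \<Gamma>' L0 L1 M F \<mu> e" and x: "x \<in> closure \<Omega>'"
    interpret stratified_decay Q m \<Omega> u k q c b1 b2 R0 \<Omega>' \<Gamma> \<Gamma>' L0 L1 M F \<mu> e by (rule sd)
    have mm: "measurable_multifun Q m \<Omega> u" by unfold_locales
    define N where "N = C1 * (M + F)"
    have N: "M \<le> N" "0 < N" "F \<le> N"
    proof -
      have "1 * (M + F) \<le> N" unfolding N_def using C1 M F by (intro mult_right_mono) auto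
      then show "M \<le> N" "0 < N" "F \<le> N" using M F by auto
    qed
    have N2: "N \<le> 2 * C2 * C1 * (M + F)" "C2 * (N + F) \<le> 2 * C2 * C1 * (M + F)"
    proof -
      have "C2 * (N + F) \<le> C2 * (2 * N)" using C2 N by (intro mult_left_mono) auto
      then show "C2 * (N + F) \<le> 2 * C2 * C1 * (M + F)" by (simp add: N_def mult_ac)
      have "1 * N \<le> (2 * C2) * N" using C2 N by (intro mult_right_mono) auto
      then show "N \<le> 2 * C2 * C1 * (M + F)" by (simp add: N_def mult_ac)
    qed
    have strata: "\<exists>R\<in>L0 \<union> L1. decays m q \<Omega> u (evalQ R) z N (R0 / 8) e"
      if z: "z \<in> \<Gamma> \<union> \<Gamma>'" and cl: "close_to \<Omega> \<Omega>' R0 z" for z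
    proof -
      have cl2: "close_to \<Omega> \<Omega>' (2 * R0) z"
        using cl R0 by (intro close_to_shift[OF cl]) (auto simp: close_to_def)
      show ?thesis
      proof (cases "z \<in> \<Gamma>")
        case True
        then obtain T where "T \<in> L0" "decays m q \<Omega> u (evalQ T) z M (R0 / 2) e" using decay_\<Gamma> cl2 by blast
        moreover from this have "decays m q \<Omega> u (evalQ T) z N (R0 / 8) e"
          using decays_mono N(1) R0 by fastforce
        ultimately show ?thesis by blast
      next
        case False
        with z have "z \<in> \<Gamma>' - \<Gamma>" by blast
        from improve_\<Gamma>'[OF this cl2] obtain R where R: "R \<in> L1" and HR: "\<forall>T\<in>L0. \<forall>\<sigma> \<rho>. 0 < \<sigma> \<longrightarrow> \<sigma> \<le> \<rho> / 2 \<longrightarrow>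
          \<rho> \<le> R0 \<longrightarrow> \<rho> \<le> infdist z \<Gamma> \<longrightarrow>
          excess m q \<Omega> u (evalQ R) z \<sigma> \<le> ennreal (b1 * (\<sigma> / \<rho>) powr e) * excess m q \<Omega> u (evalQ T) z \<rho>"
          by blast
        have "decays m q \<Omega> u (evalQ R) z (C1 * (M + F)) (R0 / 4 / 2) e"
        proof (rule level1[rule_format, where L = L0 and Z = \<Gamma> and S = "R0 / 2", OF mm _ _ \<mu> e M F _ \<Gamma>(1,2) False])
          show "polytuple k Q m R" using R polytuples by blast
          show "\<exists>T\<in>L0. decays m q \<Omega> u (evalQ T) y M (R0 / 2) e" if "y \<in> \<Gamma>" "dist z y < R0 / 4" for y
          proof -
            have "close_to \<Omega> \<Omega>' (2 * R0) y"
              using that \<Gamma>(3) R0 by (intro close_to_shift[OF cl]) auto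
            then show ?thesis using decay_\<Gamma> that by blast
          qed
          show "\<exists>T\<in>L0. excess m q \<Omega> u (evalQ T) z (R0 / 4) \<le> ennreal F"
            using bounded_approx cl2 R0 by simp
        qed (use polytuples R0 density cl2 HR in auto)
        then show ?thesis using R by (auto simp: N_def)
      qed
    qed
    have clx: "close_to \<Omega> \<Omega>' (R0 / 2) x" "close_to \<Omega> \<Omega>' R0 x" "close_to \<Omega> \<Omega>' (2 * R0) x"
      using R0 by (auto intro: close_to_closure[OF x])
    show "\<exists>R. polytuple k Q m R \<and> decays m q \<Omega> u (evalQ R) x (2 * C2 * C1 * (M + F)) (R0 / 32) e"
    proof (cases "x \<in> \<Gamma> \<union> \<Gamma>'")
      case True
      then obtain R where R: "R \<in> L0 \<union> L1" "decays m q \<Omega> u (evalQ R) x N (R0 / 8) e"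
        using strata clx by blast
      have "decays m q \<Omega> u (evalQ R) x (2 * C2 * C1 * (M + F)) (R0 / 32) e"
        by (rule decays_mono[OF R(2) N2(1)]) (use R0 in simp)
      then show ?thesis using R polytuples by blast
    next
      case False
      from improve_off[OF False clx(3)] obtain R where R: "polytuple k Q m R" and HR: "\<forall>T\<in>L0 \<union> L1. \<forall>\<sigma> \<rho>. 0 < \<sigma> \<longrightarrow> \<sigma> \<le> \<rho> / 2 \<longrightarrow>
          \<rho> \<le> R0 \<longrightarrow> \<rho> \<le> infdist x (\<Gamma> \<union> \<Gamma>') \<longrightarrow>
          excess m q \<Omega> u (evalQ R) x \<sigma> \<le> ennreal (b2 * (\<sigma> / \<rho>) powr e) * excess m q \<Omega> u (evalQ T) x \<rho>"
        by blast
      have "decays m q \<Omega> u (evalQ R) x (C2 * (N + F)) (R0 / 16 / 2) e"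
      proof (rule level2[rule_format, where L = "L0 \<union> L1" and Z = "\<Gamma> \<union> \<Gamma>'" and S = "R0 / 8",
            OF mm R _ \<mu> e N(2) F _ closed_strata _ False])
        show "\<exists>T\<in>L0 \<union> L1. decays m q \<Omega> u (evalQ T) y N (R0 / 8) e"
          if "y \<in> \<Gamma> \<union> \<Gamma>'" "dist x y < R0 / 16" for y
        proof -
          have "close_to \<Omega> \<Omega>' R0 y"
            using that \<Gamma>(3) R0 by (intro close_to_shift[OF clx(1)]) auto
          then show ?thesis using strata that by blast
        qed
        have "\<exists>T\<in>L0. excess m q \<Omega> u (evalQ T) x (R0 / 16) \<le> ennreal F"
          using bounded_approx clx R0 by simp
        then show "\<exists>T\<in>L0 \<union> L1. excess m q \<Omega> u (evalQ T) x (R0 / 16) \<le> ennreal F" by blast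
      qed (use polytuples R0 density clx HR \<Gamma>(2) in auto)
      then have "decays m q \<Omega> u (evalQ R) x (2 * C2 * C1 * (M + F)) (R0 / 32) e"
        by (rule decays_mono) (use N2 in auto)
      then show ?thesis using R by blast
    qed
  qed
qed

section \<open>Fields of multi-valued jets\<close>

text \<open>The \<open>j\<close>-th derivative of a polynomial map, as a tensor that vanishes outside its index set.\<close>

definition jet :: "nat \<Rightarrow> nat \<Rightarrow> (real^'n::finite \<Rightarrow> nat \<Rightarrow> real) \<Rightarrow> real^'n \<Rightarrow> 'n tensor" where
  "jet m j p x = (\<lambda>(a, bs). if a < m \<and> length bs = j then pderivs bs (\<lambda>y. p y a) x else 0)"

definition jetQ :: "nat \<Rightarrow> nat \<Rightarrow> (real^'n::finite \<Rightarrow> nat \<Rightarrow> real) list \<Rightarrow> real^'n \<Rightarrow> 'n tensor multiset" where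
  "jetQ m j R x = mset (map (\<lambda>p. jet m j p x) R)"

lemma finite_tidx: "finite (tidx m j :: (nat \<times> 'n::finite list) set)"
proof -
  have "tidx m j = {..<m} \<times> {bs :: 'n list. set bs \<subseteq> UNIV \<and> length bs = j}" by (auto simp: tidx_def)
  then show ?thesis using finite_lists_length_eq[of "UNIV :: 'n set" j] by simp
qed

lemma jet_vecs: "jet m j p x \<in> vecs (tidx m j)"
  by (auto simp: jet_def vecs_def tidx_def)

lemma jetQ_AQ: "length R = Q \<Longrightarrow> jetQ m j R x \<in> AQ Q (tidx m j)"
  by (auto simp: jetQ_def AQ_def jet_vecs)

lemma jetQ_mset_eq: "mset R = mset T \<Longrightarrow> jetQ m j R = jetQ m j T"
  unfolding jetQ_def by (simp add: fun_eq_iff)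

lemma jetQ_0:
  assumes "polytuple k Q m R"
  shows "jetQ m 0 R x = image_mset tensor0 (evalQ R x)"
proof -
  have "jet m 0 p x = tensor0 (p x)" if "p \<in> set R" for p
    using that assms by (fastforce simp: jet_def tensor0_def polytuple_def polymap_def vecs_def)
  then have "map (\<lambda>p. jet m 0 p x) R = map tensor0 (map (\<lambda>p. p x) R)" by auto
  then show ?thesis unfolding jetQ_def evalQ_def by (simp only: mset_map)
qed

lemma GQ_jets_le:
  fixes F G :: "(real^'n::finite \<Rightarrow> nat \<Rightarrow> real) \<Rightarrow> 'n tensor"
  assumes "length R = Q" "length T = Q"
    and "\<And>i a bs. i < Q \<Longrightarrow> a < m \<Longrightarrow> length bs = j \<Longrightarrow> \<bar>F (R ! i) (a, bs) - G (T ! i) (a, bs)\<bar> \<le> t"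
  shows "GQ (tidx m j) (mset (map F R)) (mset (map G T)) \<le> real (Q * card (tidx m j :: (nat \<times> 'n list) set)) * t"
  using GQ_le_sum_components[of "map F R" "map G T" "tidx m j" t] assms by (auto simp: tidx_def)

lemma GQ_same_list_le:
  fixes F G :: "(real^'n::finite \<Rightarrow> nat \<Rightarrow> real) \<Rightarrow> 'n tensor"
  shows "GQ (tidx m j) (mset (map F R)) (mset (map G R)) \<le>
    real (length R * card (tidx m j :: (nat \<times> 'n list) set)) *
    (\<Sum>i<length R. \<Sum>(a, bs)\<in>tidx m j. \<bar>F (R ! i) (a, bs) - G (R ! i) (a, bs)\<bar>)" (is "_ \<le> _ * ?s")
proof (rule GQ_jets_le[OF refl refl])
  fix i a and bs :: "'n list" assume *: "i < length R" "a < m" "length bs = j"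
  have "\<bar>F (R ! i) (a, bs) - G (R ! i) (a, bs)\<bar> \<le> (\<Sum>(a, bs)\<in>tidx m j. \<bar>F (R ! i) (a, bs) - G (R ! i) (a, bs)\<bar>)"
  proof -
    have "(a, bs) \<in> tidx m j" using * by (simp add: tidx_def)
    from member_le_sum[OF this _ finite_tidx, of "\<lambda>(a, bs). \<bar>F (R ! i) (a, bs) - G (R ! i) (a, bs)\<bar>"]
    show ?thesis by auto
  qed
  also have "\<dots> \<le> ?s"
    using * by (intro member_le_sum[where f = "\<lambda>i. \<Sum>(a, bs)\<in>tidx m j. \<bar>F (R ! i) (a, bs) - G (R ! i) (a, bs)\<bar>"])
      (auto intro!: sum_nonneg)
  finally show "\<bar>F (R ! i) (a, bs) - G (R ! i) (a, bs)\<bar> \<le> ?s" .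
qed

lemma polytuple_pderivs_poly:
  "polytuple k Q m R \<Longrightarrow> i < Q \<Longrightarrow> a < m \<Longrightarrow> poly_deg_le (k - length bs) (pderivs bs (\<lambda>y. (R ! i) y a))"
  by (intro poly_deg_le_pderivs polytuple_component)

lemma jetQ_tendsto:
  assumes R: "polytuple k Q m R"
  shows "((\<lambda>y. GQ (tidx m j) (jetQ m j R y) (jetQ m j R x)) \<longlongrightarrow> 0) (at x within X)"
proof (rule Lim_null_comparison)
  let ?s = "\<lambda>y. \<Sum>i<length R. \<Sum>(a, bs)\<in>tidx m j. \<bar>jet m j (R ! i) y (a, bs) - jet m j (R ! i) x (a, bs)\<bar>"
  let ?c = "real (length R * card (tidx m j :: (nat \<times> 'a list) set))"
  show "\<forall>\<^sub>F y in at x within X. norm (GQ (tidx m j) (jetQ m j R y) (jetQ m j R x)) \<le> ?c * ?s y"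
    unfolding jetQ_def using GQ_same_list_le by (intro always_eventually allI) (simp add: GQ_nonneg)
  have "((\<lambda>y. jet m j (R ! i) y c) \<longlongrightarrow> jet m j (R ! i) x c) (at x within X)" if "i < length R" for i c
  proof -
    obtain a bs where c: "c = (a, bs)" by fastforce
    show ?thesis
    proof (cases "a < m \<and> length bs = j")
      case True
      have "poly_deg_le (k - length bs) (pderivs bs (\<lambda>y. (R ! i) y a))"
        using that True R by (intro polytuple_pderivs_poly) (auto simp: polytuple_def)
      from continuous_on_poly_deg_le[OF this, of UNIV]
      have "(pderivs bs (\<lambda>y. (R ! i) y a) \<longlongrightarrow> pderivs bs (\<lambda>y. (R ! i) y a) x) (at x within X)"
        by (auto simp: continuous_on_def intro: tendsto_within_subset)
      then show ?thesis using True by (simp add: jet_def c)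
    next
      case False
      then have "jet m j (R ! i) y c = 0" for y by (auto simp: jet_def c)
      then show ?thesis by simp
    qed
  qed
  then have "(?s \<longlongrightarrow> (\<Sum>i<length R. \<Sum>(a, bs)\<in>tidx m j. \<bar>jet m j (R ! i) x (a, bs) - jet m j (R ! i) x (a, bs)\<bar>)) (at x within X)"
    unfolding case_prod_unfold by (intro tendsto_intros) auto
  then show "((\<lambda>y. ?c * ?s y) \<longlongrightarrow> 0) (at x within X)"
    by (intro tendsto_mult_right_zero) (simp add: case_prod_unfold)
qed

text \<open>Within one polynomial tuple the derivative of the \<open>j\<close>-th jet is the next jet, by differentiability of
each partial derivative. In \<open>jet_field\<close> this is combined with the change of the tuple from point to point.\<close>

lemma jetQ_has_deriv:
  assumes R: "polytuple k Q m R"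
  shows "((\<lambda>h. GQ (tidx m j) (jetQ m j R (x + h))
     (image_mset (\<lambda>p c. jet m j p x c + tapp (jet m (Suc j) p x) h c) (mset R)) / norm h) \<longlongrightarrow> 0) (at 0)"
proof (rule Lim_null_comparison)
  let ?d = "\<lambda>h i a bs. jet m j (R ! i) (x + h) (a, bs) - (jet m j (R ! i) x (a, bs) + tapp (jet m (Suc j) (R ! i) x) h (a, bs))"
  let ?s = "\<lambda>h. \<Sum>i<length R. \<Sum>(a, bs)\<in>tidx m j. \<bar>?d h i a bs / norm h\<bar>"
  let ?c = "real (length R * card (tidx m j :: (nat \<times> 'a list) set))"
  show "\<forall>\<^sub>F h in at 0. norm (GQ (tidx m j) (jetQ m j R (x + h))
     (image_mset (\<lambda>p c. jet m j p x c + tapp (jet m (Suc j) p x) h c) (mset R)) / norm h) \<le> ?c * ?s h"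
  proof (rule always_eventually, rule allI)
    fix h :: "real^'a"
    let ?G = "GQ (tidx m j) (jetQ m j R (x + h)) (image_mset (\<lambda>p c. jet m j p x c + tapp (jet m (Suc j) p x) h c) (mset R))"
    have "?G \<le> ?c * (\<Sum>i<length R. \<Sum>(a, bs)\<in>tidx m j. \<bar>?d h i a bs\<bar>)"
      using GQ_same_list_le[of m j "\<lambda>p. jet m j p (x + h)" R "\<lambda>p c. jet m j p x c + tapp (jet m (Suc j) p x) h c"]
      by (simp add: jetQ_def)
    then have "?G / norm h \<le> ?c * (\<Sum>i<length R. \<Sum>(a, bs)\<in>tidx m j. \<bar>?d h i a bs\<bar>) / norm h"
      by (rule divide_right_mono) simp
    also have "\<dots> = ?c * ((\<Sum>i<length R. \<Sum>(a, bs)\<in>tidx m j. \<bar>?d h i a bs\<bar>) / norm h)" by simp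
    also have "(\<Sum>i<length R. \<Sum>(a, bs)\<in>tidx m j. \<bar>?d h i a bs\<bar>) / norm h = ?s h"
      by (simp add: sum_divide_distrib case_prod_unfold)
    finally show "norm (?G / norm h) \<le> ?c * ?s h"
      by (simp add: jetQ_def GQ_nonneg)
  qed
  have "((\<lambda>h. ?d h i (fst c) (snd c) / norm h) \<longlongrightarrow> 0) (at 0)" if i: "i < length R" and c: "c \<in> tidx m j" for i c
  proof -
    obtain a bs where c': "c = (a, bs)" "a < m" "length bs = j" using c by (auto simp: tidx_def)
    define f where "f = pderivs bs (\<lambda>y. (R ! i) y a)"
    have "poly_deg_le (k - length bs) f"
      unfolding f_def using i c' R by (intro polytuple_pderivs_poly) (auto simp: polytuple_def)
    then have "(f has_derivative (\<lambda>h. \<Sum>b\<in>UNIV. pderiv_at b f x * h $ b)) (at x)"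
      by (rule poly_has_derivative)
    then have "((\<lambda>h. norm (f (x + h) - f x - (\<Sum>b\<in>UNIV. pderiv_at b f x * h $ b)) / norm h) \<longlongrightarrow> 0) (at 0)"
      unfolding has_derivative_at by (rule conjunct2)
    then have "((\<lambda>h. norm ((f (x + h) - f x - (\<Sum>b\<in>UNIV. pderiv_at b f x * h $ b)) / norm h)) \<longlongrightarrow> 0) (at 0)"
      by (simp only: abs_divide real_norm_def abs_norm_cancel)
    then have "((\<lambda>h. (f (x + h) - f x - (\<Sum>b\<in>UNIV. pderiv_at b f x * h $ b)) / norm h) \<longlongrightarrow> 0) (at 0)"
      by (rule tendsto_norm_zero_cancel)
    moreover have "?d h i (fst c) (snd c) = f (x + h) - f x - (\<Sum>b\<in>UNIV. pderiv_at b f x * h $ b)" for h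
      using c' by (simp add: jet_def tapp_def f_def)
    ultimately show ?thesis by simp
  qed
  then have "(?s \<longlongrightarrow> (\<Sum>i<length R. \<Sum>c\<in>(tidx m j :: (nat \<times> 'a list) set). \<bar>0\<bar>)) (at 0)"
    unfolding case_prod_unfold by (intro tendsto_sum tendsto_rabs) auto
  then show "((\<lambda>h. ?c * ?s h) \<longlongrightarrow> 0) (at 0)"
    by (intro tendsto_mult_right_zero) simp
qed

text \<open>A Whitney-type condition for multi-valued jets. At \<open>y\<close> the derivatives of the polynomials attached to \<open>x\<close>
and to \<open>y\<close> agree up to \<open>H r\<^sup>k\<^sup>+\<^sup>\<mu>\<^sup>-\<^sup>j\<close>, with one matching for all orders \<open>j\<close>. On the diagonal such a field is
a \<open>C\<^bsup>k,\<mu>\<^esup>\<close> map together with its derivatives.\<close>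

locale jet_field =
  fixes k Q m :: nat and X :: "(real^'n::finite) set"
    and Rf :: "real^'n \<Rightarrow> (real^'n \<Rightarrow> nat \<Rightarrow> real) list" and H S \<mu> :: real
  assumes X: "X \<noteq> {}" and H: "0 \<le> H" and S: "0 < S" "S \<le> 1" and \<mu>: "0 < \<mu>" "\<mu> < 1"
    and Rf: "\<And>x. x \<in> X \<Longrightarrow> polytuple k Q m (Rf x)"
    and matched: "\<And>x y r. x \<in> X \<Longrightarrow> y \<in> X \<Longrightarrow> 0 < r \<Longrightarrow> dist x y < r \<Longrightarrow> 2 * r \<le> S \<Longrightarrow>
      \<exists>T'. mset T' = mset (Rf y) \<and> (\<forall>i<Q. \<forall>a<m. \<forall>bs. length bs \<le> k \<longrightarrow>
        \<bar>pderivs bs (\<lambda>w. (Rf x ! i) w a) y - pderivs bs (\<lambda>w. (T' ! i) w a) y\<bar> \<le> H * r powr (real k + \<mu> - real (length bs)))"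
    and bounded_jets: "\<And>x i a bs. x \<in> X \<Longrightarrow> i < Q \<Longrightarrow> a < m \<Longrightarrow> length bs \<le> k \<Longrightarrow>
        \<bar>pderivs bs (\<lambda>w. (Rf x ! i) w a) x\<bar> \<le> H"
begin

definition U :: "nat \<Rightarrow> real^'n \<Rightarrow> 'n tensor multiset" where
  "U j x = jetQ m j (Rf x) x"

definition wt :: "nat \<Rightarrow> real" where
  "wt j = real (Q * card (tidx m j :: (nat \<times> 'n list) set))"

lemma wt_nonneg: "0 \<le> wt j"
  by (simp add: wt_def)

lemma len_Rf: "x \<in> X \<Longrightarrow> length (Rf x) = Q"
  using Rf by (simp add: polytuple_def)

lemma U_AQ: "x \<in> X \<Longrightarrow> U j x \<in> AQ Q (tidx m j)"
  unfolding U_def by (intro jetQ_AQ len_Rf)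

text \<open>With \<open>r = 2 \<bar>x - y\<bar>\<close> the point \<open>y\<close> lies in the open ball of radius \<open>r\<close> about \<open>x\<close>; the factor
\<open>2\<^sup>k\<^sup>+\<^sup>1\<close> absorbs \<open>2\<^sup>k\<^sup>+\<^sup>\<mu>\<^sup>-\<^sup>j\<close> for all \<open>j\<close> and \<open>\<mu>\<close>.\<close>

lemma U_compare:
  assumes x: "x \<in> X" and y: "y \<in> X" and d: "4 * dist x y \<le> S" and j: "j \<le> k"
  shows "GQ (tidx m j) (U j y) (jetQ m j (Rf x) y) \<le> wt j * 2 ^ (k + 1) * H * dist x y powr (real k + \<mu> - real j)"
proof (cases "x = y")
  case True
  then show ?thesis by (simp add: U_def GQ_self)
next
  case False
  define r where "r = 2 * dist x y"
  have r: "0 < r" "dist x y < r" "2 * r \<le> S" using False d by (auto simp: r_def)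
  obtain T' where T': "mset T' = mset (Rf y)" and close: "\<And>i a bs. i < Q \<Longrightarrow> a < m \<Longrightarrow> length bs \<le> k \<Longrightarrow>
        \<bar>pderivs bs (\<lambda>w. (Rf x ! i) w a) y - pderivs bs (\<lambda>w. (T' ! i) w a) y\<bar> \<le> H * r powr (real k + \<mu> - real (length bs))"
    using matched[OF x y r] by blast
  have len: "length T' = Q" using T' len_Rf[OF y] by (metis size_mset)
  have "GQ (tidx m j) (jetQ m j T' y) (jetQ m j (Rf x) y) \<le> wt j * (H * r powr (real k + \<mu> - real j))"
    unfolding jetQ_def wt_def
    using len len_Rf[OF x] close j
    by (intro GQ_jets_le) (auto simp: jet_def abs_minus_commute)
  also have "r powr (real k + \<mu> - real j) \<le> 2 ^ (k + 1) * dist x y powr (real k + \<mu> - real j)"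
  proof -
    have "r powr (real k + \<mu> - real j) = 2 powr (real k + \<mu> - real j) * dist x y powr (real k + \<mu> - real j)"
      by (simp add: r_def powr_mult)
    also have "\<dots> \<le> 2 powr real (k + 1) * dist x y powr (real k + \<mu> - real j)"
      using \<mu> by (intro mult_right_mono powr_mono) auto
    finally show ?thesis by (subst (asm) powr_realpow) auto
  qed
  finally have "GQ (tidx m j) (jetQ m j T' y) (jetQ m j (Rf x) y)
     \<le> wt j * (H * (2 ^ (k + 1) * dist x y powr (real k + \<mu> - real j)))"
    using wt_nonneg H by (simp add: mult_left_mono)
  then show ?thesis using jetQ_mset_eq[OF T'] by (simp add: U_def mult_ac)
qed

lemma value_compare:
  assumes x: "x \<in> X" and y: "y \<in> X" and d: "4 * dist x y \<le> S"
  shows "GQ {..<m} (evalQ (Rf y) y) (evalQ (Rf x) y) \<le> real (Q * m) * 2 ^ (k + 1) * H * dist x y powr (real k + \<mu>)"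
proof (cases "x = y")
  case True
  then show ?thesis by (simp add: GQ_self)
next
  case False
  define r where "r = 2 * dist x y"
  have r: "0 < r" "dist x y < r" "2 * r \<le> S" using False d by (auto simp: r_def)
  obtain T' where T': "mset T' = mset (Rf y)" and close: "\<And>i a bs. i < Q \<Longrightarrow> a < m \<Longrightarrow> length bs \<le> k \<Longrightarrow>
        \<bar>pderivs bs (\<lambda>w. (Rf x ! i) w a) y - pderivs bs (\<lambda>w. (T' ! i) w a) y\<bar> \<le> H * r powr (real k + \<mu> - real (length bs))"
    using matched[OF x y r] by blast
  have len: "length T' = Q" using T' len_Rf[OF y] by (metis size_mset)
  have "GQ {..<m} (evalQ T' y) (evalQ (Rf x) y) \<le> real (Q * m) * (H * r powr (real k + \<mu>))"
    using len len_Rf[OF x] close[of _ _ "[]"] by (intro GQ_evalQ_le) (auto simp: abs_minus_commute)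
  also have "r powr (real k + \<mu>) \<le> 2 ^ (k + 1) * dist x y powr (real k + \<mu>)"
  proof -
    have "r powr (real k + \<mu>) = 2 powr (real k + \<mu>) * dist x y powr (real k + \<mu>)"
      by (simp add: r_def powr_mult)
    also have "\<dots> \<le> 2 powr real (k + 1) * dist x y powr (real k + \<mu>)"
      using \<mu> by (intro mult_right_mono powr_mono) auto
    finally show ?thesis by (subst (asm) powr_realpow) auto
  qed
  finally have "GQ {..<m} (evalQ T' y) (evalQ (Rf x) y)
     \<le> real (Q * m) * (H * (2 ^ (k + 1) * dist x y powr (real k + \<mu>)))"
    using H by (simp add: mult_left_mono)
  then show ?thesis using evalQ_mset_eq[OF T'] by (simp add: mult_ac)
qed

lemma U_bound:
  assumes x: "x \<in> X" and j: "j \<le> k"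
  shows "absQ (tidx m j) (U j x) \<le> wt j * H"
proof -
  have "GQ (tidx m j) (mset (map (\<lambda>p. jet m j p x) (Rf x))) (mset (map (\<lambda>p c. 0) (Rf x))) \<le> wt j * H"
    unfolding wt_def using len_Rf[OF x] bounded_jets[OF x] j
    by (intro GQ_jets_le) (auto simp: jet_def)
  moreover have "mset (map (\<lambda>p c. 0 :: real) (Rf x) :: 'n tensor list) = replicate_mset (size (U j x)) (\<lambda>_. 0)"
    using len_Rf[OF x] by (simp only: map_replicate_const mset_replicate U_def jetQ_def size_mset length_map)
  ultimately show ?thesis unfolding absQ_def by (simp only: U_def jetQ_def)
qed

lemma powr_dist_tendsto:
  assumes "0 < s"
  shows "((\<lambda>y. dist x y powr s) \<longlongrightarrow> 0) (at x within Y)"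
proof -
  have "((\<lambda>y. dist x y powr s) \<longlongrightarrow> dist x x powr s) (at x within Y)"
    using assms by (intro tendsto_powr' tendsto_intros) auto
  then show ?thesis by simp
qed

lemma U_continuous:
  assumes j: "j \<le> k"
  shows "continuousQ_on X (tidx m j) (U j)"
  unfolding continuousQ_on_def
proof
  fix x assume x: "x \<in> X"
  let ?f = "\<lambda>y. wt j * 2 ^ (k + 1) * H * dist x y powr (real k + \<mu> - real j) + GQ (tidx m j) (jetQ m j (Rf x) y) (jetQ m j (Rf x) x)"
  show "((\<lambda>y. GQ (tidx m j) (U j y) (U j x)) \<longlongrightarrow> 0) (at x within X)"
  proof (rule Lim_null_comparison)
    have "(?f \<longlongrightarrow> wt j * 2 ^ (k + 1) * H * 0 + 0) (at x within X)"
      using \<mu> j by (intro tendsto_intros powr_dist_tendsto jetQ_tendsto[OF Rf[OF x]]) auto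
    then show "(?f \<longlongrightarrow> 0) (at x within X)" by simp
    have "\<forall>\<^sub>F y in at x within X. y \<in> X \<and> dist y x < S / 4"
      using S by (auto simp: eventually_at intro!: exI[of _ "S / 4"])
    then show "\<forall>\<^sub>F y in at x within X. norm (GQ (tidx m j) (U j y) (U j x)) \<le> ?f y"
    proof eventually_elim
      case (elim y)
      then have y: "y \<in> X" "4 * dist x y \<le> S" by (auto simp: dist_commute)
      have "GQ (tidx m j) (U j y) (U j x) \<le> GQ (tidx m j) (U j y) (jetQ m j (Rf x) y) + GQ (tidx m j) (jetQ m j (Rf x) y) (U j x)"
        using U_AQ x y jetQ_AQ[OF len_Rf[OF x]] by (intro GQ_triangle_AQ)
      then show ?case
        using U_compare[OF x y j] GQ_nonneg_AQ[OF U_AQ[OF y(1)] U_AQ[OF x], of j] by (simp add: U_def)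
    qed
  qed
qed

lemma values_continuous: "continuousQ_on X {..<m} (\<lambda>x. evalQ (Rf x) x)"
  unfolding continuousQ_on_def
proof
  fix x assume x: "x \<in> X"
  let ?f = "\<lambda>y. real (Q * m) * 2 ^ (k + 1) * H * dist x y powr (real k + \<mu>) + GQ {..<m} (evalQ (Rf x) y) (evalQ (Rf x) x)"
  show "((\<lambda>y. GQ {..<m} (evalQ (Rf y) y) (evalQ (Rf x) x)) \<longlongrightarrow> 0) (at x within X)"
  proof (rule Lim_null_comparison)
    have "((\<lambda>y. GQ {..<m} (evalQ (Rf x) y) (evalQ (Rf x) x)) \<longlongrightarrow> 0) (at x within X)"
      using continuousQ_evalQ[OF Rf[OF x], of X] x by (simp add: continuousQ_on_def)
    then have "(?f \<longlongrightarrow> real (Q * m) * 2 ^ (k + 1) * H * 0 + 0) (at x within X)"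
      using \<mu> by (intro tendsto_intros powr_dist_tendsto) auto
    then show "(?f \<longlongrightarrow> 0) (at x within X)" by simp
    have "\<forall>\<^sub>F y in at x within X. y \<in> X \<and> dist y x < S / 4"
      using S by (auto simp: eventually_at intro!: exI[of _ "S / 4"])
    then show "\<forall>\<^sub>F y in at x within X. norm (GQ {..<m} (evalQ (Rf y) y) (evalQ (Rf x) x)) \<le> ?f y"
    proof eventually_elim
      case (elim y)
      then have y: "y \<in> X" "4 * dist x y \<le> S" by (auto simp: dist_commute)
      note AQ = evalQ_AQ[OF Rf[OF y(1)], of y] evalQ_AQ[OF Rf[OF x], of y] evalQ_AQ[OF Rf[OF x], of x]
      show ?case
        using GQ_triangle_AQ[OF AQ] value_compare[OF x y] GQ_nonneg_AQ[OF AQ(1,3)] by simp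
    qed
  qed
qed

text \<open>Moving from \<open>x\<close> to \<open>x + h\<close> changes the tuple of polynomials, which costs \<open>\<bar>h\<bar>\<^sup>k\<^sup>+\<^sup>\<mu>\<^sup>-\<^sup>j = o(\<bar>h\<bar>)\<close> because
\<open>j < k\<close>. What remains is the derivative within the tuple attached to \<open>x\<close>.\<close>

lemma U_deriv:
  assumes j: "j < k" and x: "x \<in> interior Y" and Y: "Y \<subseteq> X"
  shows "has_derivQ (tidx m j) (U j) (U (Suc j) x) x"
proof -
  have xX: "x \<in> X" using x Y interior_subset by blast
  let ?J = "image_mset (\<lambda>p. (jet m j p x, jet m (Suc j) p x)) (mset (Rf x))"
  let ?L = "\<lambda>h. image_mset (\<lambda>p c. jet m j p x c + tapp (jet m (Suc j) p x) h c) (mset (Rf x))"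
  have L: "image_mset (\<lambda>(T, A) c. T c + tapp A h c) ?J = ?L h" for h
    by (simp add: image_mset.compositionality comp_def)
  let ?f = "\<lambda>h. wt j * 2 ^ (k + 1) * H * norm h powr (real k + \<mu> - real j - 1) + GQ (tidx m j) (jetQ m j (Rf x) (x + h)) (?L h) / norm h"
  have "((\<lambda>h. GQ (tidx m j) (U j (x + h)) (?L h) / norm h) \<longlongrightarrow> 0) (at 0)"
  proof (rule Lim_null_comparison)
    have "((\<lambda>h :: real^'n. dist 0 h powr (real k + \<mu> - real j - 1)) \<longlongrightarrow> 0) (at 0)"
      using \<mu> j by (intro powr_dist_tendsto) auto
    then have "(?f \<longlongrightarrow> wt j * 2 ^ (k + 1) * H * 0 + 0) (at 0)"
      by (intro tendsto_intros jetQ_has_deriv[OF Rf[OF xX]]) simp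
    then show "(?f \<longlongrightarrow> 0) (at 0)" by simp
    obtain e where e: "e > 0" "ball x e \<subseteq> Y" using x by (auto simp: mem_interior)
    have "\<forall>\<^sub>F h in at (0 :: real^'n). h \<noteq> 0 \<and> dist h 0 < min e (S / 4)"
      using S e(1) by (auto simp: eventually_at intro!: exI[of _ "min e (S / 4)"])
    then show "\<forall>\<^sub>F h in at 0. norm (GQ (tidx m j) (U j (x + h)) (?L h) / norm h) \<le> ?f h"
    proof eventually_elim
      case (elim h)
      then have "x + h \<in> ball x e" by (simp add: dist_norm)
      then have "x + h \<in> X" using e(2) Y by blast
      moreover have "4 * dist x (x + h) \<le> S" using elim by (simp add: dist_norm)
      ultimately have y: "x + h \<in> X" "4 * dist x (x + h) \<le> S" .
      have sz: "size (?L h) = Q" "size (U j (x + h)) = Q" "size (jetQ m j (Rf x) (x + h)) = Q"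
        using len_Rf xX y by (simp_all add: U_def jetQ_def)
      have "GQ (tidx m j) (U j (x + h)) (?L h) \<le>
        GQ (tidx m j) (U j (x + h)) (jetQ m j (Rf x) (x + h)) + GQ (tidx m j) (jetQ m j (Rf x) (x + h)) (?L h)"
        using sz by (intro GQ_triangle) auto
      also have "\<dots> \<le> wt j * 2 ^ (k + 1) * H * norm h powr (real k + \<mu> - real j) + GQ (tidx m j) (jetQ m j (Rf x) (x + h)) (?L h)"
        using U_compare[OF xX y, of j] j by (simp add: dist_norm)
      finally have "GQ (tidx m j) (U j (x + h)) (?L h) / norm h \<le>
        (wt j * 2 ^ (k + 1) * H * norm h powr (real k + \<mu> - real j) + GQ (tidx m j) (jetQ m j (Rf x) (x + h)) (?L h)) / norm h"
        by (rule divide_right_mono) simp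
      also have "\<dots> = ?f h"
        using elim by (simp add: add_divide_distrib powr_diff)
      finally show ?case using GQ_nonneg[of "U j (x + h)" "?L h" "tidx m j"] sz by simp
    qed
  qed
  then have "((\<lambda>h. GQ (tidx m j) (U j (x + h)) (image_mset (\<lambda>(T, A) c. T c + tapp A h c) ?J) / norm h) \<longlongrightarrow> 0) (at 0)"
    unfolding L .
  moreover have "image_mset fst ?J = U j x" "image_mset snd ?J = U (Suc j) x"
    by (simp_all add: U_def jetQ_def image_mset.compositionality comp_def)
  ultimately show ?thesis unfolding has_derivQ_def by blast
qed

lemma U_top_const:
  assumes x: "x \<in> X"
  shows "jetQ m k (Rf x) y = U k x"
proof -
  have "jet m k p y = jet m k p x" if p: "p \<in> set (Rf x)" for p
  proof (rule ext, clarify)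
    fix a and bs :: "'n list"
    have "pderivs bs (\<lambda>y. p y a) y = pderivs bs (\<lambda>y. p y a) x" if "a < m" "length bs = k"
    proof (rule poly_deg_le_0_const)
      have "poly_deg_le (k - length bs) (pderivs bs (\<lambda>y. p y a))"
        using Rf[OF x] p that(1) by (intro poly_deg_le_pderivs) (auto simp: polytuple_def polymap_def)
      then show "poly_deg_le 0 (pderivs bs (\<lambda>y. p y a))" using that by simp
    qed
    then show "jet m k p y (a, bs) = jet m k p x (a, bs)" by (simp add: jet_def)
  qed
  then show ?thesis by (auto simp: U_def jetQ_def intro!: image_mset_cong)
qed

definition hconst :: real where
  "hconst = wt k * (2 ^ (k + 1) + 8 / S)"

text \<open>For \<open>\<bar>x - y\<bar> \<le> S/4\<close> this is \<open>U_compare\<close>, since jets of order \<open>k\<close> are constant. Distant points are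
handled by the bound on the jets; the factor
\<open>8 / S\<close> compensates the lower bound \<open>S/4\<close> of \<open>\<bar>x - y\<bar>\<^sup>\<mu>\<close>.\<close>

lemma U_holder:
  assumes x: "x \<in> X" and y: "y \<in> X"
  shows "GQ (tidx m k) (U k x) (U k y) \<le> hconst * H * dist x y powr \<mu>"
proof (cases "4 * dist y x \<le> S")
  case True
  have "GQ (tidx m k) (U k x) (U k y) \<le> wt k * 2 ^ (k + 1) * H * dist y x powr \<mu>"
    using U_compare[OF y x True, of k] U_top_const[OF y, of x] by simp
  also have "\<dots> \<le> hconst * H * dist x y powr \<mu>"
  proof -
    have "wt k * 2 ^ (k + 1) \<le> hconst" using wt_nonneg[of k] S by (simp add: hconst_def distrib_left)
    then show ?thesis using H by (simp only: dist_commute[of y x] mult_right_mono powr_ge_zero)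
  qed
  finally show ?thesis .
next
  case False
  have "GQ (tidx m k) (U k x) (U k y) \<le> absQ (tidx m k) (U k x) + absQ (tidx m k) (U k y)"
    using U_AQ[OF x] U_AQ[OF y] by (intro absQ_triangle_bound) (simp add: AQ_def)
  also have "\<dots> \<le> 2 * (wt k * H)" using U_bound[OF x, of k] U_bound[OF y, of k] by simp
  also have "\<dots> = (wt k * (8 / S)) * H * (S / 4)" using S by simp
  also have "\<dots> \<le> hconst * H * dist x y powr \<mu>"
  proof (intro mult_mono)
    show "wt k * (8 / S) \<le> hconst" using wt_nonneg[of k] by (simp add: hconst_def distrib_left)
    have "S / 4 = (S / 4) powr 1" using S by simp
    also have "\<dots> \<le> (S / 4) powr \<mu>" using S \<mu> by (intro powr_mono') auto
    also have "\<dots> \<le> dist x y powr \<mu>" using False S \<mu> by (intro powr_mono2) (auto simp: dist_commute)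
    finally show "S / 4 \<le> dist x y powr \<mu>" .
  qed (use H S wt_nonneg in \<open>auto simp: hconst_def\<close>)
  finally show ?thesis .
qed

lemma U_holderQ:
  assumes "X = closure Y"
  shows "holderQ Q m k \<mu> Y (\<lambda>x. evalQ (Rf x) x) U"
  unfolding holderQ_def assms[symmetric]
proof (intro conjI allI ballI impI)
  fix x assume x: "x \<in> X"
  show "evalQ (Rf x) x \<in> AQ Q {..<m}" by (rule evalQ_AQ[OF Rf[OF x]])
  show "U 0 x = image_mset tensor0 (evalQ (Rf x) x)" unfolding U_def by (rule jetQ_0[OF Rf[OF x]])
next
  fix j x assume "j < k" "x \<in> interior Y"
  then show "has_derivQ (tidx m j) (U j) (U (Suc j) x) x"
    using closure_subset[of Y] assms by (intro U_deriv) auto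
next
  show "\<exists>L. \<forall>x\<in>X. \<forall>y\<in>X. GQ (tidx m k) (U k x) (U k y) \<le> L * dist x y powr \<mu>"
    using U_holder by blast
qed (use U_AQ U_continuous in auto)

lemma U_norm:
  assumes "X = closure Y"
  shows "holder_normQ m k \<mu> Y U \<le> ((\<Sum>j\<le>k. wt j) + hconst) * H"
proof -
  have "(SUP x\<in>X. absQ (tidx m j) (U j x)) \<le> wt j * H" if "j \<le> k" for j
    using X U_bound that by (intro cSUP_least)
  then have 1: "(\<Sum>j\<le>k. SUP x\<in>X. absQ (tidx m j) (U j x)) \<le> (\<Sum>j\<le>k. wt j * H)"
    by (intro sum_mono) auto
  have "(SUP (x, y)\<in>X \<times> X. GQ (tidx m k) (U k x) (U k y) / dist x y powr \<mu>) \<le> hconst * H"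
  proof (rule cSUP_least)
    fix z assume "z \<in> X \<times> X"
    then obtain x y where z: "z = (x, y)" "x \<in> X" "y \<in> X" by blast
    have "GQ (tidx m k) (U k x) (U k y) / dist x y powr \<mu> \<le> hconst * H"
    proof (cases "x = y")
      case True
      then show ?thesis using H S wt_nonneg[of k] by (simp add: hconst_def)
    next
      case False
      then show ?thesis using U_holder[OF z(2,3)] by (simp add: pos_divide_le_eq)
    qed
    then show "(case z of (x, y) \<Rightarrow> GQ (tidx m k) (U k x) (U k y) / dist x y powr \<mu>) \<le> hconst * H"
      by (simp add: z)
  qed (use X in auto)
  then show ?thesis using 1 unfolding holder_normQ_def assms[symmetric]
    by (simp add: distrib_right sum_distrib_right)
qed

end

section \<open>From decay of the excess to Hoelder regularity\<close>

text \<open>The Vitali covering lemma provides disjoint balls of radius \<open>\<rho>\<close> centred in \<open>S\<close> whose fivefold dilates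
cover \<open>S\<close>. By volume there are at most \<open>O(\<rho>\<^sup>-\<^sup>n)\<close> of them, so the integral of \<open>f\<close> over \<open>S\<close> is
\<open>O(\<rho>\<^sup>-\<^sup>n \<rho>\<^sup>n\<^sup>+\<^sup>\<gamma>) = O(\<rho>\<^sup>\<gamma>)\<close>, and \<open>\<rho>\<close> is arbitrary.\<close>

lemma AE_zero_of_small_ball_integrals:
  fixes f :: "real^'n::finite \<Rightarrow> ennreal"
  assumes S: "bounded S" "S \<in> sets lebesgue" and f: "(\<lambda>x. f x * indicator S x) \<in> borel_measurable lebesgue"
    and "0 < \<gamma>" "0 \<le> C" "0 < r0"
    and small: "\<And>x r. x \<in> S \<Longrightarrow> 0 < r \<Longrightarrow> r \<le> r0 \<Longrightarrow>
      (\<integral>\<^sup>+y\<in>ball x r \<inter> S. f y \<partial>lebesgue) \<le> ennreal (C * r powr (real CARD('n) + \<gamma>))"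
  shows "AE x in lebesgue. x \<in> S \<longrightarrow> f x = 0"
proof -
  obtain B where B: "0 < B" "S \<subseteq> ball 0 B" using bounded_subset_ballD[OF S(1), of 0] by blast
  define V where "V = measure lebesgue (ball (0 :: real^'n) 1)"
  have V: "0 < V" unfolding V_def by simp
  have ballV: "measure lebesgue (ball (x :: real^'n) r) = V * r ^ CARD('n)" if "0 \<le> r" for x r
    using content_ball_conv_unit_ball[OF that, of x] by (simp add: V_def mult.commute)
  define D where "D = (B + 1) ^ CARD('n) * (C * 5 powr (real CARD('n) + \<gamma>))"
  have bound: "(\<integral>\<^sup>+y\<in>S. f y \<partial>lebesgue) \<le> ennreal (D * \<rho> powr \<gamma>)" if \<rho>: "0 < \<rho>" "\<rho> \<le> 1" "5 * \<rho> \<le> r0" for \<rho>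
  proof -
    have cov: "S \<subseteq> (\<Union>x\<in>S. ball x \<rho>)" using \<rho> by auto
    obtain K where K: "countable K" "K \<subseteq> S" "pairwise (\<lambda>i j. disjnt (ball i \<rho>) (ball j \<rho>)) K"
      "S \<subseteq> (\<Union>x\<in>K. ball x (5 * \<rho>))"
      by (rule Vitali_covering_lemma_balls[OF cov, of 1]) (use \<rho> in auto)
    have card: "real (card F) \<le> ((B + 1) / \<rho>) ^ CARD('n)" if F: "F \<subseteq> K" "finite F" for F
    proof -
      have sub: "(\<Union>x\<in>F. ball x \<rho>) \<subseteq> ball 0 (B + 1)"
      proof
        fix z assume "z \<in> (\<Union>x\<in>F. ball x \<rho>)"
        then obtain x where x: "x \<in> F" "dist x z < \<rho>" by auto
        then have "x \<in> ball 0 B" using F K(2) B by blast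
        then have "dist 0 x < B" by simp
        then show "z \<in> ball 0 (B + 1)" using dist_triangle[of 0 z x] x \<rho> by simp
      qed
      have "real (card F) * (V * \<rho> ^ CARD('n)) = (\<Sum>x\<in>F. measure lebesgue (ball x \<rho>))"
        by (simp only: ballV[OF less_imp_le[OF \<rho>(1)]]) simp
      also have "\<dots> = measure lebesgue (\<Union>x\<in>F. ball x \<rho>)"
        using F K(3) by (intro measure_UNION'[symmetric]) (auto intro: pairwise_subset)
      also have "\<dots> \<le> measure lebesgue (ball (0 :: real^'n) (B + 1))"
        using F sub by (intro measure_mono_fmeasurable) auto
      also have "\<dots> = V * (B + 1) ^ CARD('n)" using B by (intro ballV) simp
      finally have "real (card F) * \<rho> ^ CARD('n) * V \<le> (B + 1) ^ CARD('n) * V" by (simp add: mult_ac)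
      then have "real (card F) * \<rho> ^ CARD('n) \<le> (B + 1) ^ CARD('n)" using V by simp
      then show ?thesis using \<rho> by (simp add: power_divide pos_le_divide_eq)
    qed
    have "finite K \<and> card K \<le> nat \<lfloor>((B + 1) / \<rho>) ^ CARD('n)\<rfloor>"
      using card by (intro finite_if_finite_subsets_card_bdd) (simp add: le_nat_floor)
    then have fin: "finite K" by blast
    have "(\<integral>\<^sup>+y\<in>S. f y \<partial>lebesgue) \<le> (\<integral>\<^sup>+y. (\<Sum>x\<in>K. f y * indicator (ball x (5 * \<rho>) \<inter> S) y) \<partial>lebesgue)"
    proof (rule nn_integral_mono)
      fix y
      show "f y * indicator S y \<le> (\<Sum>x\<in>K. f y * indicator (ball x (5 * \<rho>) \<inter> S) y)"
      proof (cases "y \<in> S")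
        case True
        then obtain x where x: "x \<in> K" "y \<in> ball x (5 * \<rho>)" using K(4) by blast
        then have "f y * indicator S y = f y * indicator (ball x (5 * \<rho>) \<inter> S) y" using True by simp
        also have "\<dots> \<le> (\<Sum>x\<in>K. f y * indicator (ball x (5 * \<rho>) \<inter> S) y)"
          using x fin by (intro member_le_sum[where f = "\<lambda>x. f y * indicator (ball x (5 * \<rho>) \<inter> S) y"]) auto
        finally show ?thesis .
      qed simp
    qed
    also have "\<dots> = (\<Sum>x\<in>K. \<integral>\<^sup>+y\<in>ball x (5 * \<rho>) \<inter> S. f y \<partial>lebesgue)"
    proof (rule nn_integral_sum)
      fix x
      have "(\<lambda>y. (f y * indicator S y) * indicator (ball x (5 * \<rho>)) y) \<in> borel_measurable lebesgue"
        by (rule borel_measurable_times_ennreal[OF f borel_measurable_indicator]) auto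
      moreover have "(f y * indicator S y) * indicator (ball x (5 * \<rho>)) y = f y * indicator (ball x (5 * \<rho>) \<inter> S) y" for y
        by (auto simp: indicator_def)
      ultimately show "(\<lambda>y. f y * indicator (ball x (5 * \<rho>) \<inter> S) y) \<in> borel_measurable lebesgue" by simp
    qed
    also have "\<dots> \<le> (\<Sum>x\<in>K. ennreal (C * (5 * \<rho>) powr (real CARD('n) + \<gamma>)))"
      using K(2) \<rho> by (intro sum_mono small) auto
    also have "\<dots> = ennreal (real (card K) * (C * (5 * \<rho>) powr (real CARD('n) + \<gamma>)))"
      using \<open>0 \<le> C\<close> by (simp add: ennreal_mult ennreal_of_nat_eq_real_of_nat)
    also have "\<dots> \<le> ennreal (D * \<rho> powr \<gamma>)"
    proof (rule ennreal_leI)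
      have "real (card K) * (C * (5 * \<rho>) powr (real CARD('n) + \<gamma>)) \<le>
        ((B + 1) / \<rho>) ^ CARD('n) * (C * (5 * \<rho>) powr (real CARD('n) + \<gamma>))"
        using card[of K] fin \<open>0 \<le> C\<close> by (intro mult_right_mono) auto
      also have "\<dots> = D * \<rho> powr \<gamma>"
        using \<rho> by (simp add: D_def power_divide powr_mult powr_add powr_realpow)
      finally show "real (card K) * (C * (5 * \<rho>) powr (real CARD('n) + \<gamma>)) \<le> D * \<rho> powr \<gamma>" .
    qed
    finally show ?thesis .
  qed
  have "((\<lambda>\<rho>. D * \<rho> powr \<gamma>) \<longlongrightarrow> D * 0 powr \<gamma>) (at_right 0)"
    using \<open>0 < \<gamma>\<close> eventually_at_right_less[of "0 :: real"]
    by (intro tendsto_intros tendsto_powr') (auto intro: tendsto_ident_at elim: eventually_mono)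
  then have "((\<lambda>\<rho>. ennreal (D * \<rho> powr \<gamma>)) \<longlongrightarrow> ennreal 0) (at_right 0)"
    by (intro tendsto_ennrealI) simp
  moreover have "\<forall>\<^sub>F \<rho> in at_right 0. (\<integral>\<^sup>+y\<in>S. f y \<partial>lebesgue) \<le> ennreal (D * \<rho> powr \<gamma>)"
    unfolding eventually_at_right_field
    using \<open>0 < r0\<close> by (intro exI[of _ "min 1 (r0 / 5)"]) (auto intro!: bound)
  ultimately have "(\<integral>\<^sup>+y\<in>S. f y \<partial>lebesgue) \<le> ennreal 0"
    by (intro tendsto_lowerbound) auto
  then have "(\<integral>\<^sup>+y\<in>S. f y \<partial>lebesgue) = 0" by simp
  then have "AE x in lebesgue. f x * indicator S x = 0" using f by (simp add: nn_integral_0_iff_AE)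
  then show ?thesis by eventually_elim (auto simp: indicator_def split: if_splits)
qed

text \<open>The matching condition is the comparison of the tuples attached to \<open>x\<close> and \<open>y\<close> on the ball of radius \<open>r\<close>
about \<open>x\<close>, which lies in the ball of radius \<open>2 r\<close> about \<open>y\<close>. The bound on the jets is the comparison with
the zero tuple at the fixed radius \<open>S\<close>, where the excess of zero is the integral of \<open>\<bar>u\<bar>\<^sup>q\<close>.\<close>

lemma jets_of_decaying_approximations:
  assumes c: "0 < c" and q: "1 \<le> q" and S: "0 < S" "S \<le> 1"
  shows "\<exists>C\<ge>1. \<forall>(\<Omega> :: (real^'n::finite) set) u X Rf M \<mu>.
    measurable_multifun Q m \<Omega> u \<longrightarrow> X \<noteq> {} \<longrightarrow> 0 < \<mu> \<longrightarrow> \<mu> < 1 \<longrightarrow> 0 < M \<longrightarrow>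
    (\<forall>x\<in>X. polytuple k Q m (Rf x) \<and>
       decays m q \<Omega> u (evalQ (Rf x)) x M S (real CARD('n) + real k * q + q * \<mu>)) \<longrightarrow>
    (\<forall>x\<in>X. \<forall>\<rho>. 0 < \<rho> \<longrightarrow> \<rho> \<le> S \<longrightarrow> c * \<rho> ^ CARD('n) \<le> measure lebesgue (ball x \<rho> \<inter> \<Omega>)) \<longrightarrow>
    (\<forall>x\<in>X. (\<integral>\<^sup>+y\<in>ball x S \<inter> \<Omega>. ennreal (absQ {..<m} (u y) powr q) \<partial>lebesgue) \<le> ennreal M) \<longrightarrow>
    jet_field k Q m X Rf (C * M powr (1 / q)) S \<mu>"
proof -
  obtain K where K: "K \<ge> 1" and comp: "comparison_bound TYPE('n) k Q m q c K"
    using comparison_of_approximations[OF c q] by blast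
  note comp0 = comp[unfolded comparison_bound_def]
  define E where "E = real CARD('n) + real k * q + q"
  define B where "B = 2 powr E"
  define N where "N = S powr (- (real CARD('n) / q)) / S ^ k"
  have B: "1 \<le> B" using q by (auto simp: B_def E_def intro!: ge_one_powr_ge_zero)
  have N: "0 < N" using S by (simp add: N_def)
  define C where "C = K * B powr (1 / q) + K * N"
  have C: "1 \<le> C" "K * B powr (1 / q) \<le> C" "K * N \<le> C"
  proof -
    have "1 \<le> B powr (1 / q)" using B q by (intro ge_one_powr_ge_zero) auto
    then have "1 * 1 \<le> K * B powr (1 / q)" using K by (intro mult_mono) auto
    then show "1 \<le> C" using K N by (simp add: C_def add_increasing2)
  qed (use K N in \<open>auto simp: C_def\<close>)
  show ?thesis
  proof (rule exI[of _ C], rule conjI[OF C(1)], intro allI impI)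
    fix \<Omega> X :: "(real^'n) set" and u Rf and M \<mu> :: real
    assume mm: "measurable_multifun Q m \<Omega> u" and X: "X \<noteq> {}" and \<mu>: "0 < \<mu>" "\<mu> < 1" and M: "0 < M"
      and Rf: "\<forall>x\<in>X. polytuple k Q m (Rf x) \<and>
       decays m q \<Omega> u (evalQ (Rf x)) x M S (real CARD('n) + real k * q + q * \<mu>)"
      and dens: "\<forall>x\<in>X. \<forall>\<rho>. 0 < \<rho> \<longrightarrow> \<rho> \<le> S \<longrightarrow> c * \<rho> ^ CARD('n) \<le> measure lebesgue (ball x \<rho> \<inter> \<Omega>)"
      and int: "\<forall>x\<in>X. (\<integral>\<^sup>+y\<in>ball x S \<inter> \<Omega>. ennreal (absQ {..<m} (u y) powr q) \<partial>lebesgue) \<le> ennreal M"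
    interpret measurable_multifun Q m \<Omega> u by (rule mm)
    define e where "e = real CARD('n) + real k * q + q * \<mu>"
    have eE: "e \<le> E" "0 \<le> e" using \<mu> q by (auto simp: e_def E_def)
    have poly: "polytuple k Q m (Rf x)" if "x \<in> X" for x using Rf that by blast
    have dec: "excess m q \<Omega> u (evalQ (Rf x)) x \<sigma> \<le> ennreal (M * \<sigma> powr e)" if "x \<in> X" "0 < \<sigma>" "\<sigma> \<le> S" for x \<sigma>
      using Rf that by (simp add: decays_def e_def)
    show "jet_field k Q m X Rf (C * M powr (1 / q)) S \<mu>"
    proof
      show "0 \<le> C * M powr (1 / q)" using C by simp
    next
      fix x y r assume x: "x \<in> X" and y: "y \<in> X" and r: "0 < r" "dist x y < r" "2 * r \<le> S"
      \<comment> \<open>The factor B = 2^E pays for the doubled radius at y.\<close>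
      define t where "t = (B * M) powr (1 / q) * r powr (real k + \<mu>)"
      have t: "0 < t" using r B M by (simp add: t_def)
      have tq: "t powr q * r ^ CARD('n) = B * M * r powr e"
      proof -
        have "t powr q * r ^ CARD('n) = (B * M) * (r powr ((real k + \<mu>) * q) * r powr real CARD('n))"
          using r q B M by (simp add: t_def powr_mult powr_powr powr_realpow)
        also have "\<dots> = B * M * r powr e"
          unfolding powr_add[symmetric] e_def by (simp add: algebra_simps)
        finally show ?thesis .
      qed
      have "excess m q \<Omega> u (evalQ (Rf x)) x r \<le> ennreal (M * r powr e)" using x r by (intro dec) auto
      also have "\<dots> \<le> ennreal (t powr q * r ^ CARD('n))"
        unfolding tq using B M by (intro ennreal_leI mult_right_mono) auto
      finally have exx: "excess m q \<Omega> u (evalQ (Rf x)) x r \<le> ennreal (t powr q * r ^ CARD('n))" .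
      have "excess m q \<Omega> u (evalQ (Rf y)) x r \<le> excess m q \<Omega> u (evalQ (Rf y)) y (2 * r)"
        using r by (intro excess_mono) auto
      also have "\<dots> \<le> ennreal (M * (2 * r) powr e)" using y r by (intro dec) auto
      also have "\<dots> \<le> ennreal (t powr q * r ^ CARD('n))"
      proof (rule ennreal_leI)
        have "(2::real) powr e \<le> B" unfolding B_def using eE by (intro powr_mono) auto
        then have "2 powr e * (M * r powr e) \<le> B * (M * r powr e)" using M by (intro mult_right_mono) auto
        then show "M * (2 * r) powr e \<le> t powr q * r ^ CARD('n)"
          unfolding tq by (simp add: powr_mult mult_ac)
      qed
      finally have exy: "excess m q \<Omega> u (evalQ (Rf y)) x r \<le> ennreal (t powr q * r ^ CARD('n))" .
      have "c * r ^ CARD('n) \<le> measure lebesgue (ball x r \<inter> \<Omega>)" using dens x r by simp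
      from comp0[rule_format, OF mm poly[OF x] poly[OF y] r(1) t this exx exy]
      obtain T' where T': "mset T' = mset (Rf y)" and close: "\<And>i a bs z. i < Q \<Longrightarrow> a < m \<Longrightarrow> length bs \<le> k \<Longrightarrow> z \<in> ball x r \<Longrightarrow>
         \<bar>pderivs bs (\<lambda>y. (Rf x ! i) y a) z - pderivs bs (\<lambda>y. (T' ! i) y a) z\<bar> \<le> K * t / r ^ length bs"
        by blast
      show "\<exists>T'. mset T' = mset (Rf y) \<and> (\<forall>i<Q. \<forall>a<m. \<forall>bs. length bs \<le> k \<longrightarrow>
        \<bar>pderivs bs (\<lambda>w. (Rf x ! i) w a) y - pderivs bs (\<lambda>w. (T' ! i) w a) y\<bar> \<le>
          C * M powr (1 / q) * r powr (real k + \<mu> - real (length bs)))"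
      proof (rule exI[of _ T'], rule conjI[OF T'], intro allI impI)
        fix i a and bs :: "'n list" assume ia: "i < Q" "a < m" "length bs \<le> k"
        have "\<bar>pderivs bs (\<lambda>w. (Rf x ! i) w a) y - pderivs bs (\<lambda>w. (T' ! i) w a) y\<bar> \<le> K * t / r ^ length bs"
          using ia r by (intro close) auto
        also have "\<dots> = K * B powr (1 / q) * (M powr (1 / q) * r powr (real k + \<mu> - real (length bs)))"
          using r by (simp add: t_def powr_mult powr_diff powr_realpow)
        also have "\<dots> \<le> C * (M powr (1 / q) * r powr (real k + \<mu> - real (length bs)))"
          using C(2) by (intro mult_right_mono) auto
        finally show "\<bar>pderivs bs (\<lambda>w. (Rf x ! i) w a) y - pderivs bs (\<lambda>w. (T' ! i) w a) y\<bar> \<le>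
          C * M powr (1 / q) * r powr (real k + \<mu> - real (length bs))" by simp
      qed
    next
      fix x i a and bs :: "'n list" assume x: "x \<in> X" and ia: "i < Q" "a < m" "length bs \<le> k"
      define t where "t = M powr (1 / q) * S powr (- (real CARD('n) / q))"
      have t: "0 < t" using S M by (simp add: t_def)
      have tq: "t powr q * S ^ CARD('n) = M"
      proof -
        have "t powr q * S ^ CARD('n) = M * (S powr (- real CARD('n)) * S powr real CARD('n))"
          using S M q by (simp add: t_def powr_mult powr_powr powr_realpow)
        also have "\<dots> = M" using S by (simp flip: powr_add)
        finally show ?thesis .
      qed
      let ?Z = "zero_tuple Q :: (real^'n \<Rightarrow> nat \<Rightarrow> real) list"
      have "excess m q \<Omega> u (evalQ (Rf x)) x S \<le> ennreal (M * S powr e)" using x S by (intro dec) auto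
      also have "\<dots> \<le> ennreal (t powr q * S ^ CARD('n))"
        unfolding tq using S eE M by (intro ennreal_leI) (simp add: powr_le1 mult_left_le)
      finally have ex1: "excess m q \<Omega> u (evalQ (Rf x)) x S \<le> ennreal (t powr q * S ^ CARD('n))" .
      have "excess m q \<Omega> u (evalQ ?Z) x S \<le> (\<integral>\<^sup>+y\<in>ball x S \<inter> \<Omega>. ennreal (absQ {..<m} (u y) powr q) \<partial>lebesgue)"
        unfolding excess_def
      proof (rule nn_integral_mono)
        fix y :: "real^'n"
        show "ennreal (GQ {..<m} (u y) (evalQ ?Z y) powr q) * indicator (ball x S \<inter> \<Omega>) y
          \<le> ennreal (absQ {..<m} (u y) powr q) * indicator (ball x S \<inter> \<Omega>) y"
          using absQ_eq_GQ_zero[OF u, of y y] by (auto simp: indicator_def)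
      qed
      also have "\<dots> \<le> ennreal (t powr q * S ^ CARD('n))" unfolding tq using int x by blast
      finally have ex2: "excess m q \<Omega> u (evalQ ?Z) x S \<le> ennreal (t powr q * S ^ CARD('n))" .
      have "c * S ^ CARD('n) \<le> measure lebesgue (ball x S \<inter> \<Omega>)" using dens x S by simp
      from comp0[rule_format, OF mm poly[OF x] polytuple_zero S(1) t this ex1 ex2]
      obtain T' where T': "mset T' = mset ?Z" and close: "\<And>i a bs z. i < Q \<Longrightarrow> a < m \<Longrightarrow> length bs \<le> k \<Longrightarrow> z \<in> ball x S \<Longrightarrow>
         \<bar>pderivs bs (\<lambda>y. (Rf x ! i) y a) z - pderivs bs (\<lambda>y. (T' ! i) y a) z\<bar> \<le> K * t / S ^ length bs"
        by blast
      have "length T' = Q" using T' by (metis length_replicate size_mset zero_tuple_def)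
      then have "T' ! i \<in> set T'" using ia by simp
      moreover have "set T' \<subseteq> {\<lambda>x c. 0}" using T' by (metis set_mset_mset set_replicate_conv_if zero_tuple_def empty_subsetI subset_refl)
      ultimately have T'0: "T' ! i = (\<lambda>x c. 0)" by blast
      have "\<bar>pderivs bs (\<lambda>y. (Rf x ! i) y a) x\<bar> \<le> K * t / S ^ length bs"
        using close[OF ia, of x] S by (simp add: T'0 pderivs_0)
      also have "\<dots> \<le> K * t / S ^ k"
        using K t S ia by (intro divide_left_mono power_decreasing) auto
      also have "\<dots> = K * N * M powr (1 / q)" by (simp add: t_def N_def)
      also have "\<dots> \<le> C * M powr (1 / q)" using C(3) by (intro mult_right_mono) auto
      finally show "\<bar>pderivs bs (\<lambda>w. (Rf x ! i) w a) x\<bar> \<le> C * M powr (1 / q)" .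
    qed (use X S \<mu> poly in auto)
  qed
qed

text \<open>On a small ball about \<open>x\<close> both \<open>u\<close> and the values \<open>v\<close> of the field are close to the polynomials attached
to \<open>x\<close>: \<open>u\<close> by decay, \<open>v\<close> by the matching condition. Hence the integral of \<open>GQ u v powr q\<close> over the ball
decays faster than its volume.\<close>

lemma field_values_eq_AE:
  fixes \<Omega> :: "(real^'n::finite) set"
  assumes mm: "measurable_multifun Q m \<Omega> u" and jf: "jet_field k Q m X Rf H S \<mu>" and q: "1 \<le> q"
    and dec: "\<And>x. x \<in> X \<Longrightarrow> decays m q \<Omega> u (evalQ (Rf x)) x M S (real CARD('n) + real k * q + q * \<mu>)"
    and M: "0 \<le> M" and Y: "Y \<subseteq> X" "Y \<subseteq> \<Omega>" "bounded Y" "Y \<in> sets lebesgue"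
  shows "AE x in lebesgue. x \<in> Y \<longrightarrow> evalQ (Rf x) x = u x"
proof -
  interpret measurable_multifun Q m \<Omega> u by (rule mm)
  interpret jet_field k Q m X Rf H S \<mu> by (rule jf)
  define v where "v = (\<lambda>x. evalQ (Rf x) x)"
  have vAQ: "v x \<in> AQ Q {..<m}" if "x \<in> X" for x unfolding v_def by (rule evalQ_AQ[OF Rf[OF that]])
  have "continuousQ_on Y {..<m} v"
    using values_continuous Y(1) unfolding continuousQ_on_def v_def by (blast intro: tendsto_within_subset)
  then have mv: "measurableQ Q {..<m} Y v"
    using Y vAQ by (intro measurableQ_continuous) auto
  have muY: "measurableQ Q {..<m} Y u"
    using \<Omega> Y by (intro measurableQ_subset[OF mu]) (auto intro!: borel_open)
  have meas: "(\<lambda>x. GQ {..<m} (u x) (v x)) \<in> borel_measurable (lebesgue_on Y)"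
    using u Y vAQ by (intro measurable_GQ[OF _ _ muY mv Y(4)]) auto
  define f where "f = (\<lambda>x. ennreal (GQ {..<m} (u x) (v x) powr q))"
  have fm: "(\<lambda>x. f x * indicator Y x) \<in> borel_measurable lebesgue"
    unfolding f_def by (rule borel_measurable_powr_indicator[OF meas Y(4)])
  define V where "V = measure lebesgue (ball (0 :: real^'n) 1)"
  define W where "W = real (Q * m) * 2 ^ (k + 1) * H"
  have W: "0 \<le> W" using H by (simp add: W_def)
  have V: "0 \<le> V" by (simp add: V_def)
  define \<gamma> where "\<gamma> = real k * q + q * \<mu>"
  have \<gamma>: "0 < \<gamma>" using q \<mu> by (auto simp: \<gamma>_def intro!: add_nonneg_pos mult_pos_pos)
  have AE0: "AE x in lebesgue. x \<in> Y \<longrightarrow> f x = 0"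
  proof (rule AE_zero_of_small_ball_integrals[OF Y(3,4) fm \<gamma>, of "2 powr q * (M + W powr q * V)" "S / 4"])
    show "0 \<le> 2 powr q * (M + W powr q * V)" using M V by simp
    show "0 < S / 4" using S by simp
    fix x r assume x: "x \<in> Y" and r: "0 < r" "r \<le> S / 4"
    have xX: "x \<in> X" using x Y by blast
    have AQ: "u z \<in> AQ Q {..<m}" "evalQ (Rf x) z \<in> AQ Q {..<m}" "v z \<in> AQ Q {..<m}" if "z \<in> Y" for z
      using that Y u vAQ evalQ_AQ[OF Rf[OF xX]] by auto
    have sub: "ball x r \<inter> Y \<in> sets lebesgue" "ball x r \<inter> Y \<subseteq> \<Omega>" using Y by auto
    have "(\<integral>\<^sup>+y\<in>ball x r \<inter> Y. f y \<partial>lebesgue) \<le> ennreal (2 powr q) *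
      ((\<integral>\<^sup>+y\<in>ball x r \<inter> Y. ennreal (GQ {..<m} (u y) (evalQ (Rf x) y) powr q) \<partial>lebesgue) +
       (\<integral>\<^sup>+y\<in>ball x r \<inter> Y. ennreal (GQ {..<m} (v y) (evalQ (Rf x) y) powr q) \<partial>lebesgue))"
      unfolding f_def
    proof (rule nn_integral_powr_triangle[OF q sub(1) measurable_dist[OF Rf[OF xX] sub(2,1)]])
      show "(\<lambda>y. GQ {..<m} (v y) (evalQ (Rf x) y)) \<in> borel_measurable (lebesgue_on (ball x r \<inter> Y))"
      proof (rule measurable_GQ[OF _ _ _ _ sub(1)])
        show "measurableQ Q {..<m} (ball x r \<inter> Y) v"
          using Y sub by (intro measurableQ_subset[OF mv]) auto
      qed (use AQ measurableQ_evalQ[OF Rf[OF xX] sub(1)] in auto)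
      fix z assume "z \<in> ball x r \<inter> Y"
      then have z: "z \<in> Y" by simp
      show "0 \<le> GQ {..<m} (u z) (evalQ (Rf x) z) \<and> 0 \<le> GQ {..<m} (v z) (evalQ (Rf x) z) \<and> 0 \<le> GQ {..<m} (u z) (v z) \<and>
        GQ {..<m} (u z) (v z) \<le> GQ {..<m} (u z) (evalQ (Rf x) z) + GQ {..<m} (v z) (evalQ (Rf x) z)"
        using GQ_triangle_AQ[OF AQ(1,2,3)[OF z]] GQ_commute_AQ[OF AQ(2,3)[OF z]] GQ_nonneg_AQ AQ[OF z] by auto
    qed
    also have "\<dots> \<le> ennreal (2 powr q) * (ennreal (M * r powr (real CARD('n) + \<gamma>)) + ennreal (W powr q * V * r powr (real CARD('n) + \<gamma>)))"
    proof (intro mult_left_mono add_mono)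
      have "(\<integral>\<^sup>+y\<in>ball x r \<inter> Y. ennreal (GQ {..<m} (u y) (evalQ (Rf x) y) powr q) \<partial>lebesgue) \<le> excess m q \<Omega> u (evalQ (Rf x)) x r"
        unfolding excess_def using Y(2) by (intro nn_integral_mono) (auto simp: indicator_def)
      also have "\<dots> \<le> ennreal (M * r powr (real CARD('n) + \<gamma>))"
        using dec[OF xX] r S by (simp add: decays_def \<gamma>_def add.assoc)
      finally show "(\<integral>\<^sup>+y\<in>ball x r \<inter> Y. ennreal (GQ {..<m} (u y) (evalQ (Rf x) y) powr q) \<partial>lebesgue) \<le> ennreal (M * r powr (real CARD('n) + \<gamma>))" .
      have "(\<integral>\<^sup>+y\<in>ball x r \<inter> Y. ennreal (GQ {..<m} (v y) (evalQ (Rf x) y) powr q) \<partial>lebesgue)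
        \<le> (\<integral>\<^sup>+y. ennreal ((W * r powr (real k + \<mu>)) powr q) * indicator (ball x r) y \<partial>lebesgue)"
      proof (rule nn_integral_mono)
        fix y :: "real^'n"
        have "GQ {..<m} (v y) (evalQ (Rf x) y) powr q \<le> (W * r powr (real k + \<mu>)) powr q" if y: "y \<in> ball x r" "y \<in> Y"
        proof -
          have "GQ {..<m} (v y) (evalQ (Rf x) y) \<le> W * dist x y powr (real k + \<mu>)"
            unfolding v_def W_def using y r Y by (intro value_compare xX) auto
          also have "\<dots> \<le> W * r powr (real k + \<mu>)"
            using W y \<mu> by (intro mult_left_mono powr_mono2) auto
          finally show ?thesis
            using GQ_nonneg_AQ[OF AQ(3,2)[OF y(2)]] q by (intro powr_mono2) auto
        qed
        then show "ennreal (GQ {..<m} (v y) (evalQ (Rf x) y) powr q) * indicator (ball x r \<inter> Y) y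
          \<le> ennreal ((W * r powr (real k + \<mu>)) powr q) * indicator (ball x r) y"
          by (auto simp: indicator_def intro!: ennreal_leI)
      qed
      also have "\<dots> = ennreal ((W * r powr (real k + \<mu>)) powr q) * ennreal (V * r ^ CARD('n))"
        using emeasure_ball_scaled[of r x] r by (simp add: nn_integral_cmult_indicator V_def)
      also have "\<dots> = ennreal ((W * r powr (real k + \<mu>)) powr q * (V * r ^ CARD('n)))"
        by (simp add: ennreal_mult')
      also have "(W * r powr (real k + \<mu>)) powr q * (V * r ^ CARD('n)) = W powr q * V * r powr (real CARD('n) + \<gamma>)"
      proof -
        have "(W * r powr (real k + \<mu>)) powr q * (V * r ^ CARD('n)) =
          W powr q * V * (r powr real CARD('n) * r powr ((real k + \<mu>) * q))"
          using r by (simp add: powr_mult powr_powr powr_realpow)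
        also have "\<dots> = W powr q * V * r powr (real CARD('n) + \<gamma>)"
          unfolding powr_add[symmetric] \<gamma>_def by (simp add: algebra_simps)
        finally show ?thesis .
      qed
      finally show "(\<integral>\<^sup>+y\<in>ball x r \<inter> Y. ennreal (GQ {..<m} (v y) (evalQ (Rf x) y) powr q) \<partial>lebesgue)
        \<le> ennreal (W powr q * V * r powr (real CARD('n) + \<gamma>))" .
    qed simp
    also have "\<dots> = ennreal (2 powr q * (M + W powr q * V) * r powr (real CARD('n) + \<gamma>))"
      using M V by (subst ennreal_plus[symmetric]) (auto simp: ennreal_mult'[symmetric] algebra_simps simp del: ennreal_plus)
    finally show "(\<integral>\<^sup>+y\<in>ball x r \<inter> Y. f y \<partial>lebesgue) \<le> ennreal (2 powr q * (M + W powr q * V) * r powr (real CARD('n) + \<gamma>))" .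
  qed
  then show ?thesis
  proof eventually_elim
    case (elim x)
    show ?case
    proof
      assume x: "x \<in> Y"
      have AQ: "u x \<in> AQ Q {..<m}" "v x \<in> AQ Q {..<m}" using x Y u vAQ by auto
      have "GQ {..<m} (u x) (v x) powr q \<le> 0" using elim x by (simp add: f_def)
      then have "GQ {..<m} (u x) (v x) = 0" by (simp add: powr_eq_0_iff order_antisym)
      then have "u x = v x" using AQ by (intro GQ_eq_0_imp_eq[of "{..<m}"]) auto
      then show "evalQ (Rf x) x = u x" by (simp add: v_def)
    qed
  qed
qed

text \<open>The conclusion for one component, with a constant that is uniform in the sets, in the functions and
in \<open>\<mu>\<close>; the size of \<open>u\<close> enters only through \<open>M + F\<close>, a multiple of \<open>K\<^sup>q\<close>.\<close>

definition regularity_bound ::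
  "'n::finite itself \<Rightarrow> nat \<Rightarrow> nat \<Rightarrow> nat \<Rightarrow> real \<Rightarrow> real \<Rightarrow> real \<Rightarrow> real \<Rightarrow> real \<Rightarrow> real \<Rightarrow> bool" where
  "regularity_bound _ k Q m q c b1 b2 R0 C \<longleftrightarrow> (\<forall>(\<Omega> :: (real^'n) set) u \<Omega>' \<Gamma> \<Gamma>' L0 L1 M F \<mu> e.
    stratified_decay Q m \<Omega> u k q c b1 b2 R0 \<Omega>' \<Gamma> \<Gamma>' L0 L1 M F \<mu> e \<longrightarrow>
    (\<exists>v U. (AE x in lebesgue. x \<in> \<Omega>' \<inter> \<Omega> \<longrightarrow> v x = u x) \<and> holderQ Q m k \<mu> \<Omega>' v U \<and>
       holder_normQ m k \<mu> \<Omega>' U \<le> C * (M + F) powr (1 / q)))"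

lemma regularity_of_stratified_decay:
  assumes c: "0 < c" and q: "1 \<le> q" and b1: "0 < b1" and b2: "0 < b2" and R0: "0 < R0" "R0 \<le> 1"
  shows "\<exists>C\<ge>1. regularity_bound TYPE('n::finite) k Q m q c b1 b2 R0 C"
proof -
  define S where "S = R0 / 32"
  have S: "0 < S" "S \<le> 1" "S \<le> R0" using R0 by (auto simp: S_def)
  obtain C1 where C1: "C1 \<ge> 1" and decay0: "\<forall>(\<Omega> :: (real^'n::finite) set) u \<Omega>' \<Gamma> \<Gamma>' L0 L1 M F \<mu> e x.
    stratified_decay Q m \<Omega> u k q c b1 b2 R0 \<Omega>' \<Gamma> \<Gamma>' L0 L1 M F \<mu> e \<longrightarrow> x \<in> closure \<Omega>' \<longrightarrow>
    (\<exists>R. polytuple k Q m R \<and> decays m q \<Omega> u (evalQ R) x (C1 * (M + F)) (R0 / 32) e)"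
    using decay_on_closure[OF c q b1 b2 R0, of Q m k, where ?'n = 'n] by (elim exE conjE)
  obtain C2 where C2: "C2 \<ge> 1" and jets: "\<forall>(\<Omega> :: (real^'n::finite) set) u X Rf M \<mu>.
    measurable_multifun Q m \<Omega> u \<longrightarrow> X \<noteq> {} \<longrightarrow> 0 < \<mu> \<longrightarrow> \<mu> < 1 \<longrightarrow> 0 < M \<longrightarrow>
    (\<forall>x\<in>X. polytuple k Q m (Rf x) \<and>
       decays m q \<Omega> u (evalQ (Rf x)) x M S (real CARD('n) + real k * q + q * \<mu>)) \<longrightarrow>
    (\<forall>x\<in>X. \<forall>\<rho>. 0 < \<rho> \<longrightarrow> \<rho> \<le> S \<longrightarrow> c * \<rho> ^ CARD('n) \<le> measure lebesgue (ball x \<rho> \<inter> \<Omega>)) \<longrightarrow>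
    (\<forall>x\<in>X. (\<integral>\<^sup>+y\<in>ball x S \<inter> \<Omega>. ennreal (absQ {..<m} (u y) powr q) \<partial>lebesgue) \<le> ennreal M) \<longrightarrow>
    jet_field k Q m X Rf (C2 * M powr (1 / q)) S \<mu>"
    using jets_of_decaying_approximations[OF c q S(1,2), of Q m k, where ?'n = 'n] by (elim exE conjE)
  define wt where "wt = (\<lambda>j. real (Q * card (tidx m j :: (nat \<times> 'n list) set)))"
  define Wt where "Wt = (\<Sum>j\<le>k. wt j) + wt k * (2 ^ (k + 1) + 8 / S)"
  have Wt: "0 \<le> Wt" using S by (auto simp: Wt_def wt_def intro!: add_nonneg_nonneg sum_nonneg)
  define C where "C = Wt * C2 * C1 powr (1 / q) + 1"
  show ?thesis
  proof (rule exI[of _ C], unfold regularity_bound_def, intro conjI allI impI)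
    show "1 \<le> C" using Wt C2 by (simp add: C_def)
  next
    fix \<Omega> \<Omega>' :: "(real^'n) set" and u \<Gamma> \<Gamma>' L0 L1 and M F \<mu> e :: real
    assume sd: "stratified_decay Q m \<Omega> u k q c b1 b2 R0 \<Omega>' \<Gamma> \<Gamma>' L0 L1 M F \<mu> e"
    interpret sd: stratified_decay Q m \<Omega> u k q c b1 b2 R0 \<Omega>' \<Gamma> \<Gamma>' L0 L1 M F \<mu> e by (rule sd)
    have mm: "measurable_multifun Q m \<Omega> u" by unfold_locales
    define M1 where "M1 = C1 * (M + F)"
    have M1: "0 < M1" "M \<le> M1"
    proof -
      have "1 * (M + F) \<le> M1" unfolding M1_def using C1 sd.M sd.F by (intro mult_right_mono) auto
      then show "0 < M1" "M \<le> M1" using sd.M sd.F by auto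
    qed
    have "\<forall>x\<in>closure \<Omega>'. \<exists>R. polytuple k Q m R \<and> decays m q \<Omega> u (evalQ R) x M1 S e"
      using decay0[rule_format, OF sd] by (simp add: M1_def S_def)
    then obtain Rf where Rf: "\<And>x. x \<in> closure \<Omega>' \<Longrightarrow> polytuple k Q m (Rf x) \<and> decays m q \<Omega> u (evalQ (Rf x)) x M1 S e"
      by metis
    have cl: "close_to \<Omega> \<Omega>' (2 * R0) x" if "x \<in> closure \<Omega>'" for x
      using that R0 by (intro sd.close_to_closure) auto
    have jf: "jet_field k Q m (closure \<Omega>') Rf (C2 * M1 powr (1 / q)) S \<mu>"
    proof (rule jets[rule_format, OF mm _ sd.\<mu> M1(1)])
      show "closure \<Omega>' \<noteq> {}" using sd.\<Omega>' by simp
      show "polytuple k Q m (Rf x) \<and> decays m q \<Omega> u (evalQ (Rf x)) x M1 S (real CARD('n) + real k * q + q * \<mu>)"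
        if "x \<in> closure \<Omega>'" for x using Rf[OF that] by (simp add: sd.e)
      show "c * \<rho> ^ CARD('n) \<le> measure lebesgue (ball x \<rho> \<inter> \<Omega>)" if "x \<in> closure \<Omega>'" "0 < \<rho>" "\<rho> \<le> S" for x \<rho>
        using sd.density cl that S by simp
      fix x assume x: "x \<in> closure \<Omega>'"
      have "(\<integral>\<^sup>+y\<in>ball x S \<inter> \<Omega>. ennreal (absQ {..<m} (u y) powr q) \<partial>lebesgue) \<le> ennreal M"
        using sd.integral_bound[OF cl[OF x]] S by blast
      also have "\<dots> \<le> ennreal M1" using M1 by (intro ennreal_leI)
      finally show "(\<integral>\<^sup>+y\<in>ball x S \<inter> \<Omega>. ennreal (absQ {..<m} (u y) powr q) \<partial>lebesgue) \<le> ennreal M1" .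
    qed
    interpret jf: jet_field k Q m "closure \<Omega>'" Rf "C2 * M1 powr (1 / q)" S \<mu> by (rule jf)
    have "AE x in lebesgue. x \<in> \<Omega>' \<inter> \<Omega> \<longrightarrow> evalQ (Rf x) x = u x"
    proof (rule field_values_eq_AE[OF mm jf q, of M1])
      show "decays m q \<Omega> u (evalQ (Rf x)) x M1 S (real CARD('n) + real k * q + q * \<mu>)" if "x \<in> closure \<Omega>'" for x
        using Rf[OF that] by (simp add: sd.e)
      show "\<Omega>' \<inter> \<Omega> \<subseteq> closure \<Omega>'" using closure_subset by blast
      show "bounded (\<Omega>' \<inter> \<Omega>)" using sd.\<Omega>' by (simp add: bounded_Int)
      show "\<Omega>' \<inter> \<Omega> \<in> sets lebesgue" using sd.\<Omega>' sd.\<Omega> by (intro sets.Int) (auto intro!: borel_open)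
    qed (use M1 in auto)
    moreover have "holderQ Q m k \<mu> \<Omega>' (\<lambda>x. evalQ (Rf x) x) jf.U" by (rule jf.U_holderQ[OF refl])
    moreover have "holder_normQ m k \<mu> \<Omega>' jf.U \<le> C * (M + F) powr (1 / q)"
    proof -
      have "holder_normQ m k \<mu> \<Omega>' jf.U \<le> Wt * (C2 * M1 powr (1 / q))"
        using jf.U_norm[OF refl] by (simp add: Wt_def wt_def jf.wt_def jf.hconst_def)
      also have "M1 powr (1 / q) = C1 powr (1 / q) * (M + F) powr (1 / q)"
        by (simp add: M1_def powr_mult)
      also have "Wt * (C2 * (C1 powr (1 / q) * (M + F) powr (1 / q))) \<le> C * (M + F) powr (1 / q)"
        by (simp add: C_def distrib_right mult.assoc)
      finally show ?thesis .
    qed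
    ultimately show "\<exists>v U. (AE x in lebesgue. x \<in> \<Omega>' \<inter> \<Omega> \<longrightarrow> v x = u x) \<and> holderQ Q m k \<mu> \<Omega>' v U \<and>
       holder_normQ m k \<mu> \<Omega>' U \<le> C * (M + F) powr (1 / q)"
      by (intro exI[of _ "\<lambda>x. evalQ (Rf x) x"] exI[of _ jf.U] conjI)
  qed
qed

section \<open>The estimate under the three decay hypotheses\<close>

lemma nested_neighbourhood:
  fixes \<Omega> \<Omega>' \<Omega>'' :: "(real^'n::finite) set"
  assumes "edist_sets \<Omega>' (closure \<Omega> - \<Omega>'') = d" "ennreal r \<le> d" "y \<in> closure \<Omega>" "w \<in> \<Omega>'" "dist y w < r"
  shows "y \<in> \<Omega>''"
proof (rule ccontr)
  assume "y \<notin> \<Omega>''"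
  then have "(w, y) \<in> \<Omega>' \<times> (closure \<Omega> - \<Omega>'')" using assms by simp
  then have "edist_sets \<Omega>' (closure \<Omega> - \<Omega>'') \<le> (case (w, y) of (x, y) \<Rightarrow> ennreal (dist x y))"
    unfolding edist_sets_def by (rule INF_lower)
  then have "d \<le> ennreal (dist w y)" using assms(1) by simp
  with assms(2) have "ennreal r \<le> ennreal (dist w y)" by (rule order_trans)
  then have "r \<le> dist w y" by (simp add: ennreal_le_iff)
  then show False using assms(5) by (simp add: dist_commute)
qed

lemma nested_lebesgue:
  assumes "openin (top_of_set (closure \<Omega>)) (S :: (real^'n::finite) set)"
  shows "S \<in> sets lebesgue"
proof -
  obtain T where "open T" "S = closure \<Omega> \<inter> T" using assms by (auto simp: openin_open)
  then show ?thesis by (auto intro!: sets.Int borel_open borel_closed)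
qed

theorem lemma2p9:
  fixes N k :: nat and Q m :: "nat \<Rightarrow> nat"
    and q A \<beta>0 \<epsilon> :: real and b bt :: "nat \<Rightarrow> real" and d :: ennreal
  assumes "\<And>i. i \<in> {1..N} \<Longrightarrow> Q i \<ge> 1 \<and> m i \<ge> 1"
    and "1 \<le> q" and "0 < A" and "0 < \<beta>0"
    and "\<And>i. i \<in> {1..N} \<Longrightarrow> 0 < b i \<and> 0 < bt i"
    and "0 < \<epsilon>" and "\<epsilon> < 1/4" and "0 < d"
  shows "\<exists>lam :: real \<Rightarrow> real. (\<forall>\<mu>\<in>{0<..<1}. lam \<mu> \<in> {0<..<1}) \<and>
    (\<forall>\<delta>>0. \<exists>C>0. \<forall>\<mu>\<in>{0<..<1}.
     \<forall>(\<Omega> :: (real^'n::finite) set) \<Omega>' \<Omega>'' \<Gamma> (\<Gamma>i :: nat \<Rightarrow> (real^'n) set)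
      (u :: nat \<Rightarrow> 'n mvfun) (\<beta> :: real)
      (\<PP>0 :: (nat \<times> nat \<times> 'n mvfun) set) (\<PP>i :: nat \<Rightarrow> (nat \<times> nat \<times> 'n mvfun) set)
      (\<PP> :: (nat \<times> nat \<times> 'n mvfun) set).
      open \<Omega> \<and> convex \<Omega> \<and> \<Omega> \<noteq> {} \<and>
      nested \<Omega>' \<Omega>'' \<Omega> \<and> \<Omega>' \<noteq> {} \<and> convex \<Omega>' \<and> weighted A \<Omega>' \<and>
      edist_sets \<Omega>' (closure \<Omega> - \<Omega>'') = d \<and> \<delta> \<le> diameter \<Omega>' \<and>
      (\<forall>i\<in>{1..N}. (\<forall>x\<in>\<Omega>. u i x \<in> AQ (Q i) {..<m i}) \<and>
         measurableQ (Q i) {..<m i} \<Omega> (u i) \<and>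
         (\<integral>\<^sup>+ x \<in> \<Omega>'' \<inter> \<Omega>. ennreal (absQ {..<m i} (u i x) powr q) \<partial>lebesgue) < \<infinity>) \<and>
      \<Gamma> \<subseteq> closure \<Omega> \<and> closed \<Gamma> \<and> \<Gamma> \<noteq> {} \<and>
      (\<forall>i\<in>{1..N}. \<Gamma>i i \<subseteq> closure \<Omega> - \<Gamma> \<and> closure (\<Gamma>i i) \<subseteq> \<Gamma> \<union> \<Gamma>i i) \<and>
      0 < \<beta> \<and>
      \<PP>0 \<subseteq> multipolys k \<and> (\<forall>i\<in>{1..N}. \<PP>i i \<subseteq> multipolys k) \<and> \<PP> \<subseteq> multipolys k \<and>
      (\<forall>i\<in>{1..N}. \<exists>P. (Q i, m i, P) \<in> \<PP>0) \<and>
      (\<forall>(Q', m', P)\<in>\<PP>0. \<forall>x\<in>\<Omega>. absQ {..<m'} (P x) \<le> \<beta>) \<and>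
      (\<comment> \<open>(I)\<close>
       \<forall>x0 \<in> \<Gamma> \<inter> closure \<Omega>''. \<exists>P :: nat \<Rightarrow> 'n mvfun.
         (\<forall>i\<in>{1..N}. (Q i, m i, P i) \<in> \<PP>0) \<and>
         (\<forall>\<sigma> \<rho>. 0 < \<sigma> \<and> \<sigma> \<le> \<rho>/2 \<and> \<rho>/2 \<le> \<epsilon>/2 \<longrightarrow>
            scaled_int \<Omega> k q x0 \<sigma> (\<lambda>x. \<Sum>i=1..N. GQ {..<m i} (u i x) (P i x) powr q)
            \<le> ennreal (\<beta>0 * (\<sigma>/\<rho>) powr (q * \<mu>)) *
               scaled_int \<Omega> k q x0 \<rho> (\<lambda>x. \<Sum>i=1..N. GQ {..<m i} (u i x) (P i x) powr q))) \<and>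
      (\<comment> \<open>(II)\<close>
       \<forall>i\<in>{1..N}. \<forall>x1 \<in> closure \<Omega>'' \<inter> \<Gamma>i i - \<Gamma>. \<exists>P1. (Q i, m i, P1) \<in> \<PP>i i \<and>
         (\<forall>P. (Q i, m i, P) \<in> \<PP>0 \<longrightarrow>
           (\<forall>\<sigma> \<rho>. 0 < \<sigma> \<and> \<sigma> \<le> \<rho>/2 \<and> \<rho>/2 \<le> min (1/4) (infdist x1 \<Gamma>) / 2 \<longrightarrow>
              scaled_int \<Omega> k q x1 \<sigma> (\<lambda>x. GQ {..<m i} (u i x) (P1 x) powr q)
              \<le> ennreal (b i * (\<sigma>/\<rho>) powr (q * \<mu>)) *
                 scaled_int \<Omega> k q x1 \<rho> (\<lambda>x. GQ {..<m i} (u i x) (P x) powr q)))) \<and>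
      (\<comment> \<open>(III)\<close>
       \<forall>i\<in>{1..N}. \<forall>x2 \<in> closure \<Omega>'' - (\<Gamma> \<union> \<Gamma>i i). \<exists>P2. (Q i, m i, P2) \<in> \<PP> \<and>
         (\<forall>P. (Q i, m i, P) \<in> \<PP>0 \<union> \<PP>i i \<longrightarrow>
           (\<forall>\<sigma> \<rho>. 0 < \<sigma> \<and> \<sigma> \<le> \<rho>/2 \<and> \<rho>/2 \<le> min (1/4) (infdist x2 (\<Gamma> \<union> \<Gamma>i i)) / 2 \<longrightarrow>
              scaled_int \<Omega> k q x2 \<sigma> (\<lambda>x. GQ {..<m i} (u i x) (P2 x) powr q)
              \<le> ennreal (bt i * (\<sigma>/\<rho>) powr (q * \<mu>)) *
                 scaled_int \<Omega> k q x2 \<rho> (\<lambda>x. GQ {..<m i} (u i x) (P x) powr q))))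
      \<longrightarrow>
      (\<forall>i\<in>{1..N}. \<exists>v U.
         (AE x in lebesgue. x \<in> \<Omega>' \<inter> \<Omega> \<longrightarrow> v x = u i x) \<and>
         holderQ (Q i) (m i) k (lam \<mu>) \<Omega>' v U \<and>
         holder_normQ (m i) k (lam \<mu>) \<Omega>' U
         \<le> C * (\<beta> powr q + enn2real (\<integral>\<^sup>+ x \<in> \<Omega>'' \<inter> \<Omega>.
                  ennreal (\<Sum>i=1..N. absQ {..<m i} (u i x) powr q) \<partial>lebesgue)) powr (1/q)))"
proof -
  note q = assms(2) and A = assms(3) and \<beta>0 = assms(4) and bb = assms(5) and \<epsilon> = assms(6,7) and d = assms(8)
  \<comment> \<open>The distance of the domains may be infinite; only a finite lower bound for it is used.\<close>
  define d' where "d' = enn2real (min 1 d)"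
  have d': "ennreal d' = min 1 d" unfolding d'_def by (intro ennreal_enn2real) (simp add: min_less_iff_disj)
  have d'0: "0 < d'" using d unfolding d'_def by (simp add: enn2real_positive_iff min_less_iff_disj)
  have d'd: "ennreal d' \<le> d" unfolding d' by simp
  define c where "c = A / 2 ^ CARD('n)"
  have c: "0 < c" using A by (simp add: c_def)
  define V where "V = measure lebesgue (ball (0 :: real^'n) 1)"
  define E where "E = real CARD('n) + real k * q + q"
  define F0 where "F0 = 2 powr q * (1 + V)"
  have F0: "1 \<le> F0"
  proof -
    have "1 * 1 \<le> 2 powr q * (1 + V)"
      using q by (intro mult_mono) (auto simp: V_def ge_one_powr_ge_zero)
    then show ?thesis by (simp add: F0_def)
  qed
  show ?thesis
    \<comment> \<open>The Hoelder exponent is \<mu>.\<close>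
    apply (rule exI[of _ "\<lambda>\<mu>. \<mu>"], intro conjI ballI allI impI)
     apply assumption
  subgoal premises prems for \<delta>
  proof -
    have \<delta>: "0 < \<delta>" by (rule prems)
    \<comment> \<open>Balls of radius R0 about points within 2 R0 of \<Omega>' stay in \<Omega>'' and below the radius \<epsilon> of (I);
      2 R0 does not exceed the diameter of \<Omega>'.\<close>
    define R0 where "R0 = min \<epsilon> (min (d' / 8) (\<delta> / 2))"
    have R0: "0 < R0" "R0 \<le> 1" "R0 \<le> \<epsilon>" "R0 \<le> 1 / 4" "3 * R0 < d'" "2 * R0 \<le> \<delta>"
      using \<epsilon> d'0 \<delta> by (auto simp: R0_def min_def)
    \<comment> \<open>The decay constant on \<Gamma>, in units of K^q: hypothesis (I) from radius R0, where N excesses add up.\<close>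
    define M0 where "M0 = \<beta>0 * R0 powr - E * (real N * F0) + 1"
    have M0: "1 \<le> M0" using \<beta>0 F0 by (simp add: M0_def)
    have "\<forall>i\<in>{1..N}. \<exists>K. 1 \<le> K \<and> regularity_bound TYPE('n) k (Q i) (m i) q c (b i) (bt i) R0 K"
      using bb by (intro ballI regularity_of_stratified_decay c q R0) auto
    from bchoice[OF this] obtain Cf where
      Cf: "\<forall>i\<in>{1..N}. 1 \<le> Cf i \<and> regularity_bound TYPE('n) k (Q i) (m i) q c (b i) (bt i) R0 (Cf i)" ..
    define C where "C = (\<Sum>i=1..N. Cf i) * (M0 + F0) powr (1 / q) + 1"
    have C: "0 < C" "\<And>i. i \<in> {1..N} \<Longrightarrow> Cf i * (M0 + F0) powr (1 / q) \<le> C"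
    proof -
      have nn: "0 \<le> Cf i" if "i \<in> {1..N}" for i using bspec[OF Cf that] by simp
      show "0 < C" unfolding C_def using nn by (intro add_nonneg_pos mult_nonneg_nonneg sum_nonneg) auto
      fix i assume i: "i \<in> {1..N}"
      have "Cf i \<le> (\<Sum>i=1..N. Cf i)" using nn i by (intro member_le_sum) auto
      then have "Cf i * (M0 + F0) powr (1 / q) \<le> (\<Sum>i=1..N. Cf i) * (M0 + F0) powr (1 / q)"
        by (intro mult_right_mono) auto
      then show "Cf i * (M0 + F0) powr (1 / q) \<le> C" by (simp add: C_def)
    qed
    show ?thesis
    proof (rule exI[of _ C], rule conjI[OF C(1)], intro ballI allI impI, elim conjE)
      fix \<mu> :: real and \<Omega> \<Omega>' \<Omega>'' \<Gamma> :: "(real^'n) set" and \<Gamma>i and u :: "nat \<Rightarrow> 'n mvfun" and \<beta> :: real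
        and \<PP>0 :: "(nat \<times> nat \<times> 'n mvfun) set" and \<PP>i and \<PP> i
      assume \<mu>01: "\<mu> \<in> {0<..<1}" and i: "i \<in> {1..N}"
        and \<Omega>: "open \<Omega>" "convex \<Omega>" "\<Omega> \<noteq> {}" and nest: "nested \<Omega>' \<Omega>'' \<Omega>" and \<Omega>'0: "\<Omega>' \<noteq> {}" and "convex \<Omega>'"
        and wA: "weighted A \<Omega>'" and ed: "edist_sets \<Omega>' (closure \<Omega> - \<Omega>'') = d" and diam: "\<delta> \<le> diameter \<Omega>'"
        and u: "\<forall>i\<in>{1..N}. (\<forall>x\<in>\<Omega>. u i x \<in> AQ (Q i) {..<m i}) \<and> measurableQ (Q i) {..<m i} \<Omega> (u i) \<and>
         (\<integral>\<^sup>+ x \<in> \<Omega>'' \<inter> \<Omega>. ennreal (absQ {..<m i} (u i x) powr q) \<partial>lebesgue) < \<infinity>"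
        and \<Gamma>: "\<Gamma> \<subseteq> closure \<Omega>" "closed \<Gamma>" "\<Gamma> \<noteq> {}"
        and \<Gamma>i: "\<forall>i\<in>{1..N}. \<Gamma>i i \<subseteq> closure \<Omega> - \<Gamma> \<and> closure (\<Gamma>i i) \<subseteq> \<Gamma> \<union> \<Gamma>i i"
        and \<beta>: "0 < \<beta>" and P0: "\<PP>0 \<subseteq> multipolys k" and Pi: "\<forall>i\<in>{1..N}. \<PP>i i \<subseteq> multipolys k" and PP: "\<PP> \<subseteq> multipolys k"
        and Pex: "\<forall>i\<in>{1..N}. \<exists>P. (Q i, m i, P) \<in> \<PP>0"
        and Pbd: "\<forall>(Q', m', P)\<in>\<PP>0. \<forall>x\<in>\<Omega>. absQ {..<m'} (P x) \<le> \<beta>"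
        and I: "\<forall>x0 \<in> \<Gamma> \<inter> closure \<Omega>''. \<exists>P :: nat \<Rightarrow> 'n mvfun.
         (\<forall>i\<in>{1..N}. (Q i, m i, P i) \<in> \<PP>0) \<and>
         (\<forall>\<sigma> \<rho>. 0 < \<sigma> \<and> \<sigma> \<le> \<rho>/2 \<and> \<rho>/2 \<le> \<epsilon>/2 \<longrightarrow>
            scaled_int \<Omega> k q x0 \<sigma> (\<lambda>x. \<Sum>i=1..N. GQ {..<m i} (u i x) (P i x) powr q)
            \<le> ennreal (\<beta>0 * (\<sigma>/\<rho>) powr (q * \<mu>)) *
               scaled_int \<Omega> k q x0 \<rho> (\<lambda>x. \<Sum>i=1..N. GQ {..<m i} (u i x) (P i x) powr q))"
        and II: "\<forall>i\<in>{1..N}. \<forall>x1 \<in> closure \<Omega>'' \<inter> \<Gamma>i i - \<Gamma>. \<exists>P1. (Q i, m i, P1) \<in> \<PP>i i \<and>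
         (\<forall>P. (Q i, m i, P) \<in> \<PP>0 \<longrightarrow>
           (\<forall>\<sigma> \<rho>. 0 < \<sigma> \<and> \<sigma> \<le> \<rho>/2 \<and> \<rho>/2 \<le> min (1/4) (infdist x1 \<Gamma>) / 2 \<longrightarrow>
              scaled_int \<Omega> k q x1 \<sigma> (\<lambda>x. GQ {..<m i} (u i x) (P1 x) powr q)
              \<le> ennreal (b i * (\<sigma>/\<rho>) powr (q * \<mu>)) *
                 scaled_int \<Omega> k q x1 \<rho> (\<lambda>x. GQ {..<m i} (u i x) (P x) powr q)))"
        and III: "\<forall>i\<in>{1..N}. \<forall>x2 \<in> closure \<Omega>'' - (\<Gamma> \<union> \<Gamma>i i). \<exists>P2. (Q i, m i, P2) \<in> \<PP> \<and>
         (\<forall>P. (Q i, m i, P) \<in> \<PP>0 \<union> \<PP>i i \<longrightarrow>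
           (\<forall>\<sigma> \<rho>. 0 < \<sigma> \<and> \<sigma> \<le> \<rho>/2 \<and> \<rho>/2 \<le> min (1/4) (infdist x2 (\<Gamma> \<union> \<Gamma>i i)) / 2 \<longrightarrow>
              scaled_int \<Omega> k q x2 \<sigma> (\<lambda>x. GQ {..<m i} (u i x) (P2 x) powr q)
              \<le> ennreal (bt i * (\<sigma>/\<rho>) powr (q * \<mu>)) *
                 scaled_int \<Omega> k q x2 \<rho> (\<lambda>x. GQ {..<m i} (u i x) (P x) powr q)))"
      have \<mu>: "0 < \<mu>" "\<mu> < 1" using \<mu>01 by auto
      define e where "e = real CARD('n) + real k * q + q * \<mu>"
      have eE: "e \<le> E" using \<mu> q by (simp add: e_def E_def)
      define J where "J = enn2real (\<integral>\<^sup>+ x \<in> \<Omega>'' \<inter> \<Omega>. ennreal (\<Sum>i=1..N. absQ {..<m i} (u i x) powr q) \<partial>lebesgue)"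
      \<comment> \<open>The quantity K^q of the estimate.\<close>
      define KK where "KK = \<beta> powr q + J"
      have J0: "0 \<le> J" by (simp add: J_def)
      have KK: "0 < KK" "J \<le> KK" using \<beta> J0 by (auto simp: KK_def intro: add_pos_nonneg)
      have op: "openin (top_of_set (closure \<Omega>)) \<Omega>'" "openin (top_of_set (closure \<Omega>)) \<Omega>''" using nest unfolding nested_def by blast+
      have sub': "\<Omega>' \<subseteq> closure \<Omega>" using op(1) by (rule openin_imp_subset)
      have \<Omega>'m: "\<Omega>' \<in> sets lebesgue" by (rule nested_lebesgue[OF op(1)])
      have Om: "\<Omega> \<in> sets lebesgue" using \<Omega> by (auto intro!: borel_open)
      have \<Omega>''m: "\<Omega>'' \<inter> \<Omega> \<in> sets lebesgue" by (intro sets.Int nested_lebesgue[OF op(2)] Om)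
      have bd': "bounded \<Omega>'" using wA by (simp add: weighted_def)
      have mm: "measurable_multifun (Q j) (m j) \<Omega> (u j)" if "j \<in> {1..N}" for j
        using u that \<Omega> by unfold_locales auto
      \<comment> \<open>Measurability is what allows the integral of the sum to be split, so that J is a genuine bound.\<close>
      have absm: "(\<lambda>x. ennreal (absQ {..<m j} (u j x) powr q) * indicator (\<Omega>'' \<inter> \<Omega>) x) \<in> borel_measurable lebesgue"
        if j: "j \<in> {1..N}" for j
      proof -
        interpret mj: measurable_multifun "Q j" "m j" \<Omega> "u j" by (rule mm[OF j])
        have "(\<lambda>y. ennreal (GQ {..<m j} (u j y) (evalQ (zero_tuple (Q j)) y) powr q) * indicator (\<Omega>'' \<inter> \<Omega>) y) \<in> borel_measurable lebesgue"
          by (rule borel_measurable_powr_indicator[OF mj.measurable_dist[OF polytuple_zero _ \<Omega>''m] \<Omega>''m]) simp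
        moreover have "ennreal (GQ {..<m j} (u j y) (evalQ (zero_tuple (Q j)) y) powr q) * indicator (\<Omega>'' \<inter> \<Omega>) y =
          ennreal (absQ {..<m j} (u j y) powr q) * indicator (\<Omega>'' \<inter> \<Omega>) y" for y
          using absQ_eq_GQ_zero[OF mj.u, of y y] by (auto simp: indicator_def)
        ultimately show ?thesis by simp
      qed
      have Jint: "(\<integral>\<^sup>+ x \<in> \<Omega>'' \<inter> \<Omega>. ennreal (\<Sum>i=1..N. absQ {..<m i} (u i x) powr q) \<partial>lebesgue) = ennreal J"
      proof -
        have "(\<integral>\<^sup>+ x \<in> \<Omega>'' \<inter> \<Omega>. ennreal (\<Sum>i=1..N. absQ {..<m i} (u i x) powr q) \<partial>lebesgue)
          = (\<integral>\<^sup>+ x. (\<Sum>i=1..N. ennreal (absQ {..<m i} (u i x) powr q) * indicator (\<Omega>'' \<inter> \<Omega>) x) \<partial>lebesgue)"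
          by (simp add: sum_distrib_right flip: sum_ennreal)
        also have "\<dots> = (\<Sum>i=1..N. \<integral>\<^sup>+ x \<in> \<Omega>'' \<inter> \<Omega>. ennreal (absQ {..<m i} (u i x) powr q) \<partial>lebesgue)"
          by (intro nn_integral_sum absm)
        also have "\<dots> < \<infinity>" using u by (simp add: less_top sum_Pinfty)
        finally show ?thesis unfolding J_def by simp
      qed
      have inO'': "y \<in> \<Omega>''" if "y \<in> closure \<Omega>" "w \<in> \<Omega>'" "dist y w < 3 * R0" for y w
        using nested_neighbourhood[OF ed d'd that(1,2)] that(3) R0 by simp
      have cl'': "z \<in> closure \<Omega>''" if z: "close_to \<Omega> \<Omega>' (2 * R0) z" for z
      proof -
        obtain w where "w \<in> \<Omega>'" "dist z w < 2 * R0" "z \<in> closure \<Omega>" using z by (auto simp: close_to_def)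
        then have "z \<in> \<Omega>''" using R0 by (intro inO'') auto
        then show ?thesis using closure_subset by blast
      qed
      have ball'': "ball z \<rho> \<inter> \<Omega> \<subseteq> \<Omega>''" if z: "close_to \<Omega> \<Omega>' (2 * R0) z" and \<rho>: "\<rho> \<le> R0" for z \<rho>
      proof
        fix y assume y: "y \<in> ball z \<rho> \<inter> \<Omega>"
        obtain w where w: "w \<in> \<Omega>'" "dist z w < 2 * R0" using z by (auto simp: close_to_def)
        have "dist y w < 3 * R0" using dist_triangle[of y w z] w y \<rho> by (simp add: dist_commute)
        then show "y \<in> \<Omega>''" using y w closure_subset by (intro inO'') auto
      qed
      have absball: "(\<integral>\<^sup>+y\<in>ball z \<rho> \<inter> \<Omega>. ennreal (absQ {..<m j} (u j y) powr q) \<partial>lebesgue) \<le> ennreal J"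
        if z: "close_to \<Omega> \<Omega>' (2 * R0) z" and \<rho>: "\<rho> \<le> R0" and j: "j \<in> {1..N}" for z \<rho> j
        unfolding Jint[symmetric]
      proof (rule nn_integral_mono)
        fix y
        have "absQ {..<m j} (u j y) powr q \<le> (\<Sum>i=1..N. absQ {..<m i} (u i y) powr q)"
          using j by (intro member_le_sum) auto
        then show "ennreal (absQ {..<m j} (u j y) powr q) * indicator (ball z \<rho> \<inter> \<Omega>) y \<le>
          ennreal (\<Sum>i=1..N. absQ {..<m i} (u i y) powr q) * indicator (\<Omega>'' \<inter> \<Omega>) y"
          using ball''[OF z \<rho>] by (auto simp: indicator_def intro!: ennreal_leI)
      qed
      have excF: "excess (m j) q \<Omega> (u j) (evalQ T) z \<rho> \<le> ennreal (F0 * KK)"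
        if z: "close_to \<Omega> \<Omega>' (2 * R0) z" and \<rho>: "0 < \<rho>" "\<rho> \<le> R0" and j: "j \<in> {1..N}"
          and T: "polytuple k (Q j) (m j) T" "(Q j, m j, evalQ T) \<in> \<PP>0" for z \<rho> j T
        unfolding F0_def V_def KK_def
      proof (rule excess_bounded_approximation[OF mm[OF j] q T(1) \<beta> _ \<rho>(1) _ J0 absball[OF z \<rho>(2) j]])
        show "absQ {..<m j} (evalQ T y) \<le> \<beta>" if "y \<in> \<Omega>" for y using Pbd T(2) that by blast
        show "\<rho> \<le> 1" using \<rho> R0 by simp
      qed
      define L0 where "L0 = {R. polytuple k (Q i) (m i) R \<and> (Q i, m i, evalQ R) \<in> \<PP>0}"
      define L1 where "L1 = {R. polytuple k (Q i) (m i) R \<and> (Q i, m i, evalQ R) \<in> \<PP>i i}"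
      have toL0: "\<exists>R\<in>L0. P = evalQ R" if "(Q i, m i, P) \<in> \<PP>0" for P
        using multipolys_evalQ[of "Q i" "m i" P k] that P0 unfolding L0_def by blast
      have toL1: "\<exists>R\<in>L1. P = evalQ R" if "(Q i, m i, P) \<in> \<PP>i i" for P
        using multipolys_evalQ[of "Q i" "m i" P k] that Pi i unfolding L1_def by blast
      define M where "M = M0 * KK"
      define F where "F = F0 * KK"
      have M: "0 < M" "KK \<le> M" and F: "0 < F"
        using M0 F0 KK mult_right_mono[OF M0, of KK] by (auto simp: M_def F_def)
      have toexc: "excess (m i) q \<Omega> (u i) P z \<sigma> \<le> ennreal (B * (\<sigma> / \<rho>) powr e) * excess (m i) q \<Omega> (u i) P' z \<rho>"
        if "0 < \<sigma>" "\<sigma> \<le> \<rho> / 2" "0 < B" and "scaled_int \<Omega> k q z \<sigma> (\<lambda>x. GQ {..<m i} (u i x) (P x) powr q)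
              \<le> ennreal (B * (\<sigma>/\<rho>) powr (q * \<mu>)) * scaled_int \<Omega> k q z \<rho> (\<lambda>x. GQ {..<m i} (u i x) (P' x) powr q)"
        for B \<sigma> \<rho> z P P'
        unfolding excess_def e_def using that by (intro scaled_int_decay) auto
      have dens: "c * \<rho> ^ CARD('n) \<le> measure lebesgue (ball z \<rho> \<inter> \<Omega>)"
        if "close_to \<Omega> \<Omega>' (2 * R0) z" and \<rho>: "0 < \<rho>" "\<rho> \<le> R0" for z \<rho>
      proof -
        from that(1) obtain w where w: "z \<in> closure \<Omega>" "w \<in> \<Omega>'" "dist z w < 2 * R0" by (auto simp: close_to_def)
        have "A * (\<rho> / 2) ^ CARD('n) \<le> measure lebesgue (ball z \<rho> \<inter> \<Omega>)"
          using convex_density_near_weighted_subset[OF \<Omega>(1,2) sub' wA \<Omega>'m w(1,2,3)] R0 diam \<rho> by simp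
        then show ?thesis
          by (simp add: c_def power_divide)
      qed
      have far: "\<exists>T\<in>L0. excess (m i) q \<Omega> (u i) (evalQ T) z \<rho> \<le> ennreal F"
        if z: "close_to \<Omega> \<Omega>' (2 * R0) z" "0 < \<rho>" "\<rho> \<le> R0" for z \<rho>
      proof -
        obtain P where "(Q i, m i, P) \<in> \<PP>0" using Pex i by blast
        then obtain T where "T \<in> L0" using toL0 by blast
        then show ?thesis unfolding F_def using excF[OF z i, of T] by (auto simp: L0_def)
      qed
      have intM: "(\<integral>\<^sup>+y\<in>ball z \<rho> \<inter> \<Omega>. ennreal (absQ {..<m i} (u i y) powr q) \<partial>lebesgue) \<le> ennreal M"
        if z: "close_to \<Omega> \<Omega>' (2 * R0) z" "\<rho> \<le> R0" for z \<rho>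
      proof -
        have "ennreal J \<le> ennreal M" using KK M by (intro ennreal_leI) simp
        then show ?thesis using absball[OF z i] by (rule order_trans[rotated])
      qed
      have decI: "\<exists>T\<in>L0. decays (m i) q \<Omega> (u i) (evalQ T) z M (R0 / 2) e"
        if z: "z \<in> \<Gamma>" "close_to \<Omega> \<Omega>' (2 * R0) z" for z
      proof -
        obtain P where P: "\<And>j. j \<in> {1..N} \<Longrightarrow> (Q j, m j, P j) \<in> \<PP>0" and dP: "\<And>\<sigma> \<rho>. 0 < \<sigma> \<Longrightarrow> \<sigma> \<le> \<rho>/2 \<Longrightarrow> \<rho>/2 \<le> \<epsilon>/2 \<Longrightarrow>
            scaled_int \<Omega> k q z \<sigma> (\<lambda>x. \<Sum>i=1..N. GQ {..<m i} (u i x) (P i x) powr q)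
            \<le> ennreal (\<beta>0 * (\<sigma>/\<rho>) powr (q * \<mu>)) *
               scaled_int \<Omega> k q z \<rho> (\<lambda>x. \<Sum>i=1..N. GQ {..<m i} (u i x) (P i x) powr q)"
          using I[rule_format, of z] z cl'' by blast
        have "\<forall>j\<in>{1..N}. \<exists>T. polytuple k (Q j) (m j) T \<and> P j = evalQ T"
          using P P0 multipolys_evalQ by blast
        then obtain T where T: "\<And>j. j \<in> {1..N} \<Longrightarrow> polytuple k (Q j) (m j) (T j) \<and> P j = evalQ (T j)" by metis
        have B: "ball z \<rho> \<inter> \<Omega> \<in> sets lebesgue" for \<rho> using Om by auto
        \<comment> \<open>At the fixed radius R0 each component has bounded excess, because its polynomial is bounded by \<beta>.\<close>
        have "(\<integral>\<^sup>+y\<in>ball z R0 \<inter> \<Omega>. ennreal (\<Sum>j=1..N. GQ {..<m j} (u j y) (P j y) powr q) \<partial>lebesgue)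
          = (\<integral>\<^sup>+y. (\<Sum>j=1..N. ennreal (GQ {..<m j} (u j y) (P j y) powr q) * indicator (ball z R0 \<inter> \<Omega>) y) \<partial>lebesgue)"
          by (simp add: sum_distrib_right flip: sum_ennreal)
        also have "\<dots> = (\<Sum>j=1..N. excess (m j) q \<Omega> (u j) (P j) z R0)"
          unfolding excess_def
        proof (rule nn_integral_sum)
          fix j assume j: "j \<in> {1..N}"
          interpret mj: measurable_multifun "Q j" "m j" \<Omega> "u j" by (rule mm[OF j])
          have "(\<lambda>y. GQ {..<m j} (u j y) (P j y)) \<in> borel_measurable (lebesgue_on (ball z R0 \<inter> \<Omega>))"
            using T[OF j] mj.measurable_dist[of k "T j" "ball z R0 \<inter> \<Omega>"] B by simp
          then show "(\<lambda>y. ennreal (GQ {..<m j} (u j y) (P j y) powr q) * indicator (ball z R0 \<inter> \<Omega>) y) \<in> borel_measurable lebesgue"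
            using B by (rule borel_measurable_powr_indicator)
        qed
        also have "\<dots> \<le> (\<Sum>j=1..N. ennreal F)"
          unfolding F_def using T P z R0 by (intro sum_mono) (auto intro!: excF)
        also have "\<dots> = ennreal (real N * F)"
          using F by (simp add: ennreal_mult ennreal_of_nat_eq_real_of_nat)
        finally have tot: "(\<integral>\<^sup>+y\<in>ball z R0 \<inter> \<Omega>. ennreal (\<Sum>j=1..N. GQ {..<m j} (u j y) (P j y) powr q) \<partial>lebesgue) \<le> ennreal (real N * F)" .
        have "decays (m i) q \<Omega> (u i) (P i) z M (R0 / 2) e"
          unfolding decays_def
        proof (intro allI impI)
          fix \<sigma> assume \<sigma>: "0 < \<sigma>" "\<sigma> \<le> R0 / 2"
          \<comment> \<open>Hypothesis (I) controls the sum over all components, which dominates the i-th one.\<close>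
          have "excess (m i) q \<Omega> (u i) (P i) z \<sigma> \<le>
            (\<integral>\<^sup>+y\<in>ball z \<sigma> \<inter> \<Omega>. ennreal (\<Sum>j=1..N. GQ {..<m j} (u j y) (P j y) powr q) \<partial>lebesgue)"
            unfolding excess_def
          proof (rule nn_integral_mono)
            fix y
            have "GQ {..<m i} (u i y) (P i y) powr q \<le> (\<Sum>j=1..N. GQ {..<m j} (u j y) (P j y) powr q)"
              using i by (intro member_le_sum[where f = "\<lambda>j. GQ {..<m j} (u j y) (P j y) powr q"]) auto
            then show "ennreal (GQ {..<m i} (u i y) (P i y) powr q) * indicator (ball z \<sigma> \<inter> \<Omega>) y \<le>
              ennreal (\<Sum>j=1..N. GQ {..<m j} (u j y) (P j y) powr q) * indicator (ball z \<sigma> \<inter> \<Omega>) y"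
              by (intro mult_right_mono ennreal_leI) auto
          qed
          also have "\<dots> \<le> ennreal (\<beta>0 * (\<sigma> / R0) powr e) *
            (\<integral>\<^sup>+y\<in>ball z R0 \<inter> \<Omega>. ennreal (\<Sum>j=1..N. GQ {..<m j} (u j y) (P j y) powr q) \<partial>lebesgue)"
            unfolding e_def using \<sigma> R0 \<beta>0 dP[of \<sigma> R0] by (intro scaled_int_decay) auto
          also have "\<dots> \<le> ennreal (\<beta>0 * (\<sigma> / R0) powr e) * ennreal (real N * F)"
            by (intro mult_left_mono tot) simp
          also have "\<dots> = ennreal (\<beta>0 * (\<sigma> / R0) powr e * (real N * F))"
            using \<beta>0 F by (simp add: ennreal_mult)
          also have "\<dots> \<le> ennreal (M * \<sigma> powr e)"
          proof (rule ennreal_leI)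
            have "\<beta>0 * (\<sigma> / R0) powr e * (real N * F) = (\<beta>0 * R0 powr - e * (real N * F0)) * (KK * \<sigma> powr e)"
              using R0 \<sigma> by (simp add: F_def powr_divide powr_minus divide_simps)
            also have "\<dots> \<le> M0 * (KK * \<sigma> powr e)"
            proof (rule mult_right_mono)
              have "R0 powr - e \<le> R0 powr - E" using R0 eE by (intro powr_mono') auto
              then have "\<beta>0 * R0 powr - e * (real N * F0) \<le> \<beta>0 * R0 powr - E * (real N * F0)"
                using \<beta>0 F0 by (intro mult_right_mono mult_left_mono) auto
              then show "\<beta>0 * R0 powr - e * (real N * F0) \<le> M0" by (simp add: M0_def)
            qed (use KK in simp)
            finally show "\<beta>0 * (\<sigma> / R0) powr e * (real N * F) \<le> M * \<sigma> powr e" by (simp add: M_def mult.assoc)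
          qed
          finally show "excess (m i) q \<Omega> (u i) (P i) z \<sigma> \<le> ennreal (M * \<sigma> powr e)" .
        qed
        then show ?thesis using toL0[OF P[OF i]] by auto
      qed
      have decII: "\<exists>R\<in>L1. \<forall>T\<in>L0. \<forall>\<sigma> \<rho>. 0 < \<sigma> \<longrightarrow> \<sigma> \<le> \<rho> / 2 \<longrightarrow>
         \<rho> \<le> R0 \<longrightarrow> \<rho> \<le> infdist z \<Gamma> \<longrightarrow> excess (m i) q \<Omega> (u i) (evalQ R) z \<sigma> \<le>
           ennreal (b i * (\<sigma> / \<rho>) powr e) * excess (m i) q \<Omega> (u i) (evalQ T) z \<rho>"
        if z: "z \<in> \<Gamma>i i - \<Gamma>" "close_to \<Omega> \<Omega>' (2 * R0) z" for z
      proof -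
        from z have "z \<in> closure \<Omega>'' \<inter> \<Gamma>i i - \<Gamma>" using cl'' by blast
        from bspec[OF bspec[OF II i] this]
        obtain P1 where P1: "(Q i, m i, P1) \<in> \<PP>i i" and dP1: "\<And>P \<sigma> \<rho>. (Q i, m i, P) \<in> \<PP>0 \<Longrightarrow> 0 < \<sigma> \<Longrightarrow> \<sigma> \<le> \<rho>/2 \<Longrightarrow>
            \<rho>/2 \<le> min (1/4) (infdist z \<Gamma>) / 2 \<Longrightarrow>
              scaled_int \<Omega> k q z \<sigma> (\<lambda>x. GQ {..<m i} (u i x) (P1 x) powr q)
              \<le> ennreal (b i * (\<sigma>/\<rho>) powr (q * \<mu>)) *
                 scaled_int \<Omega> k q z \<rho> (\<lambda>x. GQ {..<m i} (u i x) (P x) powr q)"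
          by blast
        obtain R where R: "R \<in> L1" "P1 = evalQ R" using toL1[OF P1] by blast
        show ?thesis
        proof (rule bexI[OF _ R(1)], intro ballI allI impI)
          fix T \<sigma> \<rho> assume "T \<in> L0" "0 < \<sigma>" "\<sigma> \<le> \<rho> / 2" "\<rho> \<le> R0" "\<rho> \<le> infdist z \<Gamma>"
          then show "excess (m i) q \<Omega> (u i) (evalQ R) z \<sigma> \<le>
           ennreal (b i * (\<sigma> / \<rho>) powr e) * excess (m i) q \<Omega> (u i) (evalQ T) z \<rho>"
            using bb[OF i] R0 R(2) by (intro toexc dP1[unfolded R(2)]) (auto simp: L0_def)
        qed
      qed
      have decIII: "\<exists>R. polytuple k (Q i) (m i) R \<and> (\<forall>T\<in>L0 \<union> L1. \<forall>\<sigma> \<rho>. 0 < \<sigma> \<longrightarrow> \<sigma> \<le> \<rho> / 2 \<longrightarrow>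
         \<rho> \<le> R0 \<longrightarrow> \<rho> \<le> infdist z (\<Gamma> \<union> \<Gamma>i i) \<longrightarrow> excess (m i) q \<Omega> (u i) (evalQ R) z \<sigma> \<le>
           ennreal (bt i * (\<sigma> / \<rho>) powr e) * excess (m i) q \<Omega> (u i) (evalQ T) z \<rho>)"
        if z: "z \<notin> \<Gamma> \<union> \<Gamma>i i" "close_to \<Omega> \<Omega>' (2 * R0) z" for z
      proof -
        from z have "z \<in> closure \<Omega>'' - (\<Gamma> \<union> \<Gamma>i i)" using cl'' by blast
        from bspec[OF bspec[OF III i] this]
        obtain P2 where P2: "(Q i, m i, P2) \<in> \<PP>" and dP2: "\<And>P \<sigma> \<rho>. (Q i, m i, P) \<in> \<PP>0 \<union> \<PP>i i \<Longrightarrow> 0 < \<sigma> \<Longrightarrow> \<sigma> \<le> \<rho>/2 \<Longrightarrow>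
            \<rho>/2 \<le> min (1/4) (infdist z (\<Gamma> \<union> \<Gamma>i i)) / 2 \<Longrightarrow>
              scaled_int \<Omega> k q z \<sigma> (\<lambda>x. GQ {..<m i} (u i x) (P2 x) powr q)
              \<le> ennreal (bt i * (\<sigma>/\<rho>) powr (q * \<mu>)) *
                 scaled_int \<Omega> k q z \<rho> (\<lambda>x. GQ {..<m i} (u i x) (P x) powr q)"
          by blast
        obtain R where R: "polytuple k (Q i) (m i) R" "P2 = evalQ R" using multipolys_evalQ P2 PP by blast
        show ?thesis
        proof (rule exI[of _ R], rule conjI[OF R(1)], intro ballI allI impI)
          fix T \<sigma> \<rho> assume "T \<in> L0 \<union> L1" "0 < \<sigma>" "\<sigma> \<le> \<rho> / 2" "\<rho> \<le> R0" "\<rho> \<le> infdist z (\<Gamma> \<union> \<Gamma>i i)"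
          then show "excess (m i) q \<Omega> (u i) (evalQ R) z \<sigma> \<le>
           ennreal (bt i * (\<sigma> / \<rho>) powr e) * excess (m i) q \<Omega> (u i) (evalQ T) z \<rho>"
            using bb[OF i] R0 R(2) by (intro toexc dP2[unfolded R(2)]) (auto simp: L0_def L1_def)
        qed
      qed
      have sd: "stratified_decay (Q i) (m i) \<Omega> (u i) k q c (b i) (bt i) R0 \<Omega>' \<Gamma> (\<Gamma>i i) L0 L1 M F \<mu> e"
      proof (intro stratified_decay.intro stratified_decay_axioms.intro mm[OF i] \<mu> e_def M(1) F \<Gamma>(2,3)
          sub' \<Omega>'0 bd' \<Omega>'m dens far intM decI decII decIII)
        show "polytuple k (Q i) (m i) T" if "T \<in> L0 \<union> L1" for T using that by (auto simp: L0_def L1_def)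
        show "\<Gamma> \<union> \<Gamma>i i \<subseteq> closure \<Omega>" "closure (\<Gamma>i i) \<subseteq> \<Gamma> \<union> \<Gamma>i i" using \<Gamma> \<Gamma>i i by auto
      qed
      from bspec[OF Cf i] sd
      have "\<exists>v U. (AE x in lebesgue. x \<in> \<Omega>' \<inter> \<Omega> \<longrightarrow> v x = u i x) \<and> holderQ (Q i) (m i) k \<mu> \<Omega>' v U \<and>
         holder_normQ (m i) k \<mu> \<Omega>' U \<le> Cf i * (M + F) powr (1 / q)"
        unfolding regularity_bound_def by blast
      moreover have "Cf i * (M + F) powr (1 / q) \<le> C * KK powr (1 / q)"
      proof -
        have "(M + F) powr (1 / q) = (M0 + F0) powr (1 / q) * KK powr (1 / q)"
          unfolding M_def F_def distrib_right[symmetric] by (rule powr_mult)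
        then show ?thesis using mult_right_mono[OF C(2)[OF i], of "KK powr (1 / q)"] by (simp add: mult.assoc)
      qed
      ultimately show "\<exists>v U.
         (AE x in lebesgue. x \<in> \<Omega>' \<inter> \<Omega> \<longrightarrow> v x = u i x) \<and>
         holderQ (Q i) (m i) k \<mu> \<Omega>' v U \<and>
         holder_normQ (m i) k \<mu> \<Omega>' U
         \<le> C * (\<beta> powr q + enn2real (\<integral>\<^sup>+ x \<in> \<Omega>'' \<inter> \<Omega>.
                  ennreal (\<Sum>i=1..N. absQ {..<m i} (u i x) powr q) \<partial>lebesgue)) powr (1/q)"
        unfolding KK_def J_def by (blast intro: order_trans)
    qed
  qed
  done
qed

end
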